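(* Let $T>0$, $d\ge1$ and $s>\frac d2$. Let $g,V\in L^{\infty}(\mathbb{R}^d)$ be real-valued and non-negative, and suppose $u_0\in H^s(\mathbb{R}^d)\cap L^4(\mathbb{R}^d)$. Let $u\in C([0,T];H^s(\mathbb{R}^d))$ be the classical solution of $$iu_{t}(t,x) = (-\Delta)^{s} u(t,x) + V(x)u(t,x) + g(x)\vert u(t,x)\vert^2 u(t,x),\qquad u(0,x)=u_{0}(x),\qquad (t,x)\in[0,T]\times\mathbb{R}^d.$$ Then for any regularising nets $V_\varepsilon=V\ast\psi_\varepsilon$, $g_\varepsilon=g\ast\psi_\varepsilon$ satisfying $\Vert V_\varepsilon-V\Vert_{L^\infty}\to0$ and $\Vert g_\varepsilon-g\Vert_{L^\infty}\to0$ as $\varepsilon\to0$, and any regularising net $u_{0,\varepsilon}=u_0\ast\psi_\varepsilon$, the net $(u_\varepsilon)_\varepsilon$ of solutions to $$i\partial_t u_\varepsilon=(-\Delta)^s u_\varepsilon+V_\varepsilon u_\varepsilon+g_\varepsilon|u_\varepsilon|^2u_\varepsilon,\qquad u_\varepsilon(0,\cdot)=u_{0,\varepsilon},$$ on $[0,T]\times\mathbb{R}^d$ converges to $u$ in $L^2(\mathbb{R}^d)$ as $\varepsilon\to0$.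
   Context: $(-\Delta)^s$ is the Fourier multiplier with symbol $|\xi|^{2s}$, and $H^s(\mathbb{R}^d)$ is the $L^2$-based fractional Sobolev space. The classical solution $u$ is the solution in $C([0,T];H^s(\mathbb{R}^d))$ whose existence (with conservation $\Vert u(t)\Vert_{L^2}=\Vert u_0\Vert_{L^2}$ and the bound $\Vert u(t)\Vert_{H^s}\lesssim(1+\Vert V\Vert_{L^\infty})^{1/2}\Vert u_0\Vert_{H^s}+\Vert g\Vert_{L^\infty}^{1/2}\Vert u_0\Vert_{L^4}^2$) holds for such data. The mollifying net is $\psi_\varepsilon(x)=\omega(\varepsilon)^{-d}\psi(x/\omega(\varepsilon))$, $\varepsilon\in(0,1]$, with $\psi\in C_0^\infty(\mathbb{R}^d)$ non-negative, $\int\psi=1$, and $\omega(\varepsilon)>0$, $\omega(\varepsilon)\to0$ as $\varepsilon\to0$. *)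

theory Defs
  imports "HOL-Analysis.Analysis" "HOL-Probability.Essential_Supremum"
begin

fun Ck :: "nat \<Rightarrow> ('a::euclidean_space \<Rightarrow> 'b::real_normed_vector) \<Rightarrow> bool" where
  "Ck 0 f = continuous_on UNIV f"
| "Ck (Suc k) f = (\<exists>f'. (\<forall>x. (f has_derivative f' x) (at x)) \<and> (\<forall>v. Ck k (\<lambda>x. f' x v)))"

definition test_fun :: "('a::euclidean_space \<Rightarrow> 'b::real_normed_vector) \<Rightarrow> bool" where
  "test_fun f \<longleftrightarrow> (\<forall>k. Ck k f) \<and> compact (closure {x. f x \<noteq> 0})"

definition fourier :: "('a::euclidean_space \<Rightarrow> complex) \<Rightarrow> 'a \<Rightarrow> complex" where
  "fourier f \<xi> = (\<integral>x. exp (- \<i> * complex_of_real (x \<bullet> \<xi>)) * f x \<partial>lborel)"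

definition L2 :: "('a::euclidean_space \<Rightarrow> complex) \<Rightarrow> bool" where
  "L2 f \<longleftrightarrow> f \<in> borel_measurable lborel \<and> (\<integral>\<^sup>+x. ennreal ((cmod (f x))\<^sup>2) \<partial>lborel) < \<infinity>"

definition L4 :: "('a::euclidean_space \<Rightarrow> complex) \<Rightarrow> bool" where
  "L4 f \<longleftrightarrow> f \<in> borel_measurable lborel \<and> (\<integral>\<^sup>+x. ennreal ((cmod (f x)) ^ 4) \<partial>lborel) < \<infinity>"

definition Linf :: "('a::euclidean_space \<Rightarrow> real) \<Rightarrow> bool" where
  "Linf f \<longleftrightarrow> f \<in> borel_measurable lborel \<and> esssup lborel (\<lambda>x. ereal \<bar>f x\<bar>) < \<infinity>"

definition is_FT :: "('a::euclidean_space \<Rightarrow> complex) \<Rightarrow> ('a \<Rightarrow> complex) \<Rightarrow> bool" where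
  "is_FT w F \<longleftrightarrow> L2 F \<and>
     (\<forall>\<phi>. test_fun \<phi> \<longrightarrow> (\<integral>x. w x * fourier \<phi> x \<partial>lborel) = (\<integral>\<xi>. F \<xi> * \<phi> \<xi> \<partial>lborel))"

definition FT :: "('a::euclidean_space \<Rightarrow> complex) \<Rightarrow> 'a \<Rightarrow> complex" where
  "FT w = (SOME F. is_FT w F)"

definition in_Hs :: "real \<Rightarrow> ('a::euclidean_space \<Rightarrow> complex) \<Rightarrow> bool" where
  "in_Hs s w \<longleftrightarrow> L2 w \<and> (\<exists>F. is_FT w F \<and>
      (\<integral>\<^sup>+\<xi>. ennreal ((1 + (norm \<xi>)\<^sup>2) powr s * (cmod (F \<xi>))\<^sup>2) \<partial>lborel) < \<infinity>)"

definition Hs_norm2 :: "real \<Rightarrow> ('a::euclidean_space \<Rightarrow> complex) \<Rightarrow> ennreal" where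
  "Hs_norm2 s w = (\<integral>\<^sup>+\<xi>. ennreal ((1 + (norm \<xi>)\<^sup>2) powr s * (cmod (FT w \<xi>))\<^sup>2) \<partial>lborel)"

(* pairing <(-\<Delta>)^s w, \<phi>> = (2\<pi>)^{-d} \<integral> |\<xi>|^{2s} \<hat>w(\<xi>) \<hat>\<phi>(-\<xi>) d\<xi>,
   the Fourier multiplier with symbol |\<xi>|^{2s} tested against \<phi> *)
definition frac_lap_pair :: "real \<Rightarrow> ('a::euclidean_space \<Rightarrow> complex) \<Rightarrow> ('a \<Rightarrow> complex) \<Rightarrow> complex" where
  "frac_lap_pair s w \<phi> = complex_of_real ((2 * pi) powr (- real DIM('a))) *
     (\<integral>\<xi>. complex_of_real (norm \<xi> powr (2 * s)) * FT w \<xi> * fourier \<phi> (- \<xi>) \<partial>lborel)"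

(* u \<in> C([0,T];H^s) solving i u_t = (-\<Delta>)^s u + V u + g |u|^2 u, u(0) = u0,
   the equation understood weakly in x (tested against C_0^\<infinity> functions) *)
definition nls_solution :: "real \<Rightarrow> ('a::euclidean_space \<Rightarrow> real) \<Rightarrow> ('a \<Rightarrow> real) \<Rightarrow> ('a \<Rightarrow> complex)
     \<Rightarrow> real \<Rightarrow> (real \<Rightarrow> 'a \<Rightarrow> complex) \<Rightarrow> bool" where
  "nls_solution s V g u0 T u \<longleftrightarrow>
     (\<forall>t\<in>{0..T}. in_Hs s (u t)) \<and>
     (\<forall>t\<in>{0..T}. ((\<lambda>t'. Hs_norm2 s (\<lambda>x. u t' x - u t x)) \<longlongrightarrow> 0) (at t within {0..T})) \<and>
     (AE x in lborel. u 0 x = u0 x) \<and>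
     (\<forall>\<phi>. test_fun \<phi> \<longrightarrow> (\<forall>t\<in>{0..T}.
        ((\<lambda>\<tau>. \<integral>x. u \<tau> x * \<phi> x \<partial>lborel) has_vector_derivative
          (- \<i>) * (frac_lap_pair s (u t) \<phi> +
             (\<integral>x. (complex_of_real (V x) * u t x
                    + complex_of_real (g x * (cmod (u t x))\<^sup>2) * u t x) * \<phi> x \<partial>lborel)))
        (at t within {0..T})))"

definition moll :: "('a::euclidean_space \<Rightarrow> real) \<Rightarrow> (real \<Rightarrow> real) \<Rightarrow> real \<Rightarrow> 'a \<Rightarrow> real" where
  "moll \<psi> \<omega> \<epsilon> x = \<omega> \<epsilon> powr (- real DIM('a)) * \<psi> (x /\<^sub>R \<omega> \<epsilon>)"

definition conv_real :: "('a::euclidean_space \<Rightarrow> real) \<Rightarrow> ('a \<Rightarrow> real) \<Rightarrow> 'a \<Rightarrow> real" where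
  "conv_real f h x = (\<integral>y. f (x - y) * h y \<partial>lborel)"

definition conv_cplx :: "('a::euclidean_space \<Rightarrow> complex) \<Rightarrow> ('a \<Rightarrow> real) \<Rightarrow> 'a \<Rightarrow> complex" where
  "conv_cplx f h x = (\<integral>y. f (x - y) * complex_of_real (h y) \<partial>lborel)"

end

theory Submission
  imports Defs "HOL-Probability.Characteristic_Functions"
begin

text \<open>On the Fourier side the weak equation becomes, after the frequency truncation \<open>P\<^sub>M = 1\<^bsub>|\<xi>| \<le> M\<^esub>\<close>, a strong
  differential equation in \<open>L\<^sup>2\<close>, so that \<open>P\<^sub>M u\<close> can be differentiated without regularity assumptions. Letting
  \<open>M \<rightarrow> \<infinity>\<close>, every \<open>H\<^sup>s\<close> solution conserves the mass \<open>\<parallel>u\<parallel>\<^sup>2\<close> and the energy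
  \<open>\<parallel>|\<xi>|\<^sup>s u^\<parallel>\<^sup>2 / 2 + \<integral> V |u|\<^sup>2 / 2 + g |u|\<^sup>4 / 4\<close> (up to normalisation). As \<open>V, g \<ge> 0\<close>, and as mollification does
  not increase the \<open>H\<^sup>s\<close> norm of the initial datum, the \<open>u\<^sub>\<epsilon>\<close> are bounded in \<open>H\<^sup>s\<close> uniformly in \<open>\<epsilon>\<close> and \<open>t\<close>,
  and since \<open>s > d/2\<close> also in \<open>L\<^sup>\<infinity>\<close>. On bounded sets of \<open>L\<^sup>\<infinity>\<close> the nonlinearity is Lipschitz in \<open>L\<^sup>2\<close>, whence
  Gronwall's inequality bounds \<open>\<parallel>u\<^sub>\<epsilon> - u\<parallel>\<^sup>2\<close> by a multiple of
  \<open>\<parallel>u\<^sub>0\<^sub>,\<^sub>\<epsilon> - u\<^sub>0\<parallel>\<^sup>2 + (\<parallel>V\<^sub>\<epsilon> - V\<parallel>\<^sub>\<infinity> + \<parallel>g\<^sub>\<epsilon> - g\<parallel>\<^sub>\<infinity>)\<^sup>2\<close>.\<close>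

section \<open>Square-integrable functions modulo null sets\<close>

text \<open>The equation is given only against smooth compactly supported functions. The transform
  of a nonzero one is never compactly supported, so a frequency truncation cannot be tested
  directly. Instead, multiply by <xi>^(-2s), where <xi> = (1 + |xi|^2)^(1/2): the right-hand side
  becomes a continuous curve in L2, a separating family of functionals then upgrades the weak
  derivative to a norm derivative, and on each ball of frequencies the weight can be undone. The
  separating family consists of translates and dilates of the mollifier itself; what makes it
  separating is that its transform is 1 at the origin. Energy conservation is not formal either.
  With V and g merely bounded, the nonlinearity lies only in L2 and (-Delta)^s u only in H^(-s), so
  their pairing has no meaning for u itself. For the same reason H^s bounds cannot come from a
  Gronwall argument in H^s, and the energy is the source of them.\<close>

lemma borel_measurable_cnj [measurable (raw)]:
  "f \<in> borel_measurable M \<Longrightarrow> (\<lambda>x. cnj (f x)) \<in> borel_measurable M"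
  by (rule measurable_compose[OF _ borel_measurable_continuous_onI]) (auto intro: continuous_intros)

lemma L2_iff_integrable:
  "L2 f \<longleftrightarrow> f \<in> borel_measurable lborel \<and> integrable lborel (\<lambda>x. (cmod (f x))\<^sup>2)"
  unfolding L2_def by (auto simp: integrable_iff_bounded)

lemma L2_measurable [measurable_dest]: "L2 f \<Longrightarrow> f \<in> borel_measurable lborel"
  by (simp add: L2_def)

lemma L2_integrable_sq: "L2 f \<Longrightarrow> integrable lborel (\<lambda>x. (cmod (f x))\<^sup>2)"
  by (simp add: L2_iff_integrable)

lemma L2_bounded_by:
  assumes "integrable lborel h" "f \<in> borel_measurable lborel" "AE x in lborel. (cmod (f x))\<^sup>2 \<le> h x"
  shows "L2 f"
  unfolding L2_iff_integrable
proof
  show "integrable lborel (\<lambda>x. (cmod (f x))\<^sup>2)"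
  proof (rule Bochner_Integration.integrable_bound[OF assms(1)])
    show "(\<lambda>x. (cmod (f x))\<^sup>2) \<in> borel_measurable lborel" using assms(2) by measurable
    show "AE x in lborel. norm ((cmod (f x))\<^sup>2) \<le> norm (h x)"
      using assms(3) by eventually_elim (simp add: abs_of_nonneg)
  qed
qed (rule assms)

lemma L2_integrable_mult:
  assumes "L2 f" "L2 g"
  shows "integrable lborel (\<lambda>x. f x * g x)"
proof (rule Bochner_Integration.integrable_bound)
  show "integrable lborel (\<lambda>x. (cmod (f x))\<^sup>2 + (cmod (g x))\<^sup>2)"
    using assms by (auto simp: L2_iff_integrable)
  show "AE x in lborel. norm (f x * g x) \<le> norm ((cmod (f x))\<^sup>2 + (cmod (g x))\<^sup>2)"
  proof (rule AE_I2)
    fix x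
    have "0 \<le> (cmod (f x) - cmod (g x))\<^sup>2 + (cmod (f x))\<^sup>2 + (cmod (g x))\<^sup>2" by simp
    then show "norm (f x * g x) \<le> norm ((cmod (f x))\<^sup>2 + (cmod (g x))\<^sup>2)"
      by (simp add: norm_mult power2_diff abs_of_nonneg)
  qed
qed (use assms in \<open>auto simp: L2_def\<close>)

lemma L2_add: assumes "L2 f" "L2 g" shows "L2 (\<lambda>x. f x + g x)"
proof (rule L2_bounded_by)
  show "integrable lborel (\<lambda>x. 2 * (cmod (f x))\<^sup>2 + 2 * (cmod (g x))\<^sup>2)"
    using assms by (auto simp: L2_iff_integrable)
  show "AE x in lborel. (cmod (f x + g x))\<^sup>2 \<le> 2 * (cmod (f x))\<^sup>2 + 2 * (cmod (g x))\<^sup>2"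
  proof (rule AE_I2)
    fix x
    have "(cmod (f x + g x))\<^sup>2 \<le> (cmod (f x) + cmod (g x))\<^sup>2"
      by (intro power_mono norm_triangle_ineq) auto
    also have "\<dots> \<le> 2 * (cmod (f x))\<^sup>2 + 2 * (cmod (g x))\<^sup>2"
      using sum_squares_bound[of "cmod (f x)" "cmod (g x)"] by (simp add: power2_sum)
    finally show "(cmod (f x + g x))\<^sup>2 \<le> 2 * (cmod (f x))\<^sup>2 + 2 * (cmod (g x))\<^sup>2" .
  qed
qed (use assms in \<open>auto simp: L2_def\<close>)

lemma L2_zero [simp]: "L2 (\<lambda>x. 0)"
  by (simp add: L2_def)

lemma L2_mult_bounded:
  assumes "L2 f" "m \<in> borel_measurable lborel" "AE x in lborel. cmod (m x) \<le> c"
  shows "L2 (\<lambda>x. m x * f x)"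
proof (rule L2_bounded_by)
  show "integrable lborel (\<lambda>x. c\<^sup>2 * (cmod (f x))\<^sup>2)"
    using assms by (auto simp: L2_iff_integrable)
  show "AE x in lborel. (cmod (m x * f x))\<^sup>2 \<le> c\<^sup>2 * (cmod (f x))\<^sup>2"
    using assms(3)
    by eventually_elim (auto simp: norm_mult power_mult_distrib intro!: mult_right_mono power_mono)
qed (use assms in \<open>auto simp: L2_def\<close>)

lemma L2_cmult: "L2 f \<Longrightarrow> L2 (\<lambda>x. c * f x)"
  by (rule L2_mult_bounded[where c="cmod c"]) auto

lemma L2_uminus: "L2 f \<Longrightarrow> L2 (\<lambda>x. - f x)"
  using L2_cmult[of f "-1"] by simp

lemma L2_diff: "L2 f \<Longrightarrow> L2 g \<Longrightarrow> L2 (\<lambda>x. f x - g x)"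
  using L2_add[OF _ L2_uminus[of g], of f] by simp

lemma L2_scaleR: "L2 f \<Longrightarrow> L2 (\<lambda>x. r *\<^sub>R f x)"
  using L2_cmult[of f "of_real r"] by (simp add: scaleR_conv_of_real)

lemma L2_cnj: "L2 f \<Longrightarrow> L2 (\<lambda>x. cnj (f x))"
  unfolding L2_def by auto

lemma L2_cong_AE:
  assumes "L2 f" "g \<in> borel_measurable lborel" "AE x in lborel. f x = g x"
  shows "L2 g"
  by (rule L2_bounded_by[OF L2_integrable_sq[OF assms(1)] assms(2)])
     (use assms(3) in \<open>eventually_elim, auto\<close>)

text \<open>Reflexive exactly on the square-integrable functions, hence the partial quotient below.
  Making L2 a type of its own gives access to the calculus of curves in a real Hilbert
  space.\<close>

definition l2_rel :: "('a::euclidean_space \<Rightarrow> complex) \<Rightarrow> ('a \<Rightarrow> complex) \<Rightarrow> bool" where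
  "l2_rel f g \<longleftrightarrow> L2 f \<and> L2 g \<and> (AE x in lborel. f x = g x)"

quotient_type (overloaded) 'a l2 = "'a::euclidean_space \<Rightarrow> complex" / partial: l2_rel
proof (rule part_equivpI)
  show "\<exists>x. l2_rel x x"
    by (rule exI[of _ "\<lambda>_. 0"]) (simp add: l2_rel_def)
  show "symp l2_rel"
    by (auto simp: symp_def l2_rel_def eq_commute)
  show "transp l2_rel"
    unfolding transp_def l2_rel_def by (fastforce intro: eventually_elim2)
qed

abbreviation cls :: "('a::euclidean_space \<Rightarrow> complex) \<Rightarrow> 'a l2" where "cls \<equiv> abs_l2"
abbreviation rep :: "'a::euclidean_space l2 \<Rightarrow> 'a \<Rightarrow> complex" where "rep \<equiv> rep_l2"

lemma cls_rep [simp]: "cls (rep x) = x"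
  by (rule Quotient3_abs_rep[OF Quotient3_l2])

lemma L2_rep [simp]: "L2 (rep x)"
  using Quotient3_rep_reflp[OF Quotient3_l2, of x] by (simp add: l2_rel_def)

lemma rep_measurable [measurable]: "rep x \<in> borel_measurable lborel"
  using L2_rep by (rule L2_measurable)

lemma rep_measurable_borel [measurable]: "rep x \<in> borel_measurable borel"
  using rep_measurable[of x] by simp

lemma rep_cls: "L2 f \<Longrightarrow> AE x in lborel. rep (cls f) x = f x"
  using rep_abs_rsp_left[OF Quotient3_l2, of f f] by (auto simp: l2_rel_def)

lemma cls_eq_iff: "L2 f \<Longrightarrow> L2 g \<Longrightarrow> cls f = cls g \<longleftrightarrow> (AE x in lborel. f x = g x)"
  using Quotient3_rel[OF Quotient3_l2, of f g] by (simp add: l2_rel_def)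

lemma cls_eqI: "L2 f \<Longrightarrow> L2 g \<Longrightarrow> AE x in lborel. f x = g x \<Longrightarrow> cls f = cls g"
  by (simp add: cls_eq_iff)

lemma l2_eqI: "AE t in lborel. rep x t = rep y t \<Longrightarrow> x = y"
  using cls_eqI[of "rep x" "rep y"] by simp

lemma l2_cases: obtains f where "L2 f" "x = cls f"
  by (rule that[of "rep x"]) auto

text \<open>The type class asks for a real inner product, so the real part of the sesquilinear form
  is taken. Nothing is lost: the imaginary part returns through multiplication by \<i>, see
  \<open>cip\<close>.\<close>

instantiation l2 :: (euclidean_space) real_inner
begin

definition "0 = cls (\<lambda>_. 0)"
definition "x + y = cls (\<lambda>t. rep x t + rep y t)"
definition "x - y = cls (\<lambda>t. rep x t - rep y t)"
definition "- x = cls (\<lambda>t. - rep x t)"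
definition "r *\<^sub>R x = cls (\<lambda>t. r *\<^sub>R rep x t)"
definition "inner x y = Re (\<integral>t. rep x t * cnj (rep y t) \<partial>lborel)"
definition "norm (x::'a l2) = sqrt (inner x x)"
definition "dist (x::'a l2) y = norm (x - y)"
definition "sgn (x::'a l2) = inverse (norm x) *\<^sub>R x"
definition "uniformity = (INF e\<in>{0 <..}. principal {(x::'a l2, y). dist x y < e})"
definition "open (U::'a l2 set) = (\<forall>x\<in>U. eventually (\<lambda>(x', y). x' = x \<longrightarrow> y \<in> U) uniformity)"

lemma cls_add: "L2 f \<Longrightarrow> L2 g \<Longrightarrow> cls f + cls g = cls (\<lambda>x. f x + g x)"
  unfolding plus_l2_def
  using rep_cls[of f] rep_cls[of g] by (intro cls_eqI L2_add L2_rep) (auto elim: eventually_elim2)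

lemma cls_diff: "L2 f \<Longrightarrow> L2 g \<Longrightarrow> cls f - cls g = cls (\<lambda>x. f x - g x)"
  unfolding minus_l2_def
  using rep_cls[of f] rep_cls[of g] by (intro cls_eqI L2_diff L2_rep) auto

lemma cls_uminus: "L2 f \<Longrightarrow> - cls f = cls (\<lambda>x. - f x)"
  unfolding uminus_l2_def
  using rep_cls[of f] by (intro cls_eqI L2_uminus L2_rep) auto

lemma cls_scaleR: "L2 f \<Longrightarrow> r *\<^sub>R cls f = cls (\<lambda>x. r *\<^sub>R f x)"
  unfolding scaleR_l2_def
  using rep_cls[of f] by (intro cls_eqI L2_scaleR L2_rep) auto

lemma inner_cls:
  assumes "L2 f" "L2 g"
  shows "inner (cls f) (cls g) = Re (\<integral>t. f t * cnj (g t) \<partial>lborel)"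
proof -
  have "(\<integral>t. rep (cls f) t * cnj (rep (cls g) t) \<partial>lborel) = (\<integral>t. f t * cnj (g t) \<partial>lborel)"
  proof (intro integral_cong_AE)
    show "(\<lambda>t. f t * cnj (g t)) \<in> borel_measurable lborel"
      using L2_measurable[OF assms(1)] L2_measurable[OF assms(2)] by measurable
    show "AE t in lborel. rep (cls f) t * cnj (rep (cls g) t) = f t * cnj (g t)"
      using rep_cls[OF assms(1)] rep_cls[OF assms(2)] by eventually_elim simp
  qed measurable
  then show ?thesis by (simp add: inner_l2_def)
qed

instance
proof
  fix x y z :: "'a l2" and r s :: real
  obtain f where f: "L2 f" "x = cls f" by (rule l2_cases)
  obtain g where g: "L2 g" "y = cls g" by (rule l2_cases)
  obtain h where h: "L2 h" "z = cls h" by (rule l2_cases)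
  note cls_ops = cls_add cls_diff cls_uminus cls_scaleR L2_add L2_diff L2_uminus L2_scaleR L2_cnj
  show "x + y + z = x + (y + z)" using f g h by (simp add: cls_ops add.assoc)
  show "x + y = y + x" using f g by (simp add: cls_ops add.commute)
  show "0 + x = x" using f by (simp add: zero_l2_def cls_ops)
  show "- x + x = 0" using f by (simp add: zero_l2_def cls_ops)
  show "x - y = x + - y" using f g by (simp add: cls_ops)
  show "r *\<^sub>R (x + y) = r *\<^sub>R x + r *\<^sub>R y" using f g by (simp add: cls_ops scaleR_add_right)
  show "(r + s) *\<^sub>R x = r *\<^sub>R x + s *\<^sub>R x" using f by (simp add: cls_ops scaleR_add_left)
  show "r *\<^sub>R s *\<^sub>R x = (r * s) *\<^sub>R x" using f by (simp add: cls_ops)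
  show "1 *\<^sub>R x = x" using f by (simp add: cls_ops)
  show "inner x y = inner y x"
  proof -
    have "(\<integral>t. g t * cnj (f t) \<partial>lborel) = cnj (\<integral>t. f t * cnj (g t) \<partial>lborel)"
      by (subst Bochner_Integration.integral_cnj[symmetric]) (simp add: mult.commute)
    then show ?thesis using f g by (simp add: inner_cls)
  qed
  show "inner (x + y) z = inner x z + inner y z"
    using f g h by (simp add: cls_ops inner_cls distrib_right L2_integrable_mult)
  show "inner (r *\<^sub>R x) y = r * inner x y"
    using f g h by (simp add: cls_ops inner_cls)
  have sq: "inner x x = (\<integral>t. (cmod (f t))\<^sup>2 \<partial>lborel)"
  proof -
    have "(\<lambda>t. f t * cnj (f t)) = (\<lambda>t. complex_of_real ((cmod (f t))\<^sup>2))"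
      by (simp only: complex_mult_cnj cmod_power2)
    then show ?thesis using f by (simp only: inner_cls integral_complex_of_real Re_complex_of_real)
  qed
  show "0 \<le> inner x x" by (simp add: sq)
  show "(inner x x = 0) = (x = 0)"
    unfolding sq using f L2_integrable_sq[OF f(1)]
    by (subst integral_nonneg_eq_0_iff_AE) (auto simp: zero_l2_def cls_eq_iff)
qed (simp_all add: norm_l2_def dist_l2_def sgn_l2_def uniformity_l2_def open_l2_def)

end

lemma norm_cls_sq: "L2 f \<Longrightarrow> (norm (cls f))\<^sup>2 = (\<integral>t. (cmod (f t))\<^sup>2 \<partial>lborel)"
proof -
  assume f: "L2 f"
  have "(\<lambda>t. f t * cnj (f t)) = (\<lambda>t. complex_of_real ((cmod (f t))\<^sup>2))"
    by (simp only: complex_mult_cnj cmod_power2)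
  then show ?thesis using f
    by (simp only: power2_norm_eq_inner inner_cls integral_complex_of_real Re_complex_of_real)
qed

lemma norm_l2_sq: "(norm x)\<^sup>2 = (\<integral>t. (cmod (rep x t))\<^sup>2 \<partial>lborel)"
  using norm_cls_sq[of "rep x"] by simp

lemma nn_integral_cls: "L2 f \<Longrightarrow> (\<integral>\<^sup>+t. ennreal ((cmod (f t))\<^sup>2) \<partial>lborel) = ennreal ((norm (cls f))\<^sup>2)"
  by (simp add: norm_cls_sq nn_integral_eq_integral L2_integrable_sq)

lemma rep_add: "AE t in lborel. rep (x + y) t = rep x t + rep y t"
  unfolding plus_l2_def by (intro rep_cls L2_add L2_rep)

lemma rep_diff: "AE t in lborel. rep (x - y) t = rep x t - rep y t"
  unfolding minus_l2_def by (intro rep_cls L2_diff L2_rep)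

lemma rep_scaleR: "AE t in lborel. rep (r *\<^sub>R x) t = r *\<^sub>R rep x t"
  unfolding scaleR_l2_def by (intro rep_cls L2_scaleR L2_rep)

lemma norm_l2_mono:
  assumes "AE t in lborel. cmod (rep x t) \<le> c * cmod (rep y t)" "c \<ge> 0"
  shows "norm x \<le> c * norm y"
proof (rule power2_le_imp_le)
  have "AE t in lborel. (cmod (rep x t))\<^sup>2 \<le> c\<^sup>2 * (cmod (rep y t))\<^sup>2"
    using assms(1)
  proof eventually_elim
    case (elim t)
    from power_mono[OF this, of 2] show ?case by (simp add: power_mult_distrib)
  qed
  then have "(norm x)\<^sup>2 \<le> (\<integral>t. c\<^sup>2 * (cmod (rep y t))\<^sup>2 \<partial>lborel)"
    unfolding norm_l2_sq[of x]
    by (rule integral_mono_AE[rotated 2]) (simp_all add: L2_integrable_sq)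
  then show "(norm x)\<^sup>2 \<le> (c * norm y)\<^sup>2"
    by (simp add: norm_l2_sq[of y] power_mult_distrib)
  show "0 \<le> c * norm y" using assms(2) by simp
qed

text \<open>Riesz--Fischer: along a subsequence with \<open>\<parallel>d\<^sub>n\<parallel> \<le> 2\<^sup>-\<^sup>n\<close> the sum of \<open>2\<^sup>n |d\<^sub>n|\<^sup>2\<close>
  is integrable, so \<open>|d\<^sub>n| \<le> C 2\<^sup>-\<^sup>n\<^sup>/\<^sup>2\<close> almost everywhere.\<close>

instance l2 :: (euclidean_space) complete_space
proof
  fix X :: "nat \<Rightarrow> 'a l2" assume X: "Cauchy X"
  have "\<exists>r. strict_mono r \<and> (\<forall>n. norm (X (r (Suc n)) - X (r n)) < (1/2)^n)"
  proof -
    have ex: "\<exists>N. \<forall>m\<ge>N. \<forall>n\<ge>N. norm (X m - X n) < (1/2)^k" for k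
      using X by (auto simp: Cauchy_iff)
    then obtain N where N: "\<And>k m n. m \<ge> N k \<Longrightarrow> n \<ge> N k \<Longrightarrow> norm (X m - X n) < (1/2)^k" by metis
    define r where "r = rec_nat (N 0) (\<lambda>k p. max (Suc p) (N (Suc k)))"
    have r0: "r 0 = N 0" and rS: "\<And>k. r (Suc k) = max (Suc (r k)) (N (Suc k))" by (simp_all add: r_def)
    have mono: "strict_mono r" by (rule strict_mono_Suc_iff[THEN iffD2]) (auto simp: rS)
    have ge: "r k \<ge> N k" for k by (cases k) (auto simp: r0 rS)
    have "norm (X (r (Suc n)) - X (r n)) < (1/2)^n" for n
      using ge[of n] rS[of n] by (intro N) auto
    with mono show ?thesis by blast
  qed
  then obtain r where r: "strict_mono r" "\<And>n. norm (X (r (Suc n)) - X (r n)) < (1/2)^n" by blast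
  define d where "d n = rep (X (r (Suc n)) - X (r n))" for n
  have [measurable]: "d n \<in> borel_measurable borel" for n unfolding d_def by simp
  have "(\<integral>\<^sup>+t. (\<Sum>n. ennreal (2^n * (cmod (d n t))\<^sup>2)) \<partial>lborel) = (\<Sum>n. \<integral>\<^sup>+t. ennreal (2^n * (cmod (d n t))\<^sup>2) \<partial>lborel)"
    by (rule nn_integral_suminf) simp
  also have "\<dots> \<le> (\<Sum>n. ennreal ((1/2)^n))"
  proof (rule suminf_le)
    fix n
    have "(\<integral>\<^sup>+t. ennreal (2^n * (cmod (d n t))\<^sup>2) \<partial>lborel)
        = (\<integral>\<^sup>+t. ennreal (2^n) * ennreal ((cmod (d n t))\<^sup>2) \<partial>lborel)"
      by (rule nn_integral_cong, rule ennreal_mult) auto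
    also have "\<dots> = ennreal (2^n) * ennreal ((norm (X (r (Suc n)) - X (r n)))\<^sup>2)"
      unfolding d_def by (subst nn_integral_cmult) (simp_all add: nn_integral_cls[OF L2_rep])
    also have "\<dots> = ennreal (2^n * (norm (X (r (Suc n)) - X (r n)))\<^sup>2)"
      by (rule ennreal_mult[symmetric]) auto
    also have "\<dots> \<le> ennreal (2^n * ((1/2)^n)\<^sup>2)"
      using r(2)[of n] by (intro ennreal_leI mult_left_mono power_mono) auto
    also have "2^n * ((1/2)^n)\<^sup>2 = ((1/2)^n::real)"
      by (simp add: power2_eq_square power_one_over field_simps)
    finally show "(\<integral>\<^sup>+t. ennreal (2^n * (cmod (d n t))\<^sup>2) \<partial>lborel) \<le> ennreal ((1/2)^n)" .
  qed auto
  also have "\<dots> = ennreal 2"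
    by (subst suminf_ennreal2) (auto simp: suminf_geometric intro!: summable_geometric)
  finally have "(\<integral>\<^sup>+t. (\<Sum>n. ennreal (2^n * (cmod (d n t))\<^sup>2)) \<partial>lborel) \<noteq> \<infinity>"
    by (auto simp: top_unique)
  then have "AE t in lborel. (\<Sum>n. ennreal (2^n * (cmod (d n t))\<^sup>2)) \<noteq> \<infinity>"
    by (intro nn_integral_PInf_AE) auto
  moreover have "AE t in lborel. \<forall>n. d n t = rep (X (r (Suc n))) t - rep (X (r n)) t"
    unfolding d_def by (intro AE_all_countable[THEN iffD2] allI rep_diff)
  ultimately have conv: "AE t in lborel. convergent (\<lambda>n. rep (X (r n)) t)"
  proof eventually_elim
    case (elim t)
    have sm: "summable (\<lambda>n. 2^n * (cmod (d n t))\<^sup>2)"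
      by (rule summable_suminf_not_top) (use elim in auto)
    then have "(\<lambda>n. 2^n * (cmod (d n t))\<^sup>2) \<longlonglongrightarrow> 0" by (rule summable_LIMSEQ_zero)
    then have "Bseq (\<lambda>n. 2^n * (cmod (d n t))\<^sup>2)"
      by (intro convergent_imp_Bseq convergentI)
    then obtain B where B: "\<And>n. norm (2^n * (cmod (d n t))\<^sup>2) \<le> B"
      by (auto simp: Bseq_def)
    have B0: "B \<ge> 0" using order_trans[OF norm_ge_zero B[of 0]] .
    have bd: "cmod (d n t) \<le> sqrt B * (1/sqrt 2)^n" for n
    proof (rule power2_le_imp_le)
      have "(cmod (d n t))\<^sup>2 \<le> B / 2^n" using B[of n] by (simp add: field_simps)
      also have "\<dots> = (sqrt B * (1/sqrt 2)^n)\<^sup>2"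
      proof -
        have "(sqrt 2 ^ n)\<^sup>2 = (2::real) ^ n"
          by (simp add: power2_eq_square flip: power_mult_distrib)
        then show ?thesis using B0 by (simp add: power_mult_distrib power_divide)
      qed
      finally show "(cmod (d n t))\<^sup>2 \<le> (sqrt B * (1/sqrt 2)^n)\<^sup>2" .
    qed (use B0 in auto)
    have "summable (\<lambda>n. d n t)"
      by (rule summable_comparison_test'[OF summable_mult[OF summable_geometric] bd]) auto
    then have "summable (\<lambda>n. rep (X (r (Suc n))) t - rep (X (r n)) t)" using elim by simp
    then have "convergent (\<lambda>n. \<Sum>i<n. rep (X (r (Suc i))) t - rep (X (r i)) t)"
      by (simp add: summable_iff_convergent)
    then have "convergent (\<lambda>n. (rep (X (r n)) t - rep (X (r 0)) t))"
      by (simp only: sum_lessThan_telescope[where f="\<lambda>n. rep (X (r n)) t"])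
    from convergent_add[OF this convergent_const[of "rep (X (r 0)) t"]]
    show ?case by simp
  qed
  define f where "f t = lim (\<lambda>n. rep (X (r n)) t)" for t
  have f_meas [measurable]: "f \<in> borel_measurable borel"
    unfolding f_def by (rule borel_measurable_lim_metric) simp
  have f_lim: "AE t in lborel. (\<lambda>n. rep (X (r n)) t) \<longlonglongrightarrow> f t"
    using conv by eventually_elim (simp add: f_def convergent_LIMSEQ_iff)
  \<comment> \<open>Fatou along the almost everywhere convergent subsequence turns a Cauchy estimate
    for \<open>X\<close> into one for the limit. With bound 1 it puts \<open>f\<close> in L2; with
    bound e/2 it gives convergence of the whole sequence.\<close>
  have fatou: "(\<integral>\<^sup>+t. ennreal ((cmod (f t - rep (X k) t))\<^sup>2) \<partial>lborel) \<le> ennreal (e\<^sup>2)"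
    if "\<And>m. m \<ge> N \<Longrightarrow> norm (X m - X k) \<le> e" "e \<ge> 0" for k N e
  proof -
    have "(\<integral>\<^sup>+t. ennreal ((cmod (f t - rep (X k) t))\<^sup>2) \<partial>lborel)
        \<le> (\<integral>\<^sup>+t. liminf (\<lambda>n. ennreal ((cmod (rep (X (r n)) t - rep (X k) t))\<^sup>2)) \<partial>lborel)"
    proof (rule nn_integral_mono_AE, use f_lim in eventually_elim)
      case (elim t)
      have "(\<lambda>n. ennreal ((cmod (rep (X (r n)) t - rep (X k) t))\<^sup>2)) \<longlonglongrightarrow> ennreal ((cmod (f t - rep (X k) t))\<^sup>2)"
        by (intro tendsto_intros elim)
      from lim_imp_Liminf[OF trivial_limit_sequentially this] show ?case by simp
    qed
    also have "\<dots> \<le> liminf (\<lambda>n. \<integral>\<^sup>+t. ennreal ((cmod (rep (X (r n)) t - rep (X k) t))\<^sup>2) \<partial>lborel)"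
      by (rule nn_integral_liminf) simp
    also have "\<dots> \<le> limsup (\<lambda>n. \<integral>\<^sup>+t. ennreal ((cmod (rep (X (r n)) t - rep (X k) t))\<^sup>2) \<partial>lborel)"
      by (rule Liminf_le_Limsup) simp
    also have "\<dots> \<le> ennreal (e\<^sup>2)"
    proof (rule Limsup_bounded, rule eventually_sequentiallyI[of N])
      fix n assume "n \<ge> N"
      then have n: "r n \<ge> N" using seq_suble[OF r(1), of n] by linarith
      have "(\<integral>\<^sup>+t. ennreal ((cmod (rep (X (r n)) t - rep (X k) t))\<^sup>2) \<partial>lborel) = ennreal ((norm (X (r n) - X k))\<^sup>2)"
        by (subst nn_integral_cls) (auto simp: L2_diff minus_l2_def)
      also have "\<dots> \<le> ennreal (e\<^sup>2)" using that(1)[OF n] by (intro ennreal_leI power_mono) auto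
      finally show "(\<integral>\<^sup>+t. ennreal ((cmod (rep (X (r n)) t - rep (X k) t))\<^sup>2) \<partial>lborel) \<le> ennreal (e\<^sup>2)" .
    qed
    finally show ?thesis .
  qed
  obtain N where N: "\<And>m. m \<ge> N \<Longrightarrow> norm (X m - X N) \<le> 1"
    using X[unfolded Cauchy_iff, rule_format, of 1] by (metis le_refl less_imp_le zero_less_one)
  have "L2 (\<lambda>t. f t - rep (X N) t)"
    using le_less_trans[OF fatou[of N N 1] ennreal_less_top] N by (simp add: L2_def)
  from L2_add[OF this L2_rep[of "X N"]] have Lf: "L2 f" by simp
  have "X \<longlonglongrightarrow> cls f"
  proof (rule LIMSEQ_I)
    fix e :: real assume "e > 0"
    then obtain M where M: "\<And>m n. m \<ge> M \<Longrightarrow> n \<ge> M \<Longrightarrow> norm (X m - X n) < e/2"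
      using X[unfolded Cauchy_iff, rule_format, of "e/2"] by (metis half_gt_zero)
    show "\<exists>n0. \<forall>n\<ge>n0. norm (X n - cls f) < e"
    proof (intro exI allI impI)
      fix n assume n: "n \<ge> M"
      have "(\<integral>\<^sup>+t. ennreal ((cmod (f t - rep (X n) t))\<^sup>2) \<partial>lborel) \<le> ennreal ((e/2)\<^sup>2)"
        by (rule fatou[of M]) (use M n \<open>e > 0\<close> in \<open>auto intro: less_imp_le\<close>)
      then have "(norm (cls f - X n))\<^sup>2 \<le> (e/2)\<^sup>2"
        using cls_diff[OF Lf L2_rep[of "X n"]]
        by (simp add: nn_integral_cls L2_diff Lf)
      then have "norm (cls f - X n) \<le> e/2" by (rule power2_le_imp_le) (use \<open>e > 0\<close> in auto)
      then show "norm (X n - cls f) < e" using \<open>e > 0\<close> by (simp add: norm_minus_commute)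
    qed
  qed
  then show "convergent X" by (auto simp: convergent_def)
qed

instance l2 :: (euclidean_space) banach ..

lemma cls_tendstoI:
  assumes "(\<lambda>n. (\<integral>t. (cmod (f n t - g t))\<^sup>2 \<partial>lborel)) \<longlonglongrightarrow> 0" "\<And>n. L2 (f n)" "L2 g"
  shows "(\<lambda>n. cls (f n)) \<longlonglongrightarrow> cls g"
proof -
  have "(\<lambda>n. sqrt ((norm (cls (f n) - cls g))\<^sup>2)) \<longlonglongrightarrow> sqrt 0"
    using assms by (intro tendsto_real_sqrt) (simp add: cls_diff norm_cls_sq L2_diff)
  then show ?thesis by (simp add: tendsto_norm_zero_iff LIM_zero_iff)
qed

text \<open>The limit inherits the majorant, so it is square-integrable too and the squared
  differences are dominated by \<open>4 * (cmod (h x))\<^sup>2\<close>.\<close>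

lemma cls_tendsto_dominated:
  assumes f: "\<And>n. f n \<in> borel_measurable borel" and g: "g \<in> borel_measurable borel" and h: "L2 h"
    and bd: "\<And>n. AE x in lborel. cmod (f n x) \<le> cmod (h x)"
    and lim: "AE x in lborel. (\<lambda>n. f n x) \<longlonglongrightarrow> g x"
  shows "(\<lambda>n. cls (f n)) \<longlonglongrightarrow> cls g" and "L2 g" and "L2 (f n)"
proof -
  have L: "L2 k" if "k \<in> borel_measurable borel" "AE x in lborel. cmod (k x) \<le> cmod (h x)" for k
  proof (rule L2_bounded_by[OF L2_integrable_sq[OF h]])
    show "AE x in lborel. (cmod (k x))\<^sup>2 \<le> (cmod (h x))\<^sup>2"
      using that(2) by eventually_elim (auto intro: power_mono)
  qed (use that in simp)
  have "AE x in lborel. \<forall>n. cmod (f n x) \<le> cmod (h x)"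
    using bd by (simp add: AE_all_countable)
  then have gb: "AE x in lborel. cmod (g x) \<le> cmod (h x)"
    using lim
  proof eventually_elim
    case (elim x)
    show ?case by (rule LIMSEQ_le_const2[OF tendsto_norm[OF elim(2)]]) (use elim(1) in auto)
  qed
  show Lg: "L2 g" by (rule L[OF g gb])
  show Lf: "L2 (f n)" for n by (rule L[OF f bd])
  have meas: "(\<lambda>t. (cmod (f n t - g t))\<^sup>2) \<in> borel_measurable lborel" for n
    using f[of n] g by measurable
  have "(\<lambda>n. (\<integral>t. (cmod (f n t - g t))\<^sup>2 \<partial>lborel)) \<longlonglongrightarrow> (\<integral>t. (0::real) \<partial>(lborel::'a measure))"
  proof (rule integral_dominated_convergence)
    show "integrable lborel (\<lambda>x. 4 * (cmod (h x))\<^sup>2)"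
      using L2_integrable_sq[OF h] by simp
    show "AE x in lborel. (\<lambda>n. (cmod (f n x - g x))\<^sup>2) \<longlonglongrightarrow> 0"
      using lim
    proof eventually_elim
      case (elim x)
      have "(\<lambda>n. (cmod (f n x - g x))\<^sup>2) \<longlonglongrightarrow> (cmod (g x - g x))\<^sup>2"
        by (intro tendsto_intros elim)
      then show ?case by simp
    qed
    show "AE x in lborel. norm ((cmod (f n x - g x))\<^sup>2) \<le> 4 * (cmod (h x))\<^sup>2" for n
      using bd[of n] gb
    proof eventually_elim
      case (elim x)
      have "cmod (f n x - g x) \<le> 2 * cmod (h x)"
        using norm_triangle_ineq4[of "f n x" "g x"] elim by linarith
      then have "(cmod (f n x - g x))\<^sup>2 \<le> (2 * cmod (h x))\<^sup>2" by (rule power_mono) simp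
      then show ?case by (simp add: power_mult_distrib)
    qed
  qed (use meas in auto)
  then show "(\<lambda>n. cls (f n)) \<longlonglongrightarrow> cls g"
    by (intro cls_tendstoI Lf Lg) simp
qed

section \<open>Multiplication operators and affine substitutions\<close>

definition bmeas :: "('a::euclidean_space \<Rightarrow> complex) \<Rightarrow> bool" where
  "bmeas m \<longleftrightarrow> m \<in> borel_measurable borel \<and> (\<exists>c. \<forall>x. cmod (m x) \<le> c)"

text \<open>The value 0 for symbols that are not bounded and measurable makes \<open>mul m\<close>
  bounded linear for every \<open>m\<close>, without side conditions.\<close>

definition mul :: "('a::euclidean_space \<Rightarrow> complex) \<Rightarrow> 'a l2 \<Rightarrow> 'a l2" where
  "mul m x = (if bmeas m then cls (\<lambda>t. m t * rep x t) else 0)"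

lemma bmeasI: "m \<in> borel_measurable borel \<Longrightarrow> (\<And>x. cmod (m x) \<le> c) \<Longrightarrow> bmeas m"
  by (auto simp: bmeas_def)

lemma bmeas_measurable: "bmeas m \<Longrightarrow> m \<in> borel_measurable borel"
  by (simp add: bmeas_def)

lemma bmeas_const [simp]: "bmeas (\<lambda>_. c)"
  by (rule bmeasI[of _ "cmod c"]) auto

lemma bmeas_mult: "bmeas a \<Longrightarrow> bmeas b \<Longrightarrow> bmeas (\<lambda>t. a t * b t)"
proof -
  assume a: "bmeas a" and b: "bmeas b"
  obtain c where c: "\<And>x. cmod (a x) \<le> c" using a by (auto simp: bmeas_def)
  obtain d where d: "\<And>x. cmod (b x) \<le> d" using b by (auto simp: bmeas_def)
  show ?thesis
  proof (rule bmeasI[of _ "c * d"])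
    show "(\<lambda>t. a t * b t) \<in> borel_measurable borel"
      using bmeas_measurable[OF a] bmeas_measurable[OF b] by measurable
    show "cmod (a x * b x) \<le> c * d" for x
      unfolding norm_mult by (intro mult_mono c d order_trans[OF norm_ge_zero c]) auto
  qed
qed

lemma bmeas_cnj: "bmeas a \<Longrightarrow> bmeas (\<lambda>t. cnj (a t))"
  by (auto simp: bmeas_def)

lemma L2_bmeas_mult: "bmeas m \<Longrightarrow> L2 f \<Longrightarrow> L2 (\<lambda>t. m t * f t)"
  unfolding bmeas_def by (elim conjE exE) (rule L2_mult_bounded, auto)

lemma rep_mul: "bmeas m \<Longrightarrow> AE t in lborel. rep (mul m x) t = m t * rep x t"
  by (simp add: mul_def rep_cls L2_bmeas_mult)

lemma mul_cls:
  assumes "bmeas m" "L2 f" shows "mul m (cls f) = cls (\<lambda>t. m t * f t)"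
proof -
  have "AE t in lborel. m t * rep (cls f) t = m t * f t"
    using rep_cls[OF assms(2)] by eventually_elim simp
  then show ?thesis using assms by (simp add: mul_def cls_eq_iff L2_bmeas_mult)
qed

lemma bounded_linear_mul: "bounded_linear (mul m)"
proof (cases "bmeas m")
  case True
  then obtain c where c: "\<And>x. cmod (m x) \<le> c" by (auto simp: bmeas_def)
  have c0: "c \<ge> 0" using order_trans[OF norm_ge_zero c] .
  show ?thesis
  proof (rule bounded_linear_intro[where K=c])
    fix x y :: "'a l2" and r :: real
    show "mul m (x + y) = mul m x + mul m y"
    proof (rule l2_eqI)
      show "AE t in lborel. rep (mul m (x + y)) t = rep (mul m x + mul m y) t"
        using rep_mul[OF True, of x] rep_mul[OF True, of y] rep_mul[OF True, of "x+y"]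
          rep_add[of x y] rep_add[of "mul m x" "mul m y"]
        by eventually_elim (simp add: distrib_left)
    qed
    show "mul m (r *\<^sub>R x) = r *\<^sub>R mul m x"
    proof (rule l2_eqI)
      show "AE t in lborel. rep (mul m (r *\<^sub>R x)) t = rep (r *\<^sub>R mul m x) t"
        using rep_mul[OF True, of x] rep_mul[OF True, of "r *\<^sub>R x"]
          rep_scaleR[of r x] rep_scaleR[of r "mul m x"]
        by eventually_elim simp
    qed
    show "norm (mul m x) \<le> norm x * c"
      unfolding mult.commute[of "norm x"]
    proof (rule norm_l2_mono[OF _ c0])
      show "AE t in lborel. cmod (rep (mul m x) t) \<le> c * cmod (rep x t)"
        using rep_mul[OF True, of x] by eventually_elim (auto simp: norm_mult intro: mult_right_mono c)
    qed
  qed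
qed (simp add: mul_def[abs_def])

lemmas mul_add = linear_add[OF bounded_linear.linear[OF bounded_linear_mul]]
lemmas mul_diff = linear_diff[OF bounded_linear.linear[OF bounded_linear_mul]]
lemma norm_mul_le:
  assumes "\<And>t. cmod (m t) \<le> c" shows "norm (mul m x) \<le> c * norm x"
proof -
  have c0: "c \<ge> 0" using order_trans[OF norm_ge_zero assms] .
  show ?thesis
  proof (cases "bmeas m")
    case True
    show ?thesis
    proof (rule norm_l2_mono[OF _ c0])
      show "AE t in lborel. cmod (rep (mul m x) t) \<le> c * cmod (rep x t)"
        using rep_mul[OF True, of x] by eventually_elim (auto simp: norm_mult intro: mult_right_mono assms)
    qed
  qed (use c0 in \<open>simp add: mul_def\<close>)
qed

lemma mul_mul:
  assumes "bmeas a" "bmeas b" shows "mul a (mul b x) = mul (\<lambda>t. a t * b t) x"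
proof (rule l2_eqI)
  show "AE t in lborel. rep (mul a (mul b x)) t = rep (mul (\<lambda>t. a t * b t) x) t"
    using rep_mul[OF assms(2), of x] rep_mul[OF assms(1), of "mul b x"] rep_mul[OF bmeas_mult[OF assms], of x]
    by eventually_elim simp
qed

lemma mul_one [simp]: "mul (\<lambda>_. 1) x = x"
  by (simp add: mul_def)

lemma inner_rep: "inner x y = Re (\<integral>t. rep x t * cnj (rep y t) \<partial>lborel)"
  by (simp add: inner_l2_def)

lemma inner_mul:
  assumes "bmeas m" shows "inner (mul m x) y = inner x (mul (\<lambda>t. cnj (m t)) y)"
proof -
  have "(\<integral>t. rep (mul m x) t * cnj (rep y t) \<partial>lborel) = (\<integral>t. rep x t * cnj (rep (mul (\<lambda>t. cnj (m t)) y) t) \<partial>lborel)"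
  proof (rule integral_cong_AE)
    show "AE t in lborel. rep (mul m x) t * cnj (rep y t) = rep x t * cnj (rep (mul (\<lambda>t. cnj (m t)) y) t)"
      using rep_mul[OF assms, of x] rep_mul[OF bmeas_cnj[OF assms], of y] by eventually_elim simp
  qed measurable
  then show ?thesis by (simp add: inner_rep)
qed

lemma mul_tendsto:
  assumes m: "\<And>n. m n \<in> borel_measurable borel" and k: "k \<in> borel_measurable borel"
    and bd: "\<And>n t. cmod (m n t) \<le> c" and kb: "\<And>t. cmod (k t) \<le> c"
    and lim: "AE t in lborel. (\<lambda>n. m n t) \<longlonglongrightarrow> k t"
  shows "(\<lambda>n. mul (m n) x) \<longlonglongrightarrow> mul k x"
proof -
  have c0: "c \<ge> 0" using order_trans[OF norm_ge_zero kb] .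
  have bm: "bmeas (m n)" "bmeas k" for n
    by (rule bmeasI[OF m bd], rule bmeasI[OF k kb])
  have "(\<lambda>n. cls (\<lambda>t. m n t * rep x t)) \<longlonglongrightarrow> cls (\<lambda>t. k t * rep x t)"
  proof (rule cls_tendsto_dominated[where h="\<lambda>t. complex_of_real c * rep x t"])
    show "AE t in lborel. cmod (m n t * rep x t) \<le> cmod (complex_of_real c * rep x t)" for n
      using c0 bd by (intro AE_I2) (auto simp: norm_mult intro: mult_right_mono)
    show "AE t in lborel. (\<lambda>n. m n t * rep x t) \<longlonglongrightarrow> k t * rep x t"
      using lim by eventually_elim (intro tendsto_intros)
    show "L2 (\<lambda>t. complex_of_real c * rep x t)" by (rule L2_cmult) simp
  qed (use m k in measurable)
  then show ?thesis using bm by (simp add: mul_def)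
qed

section \<open>Affine substitutions, density of compactly supported functions, continuity of
  translations\<close>

lemma AE_lborel_affine:
  fixes P :: "'a::euclidean_space \<Rightarrow> bool"
  assumes c: "c \<noteq> 0" and P: "Measurable.pred borel P" "AE x in lborel. P x"
  shows "AE x in lborel. P (a + c *\<^sub>R x)"
proof -
  have "AE x in density (distr lborel borel (\<lambda>x. a + c *\<^sub>R x)) (\<lambda>_. ennreal (\<bar>c\<bar> ^ DIM('a))). P x"
    by (subst lborel_affine[OF c, of a, symmetric]) (rule P(2))
  then show ?thesis
    using P(1) c by (simp add: AE_density AE_distr_iff)
qed

lemma lborel_integrable_affine:
  fixes f :: "'a::euclidean_space \<Rightarrow> 'b::{banach, second_countable_topology}"
  assumes c: "c \<noteq> 0" and f: "integrable lborel f"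
  shows "integrable lborel (\<lambda>x. f (a + c *\<^sub>R x))"
proof -
  have m: "f \<in> borel_measurable borel" using f by auto
  have "integrable (density (distr lborel borel (\<lambda>x. a + c *\<^sub>R x)) (\<lambda>_. ennreal (\<bar>c\<bar> ^ DIM('a)))) f"
    by (subst lborel_affine[OF c, of a, symmetric]) (rule f)
  then have "integrable lborel (\<lambda>x. \<bar>c\<bar> ^ DIM('a) *\<^sub>R f (a + c *\<^sub>R x))"
    using m c by (simp add: integrable_density integrable_distr_eq)
  from integrable_scaleR_right[of "inverse (\<bar>c\<bar> ^ DIM('a))", OF this] show ?thesis
    using c by simp
qed

lemma lborel_integral_affine:
  fixes f :: "'a::euclidean_space \<Rightarrow> 'b::{banach, second_countable_topology}"
  assumes c: "c \<noteq> 0" and m: "f \<in> borel_measurable borel"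
  shows "(\<integral>x. f x \<partial>lborel) = \<bar>c\<bar> ^ DIM('a) *\<^sub>R (\<integral>x. f (a + c *\<^sub>R x) \<partial>lborel)"
  by (subst lborel_affine[OF c, of a]) (use m in \<open>simp add: integral_density integral_distr\<close>)

lemma L2_affine: assumes "c \<noteq> 0" "L2 f" shows "L2 (\<lambda>x. f (a + c *\<^sub>R x))"
  using assms(2) lborel_integrable_affine[OF assms(1), of "\<lambda>x. (cmod (f x))\<^sup>2" a]
  by (auto simp: L2_iff_integrable)

lemma L2_bounded_support:
  assumes "f \<in> borel_measurable borel" "\<And>x. cmod (f x) \<le> B" "\<And>x. norm x > R \<Longrightarrow> f x = 0"
  shows "L2 f" and "integrable lborel f"
proof -
  have i: "integrable lborel (\<lambda>x. B\<^sup>2 * indicator (cball 0 R) x :: real)" for B R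
    by (intro integrable_mult_right integrable_real_indicator) (auto intro: emeasure_bounded_finite[unfolded infinity_ennreal_def])
  have B: "B \<ge> 0" using order_trans[OF norm_ge_zero assms(2)] .
  show "L2 f"
  proof (rule L2_bounded_by[OF i])
    show "AE x in lborel. (cmod (f x))\<^sup>2 \<le> B\<^sup>2 * indicator (cball 0 R) x"
      using assms(2,3) by (intro AE_I2) (auto simp: indicator_def not_le intro: power_mono)
  qed (use assms in simp)
  show "integrable lborel f"
  proof (rule Bochner_Integration.integrable_bound[OF i])
    \<comment> \<open>The majorant \<open>i\<close> was stated with a square; taking it at the
      square root of \<open>B\<close> reuses it for the modulus itself.\<close>
    show "AE x in lborel. norm (f x) \<le> norm ((sqrt B)\<^sup>2 * indicator (cball 0 R) x)"
      using assms(2,3) B by (intro AE_I2) (auto simp: indicator_def not_le)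
  qed (use assms in simp)
qed

text \<open>Cut off in space and in size, then approximate the cut-off function almost everywhere by
  continuous functions. These need not be bounded or compactly supported, so they are clipped in
  size and multiplied by a continuous cutoff, after which dominated convergence applies.\<close>

lemma Cc_dense_L2:
  fixes x :: "'a::euclidean_space l2"
  assumes "e > 0"
  obtains g R where "continuous_on UNIV g" "\<And>t. norm t > R \<Longrightarrow> g t = 0" "L2 g" "norm (x - cls g) < e"
proof -
  define F where "F n t = (if norm t \<le> real n \<and> cmod (rep x t) \<le> real n then rep x t else 0)" for n t
  have [measurable]: "F n \<in> borel_measurable borel" for n unfolding F_def by measurable
  have "(\<lambda>n. cls (F n)) \<longlonglongrightarrow> cls (rep x)"
  proof (rule cls_tendsto_dominated[where h="rep x"])
    show "AE t in lborel. (\<lambda>n. F n t) \<longlonglongrightarrow> rep x t"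
    proof (rule AE_I2)
      fix t
      obtain N where N: "max (norm t) (cmod (rep x t)) \<le> real N" using real_arch_simple by blast
      show "(\<lambda>n. F n t) \<longlonglongrightarrow> rep x t"
        by (rule tendsto_eventually, rule eventually_sequentiallyI[of N]) (use N in \<open>auto simp: F_def\<close>)
    qed
  qed (auto simp: F_def)
  then obtain n0 where n0: "\<And>n. n \<ge> n0 \<Longrightarrow> norm (cls (F n) - x) < e / 2"
    using LIMSEQ_D[of "\<lambda>n. cls (F n)" "x" "e/2"] assms by auto
  \<comment> \<open>The successor keeps n positive, so that the quotient in \<open>\<phi>\<close>
    below is continuous.\<close>
  define n where "n = Suc n0"
  have n: "norm (cls (F n) - x) < e / 2" using n0[of n] by (simp add: n_def)
  have LF: "L2 (F n)" by (rule L2_bounded_support[of _ "real n" "real n"]) (auto simp: F_def)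
  \<comment> \<open>\<open>measurable_on\<close> means being a limit of continuous functions off a
    negligible set, which supplies the approximants.\<close>
  have "F n measurable_on UNIV"
    by (rule lebesgue_measurable_imp_measurable_on) (auto intro!: measurable_completion)
  then obtain N g where N: "negligible N" and g: "\<And>k. continuous_on UNIV (g k)"
    and lim: "\<And>t. t \<notin> N \<Longrightarrow> (\<lambda>k. g k t) \<longlonglongrightarrow> F n t"
    unfolding measurable_on_def by auto
  have AElim: "AE t in lborel. (\<lambda>k. g k t) \<longlonglongrightarrow> F n t"
  proof -
    have "AE t in lebesgue. t \<notin> N" using N by (simp add: negligible_iff_null_sets AE_not_in)
    then have "AE t in lborel. t \<notin> N" by (simp add: AE_completion_iff)
    then show ?thesis by eventually_elim (rule lim)
  qed
  define ch where "ch t = max 0 (min 1 (real n + 1 - norm t))" for t :: 'a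
  \<comment> \<open>Radial retraction of the complex plane onto the disc of radius n: continuous,
    and the identity on the values of \<open>F n\<close>.\<close>
  define \<phi> where "\<phi> z = (real n / max (real n) (cmod z)) *\<^sub>R z" for z
  have npos: "real n > 0" by (simp add: n_def)
  have \<phi>_cont: "continuous_on UNIV \<phi>"
    unfolding \<phi>_def by (intro continuous_intros) (use npos in auto)
  have \<phi>_bd: "cmod (\<phi> z) \<le> real n" for z
    using npos by (auto simp: \<phi>_def max_def field_simps)
  have \<phi>_id: "\<phi> z = z" if "cmod z \<le> real n" for z
    using npos that by (auto simp: \<phi>_def max_def)
  define G where "G k t = complex_of_real (ch t) * \<phi> (g k t)" for k t
  have ch_cont: "continuous_on UNIV ch" unfolding ch_def by (intro continuous_intros)
  have Gc: "continuous_on UNIV (G k)" for k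
    unfolding G_def
    by (intro continuous_intros ch_cont continuous_on_compose2[OF \<phi>_cont g]) auto
  have Gs: "norm t > real n + 1 \<Longrightarrow> G k t = 0" for t k by (simp add: G_def ch_def)
  have ch_bd: "0 \<le> ch t" "ch t \<le> 1" for t by (auto simp: ch_def)
  have Gb: "cmod (G k t) \<le> real n" for k t
    unfolding G_def norm_mult using ch_bd[of t] \<phi>_bd[of "g k t"] mult_mono[of "ch t" 1 "cmod (\<phi> (g k t))" "real n"] by simp
  have "(\<lambda>k. cls (G k)) \<longlonglongrightarrow> cls (F n)"
  proof (rule cls_tendsto_dominated[where h="\<lambda>t. real n * indicator (cball 0 (real n + 1)) t"])
    show "G k \<in> borel_measurable borel" for k by (rule borel_measurable_continuous_onI[OF Gc])
    show "L2 (\<lambda>t. complex_of_real (real n * indicator (cball 0 (real n + 1)) t))"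
      by (rule L2_bounded_support[of _ "real n" "real n + 1"]) (auto simp: indicator_def)
    show "AE t in lborel. cmod (G k t) \<le> cmod (complex_of_real (real n * indicator (cball 0 (real n + 1)) t))" for k
    proof (rule AE_I2)
      fix t show "cmod (G k t) \<le> cmod (complex_of_real (real n * indicator (cball 0 (real n + 1)) t))"
        using Gb[of k t] Gs[of t k] by (cases "norm t > real n + 1") (auto simp: indicator_def)
    qed
    show "AE t in lborel. (\<lambda>k. G k t) \<longlonglongrightarrow> F n t"
      using AElim
    proof eventually_elim
      case (elim t)
      have "isCont \<phi> (F n t)" using \<phi>_cont by (simp add: continuous_on_eq_continuous_at)
      from isCont_tendsto_compose[OF this elim]
      have "(\<lambda>k. G k t) \<longlonglongrightarrow> complex_of_real (ch t) * \<phi> (F n t)"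
        unfolding G_def by (intro tendsto_intros)
      also have "\<phi> (F n t) = F n t" by (rule \<phi>_id) (simp add: F_def)
      also have "complex_of_real (ch t) * F n t = F n t" by (auto simp: F_def ch_def)
      finally show ?case .
    qed
  qed measurable
  then obtain k where k: "norm (cls (G k) - cls (F n)) < e / 2"
    using LIMSEQ_D[of "\<lambda>n. cls (G n)" "cls (F n)" "e/2"] assms by auto
  have "L2 (G k)"
    by (rule L2_bounded_support[of _ "real n" "real n + 1"])
      (use Gb Gs borel_measurable_continuous_onI[OF Gc] in auto)
  moreover have "norm (x - cls (G k)) < e"
  proof -
    have "norm (x - cls (G k)) \<le> norm (x - cls (F n)) + norm (cls (F n) - cls (G k))"
      using norm_triangle_ineq[of "x - cls (F n)" "cls (F n) - cls (G k)"] by simp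
    then show ?thesis using n k by (simp add: norm_minus_commute)
  qed
  ultimately show ?thesis using that[of "G k" "real n + 1"] Gc Gs by blast
qed

lemma norm_cls_shift:
  assumes "L2 f" shows "norm (cls (\<lambda>x. f (x + z))) = norm (cls f)"
proof -
  have L: "L2 (\<lambda>x. f (x + z))" using L2_affine[of 1 f z] assms by (simp add: add.commute)
  have "(\<integral>x. (cmod (f x))\<^sup>2 \<partial>lborel) = (\<integral>x. (cmod (f (x + z)))\<^sup>2 \<partial>lborel)"
    using lborel_integral_affine[of 1 "\<lambda>x. (cmod (f x))\<^sup>2" z] L2_measurable[OF assms]
    by (simp add: add.commute)
  then have "(norm (cls (\<lambda>x. f (x + z))))\<^sup>2 = (norm (cls f))\<^sup>2"
    using L assms by (simp add: norm_cls_sq)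
  then show ?thesis by simp
qed

text \<open>For continuous compactly supported functions, all shifts by the bounded sequence
  \<open>z\<close> live in one ball, and dominated convergence applies. Since translations are
  isometries, density carries this over with an e/3 argument.\<close>

lemma L2_translation_continuous:
  fixes f :: "'a::euclidean_space \<Rightarrow> complex" and z :: "nat \<Rightarrow> 'a"
  assumes f: "L2 f" and z: "z \<longlonglongrightarrow> 0"
  shows "(\<lambda>n. cls (\<lambda>x. f (x + z n))) \<longlonglongrightarrow> cls f"
proof (rule LIMSEQ_I)
  fix e :: real assume e: "e > 0"
  have sh: "L2 k \<Longrightarrow> L2 (\<lambda>x. k (x + w))" for k :: "'a \<Rightarrow> complex" and w
    using L2_affine[of 1 k w] by (simp add: add.commute)
  obtain g R where g: "continuous_on UNIV g" "\<And>t. norm t > R \<Longrightarrow> g t = 0" "L2 g" "norm (cls f - cls g) < e / 3"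
    using Cc_dense_L2[of "e/3" "cls f"] e by auto
  obtain B where B: "\<And>t. cmod (g t) \<le> B"
  proof -
    have "bounded (g ` cball 0 R)"
      by (intro compact_imp_bounded compact_continuous_image continuous_on_subset[OF g(1)]) auto
    then obtain B where "\<forall>t\<in>cball 0 R. cmod (g t) \<le> B" by (auto simp: bounded_iff)
    then have "cmod (g t) \<le> max B 0" for t using g(2)[of t] by (cases "norm t \<le> R") (auto simp: le_max_iff_disj)
    then show ?thesis by (rule that)
  qed
  have B0: "B \<ge> 0" using order_trans[OF norm_ge_zero B] .
  obtain K where K: "\<And>n. norm (z n) \<le> K"
    using convergent_imp_Bseq[OF convergentI[OF z]] by (auto simp: Bseq_def)
  have gm: "g \<in> borel_measurable borel" by (rule borel_measurable_continuous_onI[OF g(1)])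
  have "(\<lambda>n. cls (\<lambda>x. g (x + z n))) \<longlonglongrightarrow> cls g"
  proof (rule cls_tendsto_dominated[where h="\<lambda>t. complex_of_real (B * indicator (cball 0 (R + K)) t)"])
    show "(\<lambda>x. g (x + z n)) \<in> borel_measurable borel" for n using gm by measurable
    show "L2 (\<lambda>t. complex_of_real (B * indicator (cball 0 (R + K)) t))"
      by (rule L2_bounded_support[of _ B "R + K"]) (use B0 in \<open>auto simp: indicator_def\<close>)
    show "AE x in lborel. cmod (g (x + z n)) \<le> cmod (complex_of_real (B * indicator (cball 0 (R + K)) x))" for n
    proof (rule AE_I2)
      fix x
      have "norm x \<le> norm (x + z n) + norm (z n)" using norm_triangle_ineq4[of "x + z n" "z n"] by simp
      then have "g (x + z n) = 0" if "norm x > R + K" using that K[of n] by (intro g(2)) linarith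
      then show "cmod (g (x + z n)) \<le> cmod (complex_of_real (B * indicator (cball 0 (R + K)) x))"
        using B[of "x + z n"] B0 by (cases "norm x > R + K") (auto simp: indicator_def)
    qed
    show "AE x in lborel. (\<lambda>n. g (x + z n)) \<longlonglongrightarrow> g x"
    proof (rule AE_I2)
      fix x
      have "isCont g x" using g(1) by (simp add: continuous_on_eq_continuous_at)
      moreover have "(\<lambda>n. x + z n) \<longlonglongrightarrow> x" using tendsto_add[OF tendsto_const z, of x] by simp
      ultimately show "(\<lambda>n. g (x + z n)) \<longlonglongrightarrow> g x" by (rule isCont_tendsto_compose)
    qed
  qed (use gm in auto)
  then obtain N where N: "\<And>n. n \<ge> N \<Longrightarrow> norm (cls (\<lambda>x. g (x + z n)) - cls g) < e / 3"
    using LIMSEQ_D[of _ _ "e/3"] e by force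
  show "\<exists>N. \<forall>n\<ge>N. norm (cls (\<lambda>x. f (x + z n)) - cls f) < e"
  proof (intro exI allI impI)
    fix n assume n: "n \<ge> N"
    have "norm (cls (\<lambda>x. f (x + z n)) - cls (\<lambda>x. g (x + z n))) = norm (cls f - cls g)"
      using norm_cls_shift[OF L2_diff[OF f g(3)], of "z n"] f g(3) sh[OF f] sh[OF g(3)] by (simp add: cls_diff)
    moreover have "norm (cls (\<lambda>x. f (x + z n)) - cls f)
      \<le> norm (cls (\<lambda>x. f (x + z n)) - cls (\<lambda>x. g (x + z n))) + norm (cls (\<lambda>x. g (x + z n)) - cls g) + norm (cls g - cls f)"
      by (smt (verit) norm_triangle_ineq diff_add_cancel add_diff_eq)
    ultimately show "norm (cls (\<lambda>x. f (x + z n)) - cls f) < e"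
      using N[OF n] g(4) by (simp add: norm_minus_commute)
  qed
qed

section \<open>Plancherel's theorem\<close>

text \<open>Lebesgue measure is the image of a product measure, so integrals of coordinatewise
  products factor. Both the Gaussian and the bracket weight are reduced to one dimension in this
  way.\<close>

lemma
  fixes f :: "'a::euclidean_space \<Rightarrow> real \<Rightarrow> 'b::{real_normed_field,banach,second_countable_topology}"
  assumes f: "\<And>b. b \<in> Basis \<Longrightarrow> integrable lborel (f b)"
  shows integrable_lborel_prod: "integrable lborel (\<lambda>x. \<Prod>b\<in>Basis. f b (x \<bullet> b))"
    and integral_lborel_prod: "(\<integral>x. (\<Prod>b\<in>Basis. f b (x \<bullet> b)) \<partial>lborel) = (\<Prod>b\<in>Basis. \<integral>s. f b s \<partial>lborel)"
proof -
  interpret product_sigma_finite "\<lambda>_::'a. lborel :: real measure" by standard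
  have eq: "(\<Prod>b\<in>Basis. f b ((\<Sum>c\<in>Basis. y c *\<^sub>R c) \<bullet> b)) = (\<Prod>b\<in>Basis. f b (y b))" for y :: "'a \<Rightarrow> real"
    by (intro prod.cong refl) simp
  have m: "(\<lambda>x::'a. \<Prod>b\<in>Basis. f b (x \<bullet> b)) \<in> borel_measurable borel"
  proof (rule borel_measurable_prod)
    fix b :: 'a assume "b \<in> Basis"
    then have [measurable]: "f b \<in> borel_measurable borel" using f[of b] by auto
    show "(\<lambda>x. f b (x \<bullet> b)) \<in> borel_measurable borel" by measurable
  qed
  have mm: "(\<lambda>y. \<Sum>c\<in>Basis. y c *\<^sub>R c) \<in> (\<Pi>\<^sub>M b\<in>(Basis::'a set). lborel) \<rightarrow>\<^sub>M (borel::'a measure)"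
    by measurable
  show "integrable lborel (\<lambda>x. \<Prod>b\<in>Basis. f b (x \<bullet> b))"
    unfolding lborel_eq[where 'a='a]
    by (subst integrable_distr_eq[OF mm m]) (simp only: eq, rule product_integrable_prod, auto intro: f)
  show "(\<integral>x. (\<Prod>b\<in>Basis. f b (x \<bullet> b)) \<partial>lborel) = (\<Prod>b\<in>Basis. \<integral>s. f b s \<partial>lborel)"
    unfolding lborel_eq[where 'a='a]
    by (subst integral_distr[OF mm m]) (simp only: eq, rule product_integral_prod, auto intro: f)
qed

text \<open>The characteristic function of the standard normal distribution, rescaled by
  \<open>t\<close>.\<close>

lemma
  fixes t w :: real assumes t: "t > 0"
  shows gaussian_integrable_1d: "integrable lborel (\<lambda>s. exp (- \<i> * complex_of_real (w * s)) * complex_of_real (exp (- (t * s)\<^sup>2 / 2)))"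
    and gaussian_fourier_1d: "(\<integral>s. exp (- \<i> * complex_of_real (w * s)) * complex_of_real (exp (- (t * s)\<^sup>2 / 2)) \<partial>lborel)
      = complex_of_real (sqrt (2 * pi) / t * exp (- (w / t)\<^sup>2 / 2))"
proof -
  define F where "F s = std_normal_density s *\<^sub>R iexp ((- w / t) * s)" for s
  have Fi: "integrable lborel F"
  proof (rule Bochner_Integration.integrable_bound)
    show "integrable lborel std_normal_density" by simp
    show "AE s in lborel. norm (F s) \<le> norm (std_normal_density s)"
      by (intro AE_I2) (auto simp: F_def norm_mult)
  qed (simp add: F_def[abs_def])
  have eq: "F (0 + t * s) = complex_of_real (1 / sqrt (2 * pi)) * (exp (- \<i> * complex_of_real (w * s)) * complex_of_real (exp (- (t * s)\<^sup>2 / 2)))" for s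
    using t by (simp add: F_def std_normal_density_def scaleR_conv_of_real)
  have "(\<integral>s. F s \<partial>lborel) = char std_normal_distribution (- w / t)"
    unfolding char_def F_def by (subst integral_density) auto
  then have 1: "(\<integral>s. F s \<partial>lborel) = complex_of_real (exp (- (w / t)\<^sup>2 / 2))"
    by (simp add: char_std_normal_distribution)
  have "integrable lborel (\<lambda>s. F (0 + t * s))"
    using lborel_integrable_real_affine[OF Fi, of t 0] t by auto
  from integrable_mult_right[OF this, of "complex_of_real (sqrt (2*pi))"]
  show "integrable lborel (\<lambda>s. exp (- \<i> * complex_of_real (w * s)) * complex_of_real (exp (- (t * s)\<^sup>2 / 2)))"
    by (simp only: eq mult.assoc[symmetric] of_real_mult[symmetric]) simp
  have "(\<integral>s. F s \<partial>lborel) = \<bar>t\<bar> *\<^sub>R (\<integral>s. F (0 + t * s) \<partial>lborel)"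
    by (rule lborel_integral_real_affine) (use t in simp)
  then have "complex_of_real (exp (- (w / t)\<^sup>2 / 2)) = complex_of_real (t / sqrt (2 * pi)) *
     (\<integral>s. exp (- \<i> * complex_of_real (w * s)) * complex_of_real (exp (- (t * s)\<^sup>2 / 2)) \<partial>lborel)"
    unfolding 1 eq using t by (simp add: scaleR_conv_of_real)
  then have "complex_of_real (sqrt (2 * pi) / t) * complex_of_real (exp (- (w / t)\<^sup>2 / 2)) =
     complex_of_real (sqrt (2 * pi) / t * (t / sqrt (2 * pi))) *
     (\<integral>s. exp (- \<i> * complex_of_real (w * s)) * complex_of_real (exp (- (t * s)\<^sup>2 / 2)) \<partial>lborel)"
    by (simp only: of_real_mult mult.assoc)
  then show "(\<integral>s. exp (- \<i> * complex_of_real (w * s)) * complex_of_real (exp (- (t * s)\<^sup>2 / 2)) \<partial>lborel)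
      = complex_of_real (sqrt (2 * pi) / t * exp (- (w / t)\<^sup>2 / 2))"
    using t by simp
qed

lemma
  fixes w :: "'a::euclidean_space" and t :: real
  assumes t: "t > 0"
  shows fourier_gaussian: "fourier (\<lambda>\<xi>. complex_of_real (exp (- (t * norm \<xi>)\<^sup>2 / 2))) w
      = complex_of_real ((sqrt (2 * pi) / t) ^ DIM('a) * exp (- (norm w / t)\<^sup>2 / 2))"
    and integrable_gaussian: "integrable lborel (\<lambda>\<xi>::'a. exp (- (t * norm \<xi>)\<^sup>2 / 2))"
proof -
  have nsq: "(norm x)\<^sup>2 = (\<Sum>b\<in>Basis. (x \<bullet> b)\<^sup>2)" for x :: 'a
    unfolding power2_norm_eq_inner by (subst euclidean_inner) (simp add: power2_eq_square)
  have eq: "exp (- \<i> * complex_of_real (\<xi> \<bullet> w)) * complex_of_real (exp (- (t * norm \<xi>)\<^sup>2 / 2))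
     = (\<Prod>b\<in>Basis. exp (- \<i> * complex_of_real ((w \<bullet> b) * (\<xi> \<bullet> b))) * complex_of_real (exp (- (t * (\<xi> \<bullet> b))\<^sup>2 / 2)))" for \<xi> w :: 'a
  proof -
    have "exp (- \<i> * complex_of_real (\<xi> \<bullet> w)) = (\<Prod>b\<in>Basis. exp (- \<i> * complex_of_real ((w \<bullet> b) * (\<xi> \<bullet> b))))"
      by (subst euclidean_inner) (simp add: exp_sum[symmetric] sum_distrib_left mult.commute)
    moreover have "exp (- (t * norm \<xi>)\<^sup>2 / 2) = (\<Prod>b\<in>Basis. exp (- (t * (\<xi> \<bullet> b))\<^sup>2 / 2))"
      by (simp add: exp_sum[symmetric] power_mult_distrib nsq sum_distrib_left sum_divide_distrib sum_negf[symmetric] del: sum_negf)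
    ultimately show ?thesis by (simp add: prod.distrib)
  qed
  have i: "integrable lborel (\<lambda>\<xi>. exp (- \<i> * complex_of_real (\<xi> \<bullet> w)) * complex_of_real (exp (- (t * norm \<xi>)\<^sup>2 / 2)))" for w :: 'a
    unfolding eq by (rule integrable_lborel_prod) (rule gaussian_integrable_1d[OF t])
  from integrable_Re[OF i[of 0]] show "integrable lborel (\<lambda>\<xi>::'a. exp (- (t * norm \<xi>)\<^sup>2 / 2))"
    by simp
  have "fourier (\<lambda>\<xi>. complex_of_real (exp (- (t * norm \<xi>)\<^sup>2 / 2))) w
      = (\<Prod>b\<in>(Basis::'a set). complex_of_real (sqrt (2 * pi) / t * exp (- ((w \<bullet> b) / t)\<^sup>2 / 2)))"
    unfolding fourier_def eq
    by (subst integral_lborel_prod[OF gaussian_integrable_1d[OF t]]) (simp only: gaussian_fourier_1d[OF t])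
  also have "\<dots> = complex_of_real ((sqrt (2 * pi) / t) ^ DIM('a) * (\<Prod>b\<in>Basis. exp (- ((w \<bullet> b) / t)\<^sup>2 / 2)))"
    by (simp only: of_real_prod[symmetric] prod.distrib prod_constant)
  also have "(\<Prod>b\<in>Basis. exp (- ((w \<bullet> b) / t)\<^sup>2 / 2)) = exp (- (norm w / t)\<^sup>2 / 2)"
    by (simp add: exp_sum[symmetric] power_divide nsq sum_divide_distrib sum_negf[symmetric] del: sum_negf)
  finally show "fourier (\<lambda>\<xi>. complex_of_real (exp (- (t * norm \<xi>)\<^sup>2 / 2))) w
      = complex_of_real ((sqrt (2 * pi) / t) ^ DIM('a) * exp (- (norm w / t)\<^sup>2 / 2))" .
qed

text \<open>Absolute convergence for Fubini in the multiplication formula, in the correlation of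
  test functions and in the convolution theorem.\<close>

lemma integrable_kernel:
  fixes f :: "'a::euclidean_space \<Rightarrow> complex" and g :: "'b::euclidean_space \<Rightarrow> complex"
  assumes f: "integrable lborel f" and g: "integrable lborel g"
    and k: "k \<in> borel_measurable (lborel \<Otimes>\<^sub>M lborel)" and kb: "\<And>z. cmod (k z) \<le> C"
  shows "integrable (lborel \<Otimes>\<^sub>M lborel) (\<lambda>(x, y). f x * g y * k (x, y))"
proof -
  have [measurable]: "f \<in> borel_measurable borel" "g \<in> borel_measurable borel" using f g by auto
  have 1: "integrable (lborel \<Otimes>\<^sub>M lborel) (\<lambda>z. f (fst z) * g (snd z))"
  proof (rule lborel_pair.Fubini_integrable)
    show "integrable lborel (\<lambda>x. \<integral>y. norm (f (fst (x, y)) * g (snd (x, y))) \<partial>lborel)"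
      using f by (simp add: norm_mult)
    show "AE x in lborel. integrable lborel (\<lambda>y. f (fst (x, y)) * g (snd (x, y)))"
      using g by simp
  qed measurable
  have "integrable (lborel \<Otimes>\<^sub>M lborel) (\<lambda>z. C *\<^sub>R (f (fst z) * g (snd z)))"
    by (rule integrable_scaleR_right[OF 1])
  then show ?thesis
  proof (rule Bochner_Integration.integrable_bound)
    show "(\<lambda>(x, y). f x * g y * k (x, y)) \<in> borel_measurable (lborel \<Otimes>\<^sub>M lborel)"
      using k by (simp add: case_prod_beta)
    show "AE z in lborel \<Otimes>\<^sub>M lborel. norm (case z of (x, y) \<Rightarrow> f x * g y * k (x, y)) \<le> norm (C *\<^sub>R (f (fst z) * g (snd z)))"
    proof (rule AE_I2)
      fix z :: "'a \<times> 'b"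
      have "C \<ge> 0" using order_trans[OF norm_ge_zero kb] .
      then show "norm (case z of (x, y) \<Rightarrow> f x * g y * k (x, y)) \<le> norm (C *\<^sub>R (f (fst z) * g (snd z)))"
        using mult_left_mono[OF kb[of z], of "cmod (f (fst z)) * cmod (g (snd z))"]
        by (simp add: case_prod_beta norm_mult mult_ac)
    qed
  qed
qed

lemma norm_exp_i: "cmod (exp (- \<i> * complex_of_real r)) = 1"
  using norm_exp_i_times[of "- r"] by simp

lemma integrable_bounded_mult:
  fixes f :: "'a \<Rightarrow> complex"
  assumes "integrable M f" "m \<in> borel_measurable M" "\<And>x. cmod (m x) \<le> C"
  shows "integrable M (\<lambda>x. m x * f x)"
proof (rule Bochner_Integration.integrable_bound)
  show "integrable M (\<lambda>x. C *\<^sub>R f x)" using assms by simp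
  show "AE x in M. norm (m x * f x) \<le> norm (C *\<^sub>R f x)"
  proof (rule AE_I2)
    fix x
    have "C \<ge> 0" using order_trans[OF norm_ge_zero assms(3)] .
    then show "norm (m x * f x) \<le> norm (C *\<^sub>R f x)"
      using assms(3) by (auto simp: norm_mult intro: mult_right_mono)
  qed
qed (use assms in auto)

lemma fourier_integrand:
  assumes "integrable lborel f"
  shows "integrable lborel (\<lambda>x. exp (- \<i> * complex_of_real (x \<bullet> \<xi>)) * f x)"
  by (rule integrable_bounded_mult[OF assms, of _ 1]) (simp_all add: norm_exp_i)

lemma fourier_bounded:
  "cmod (fourier f \<xi>) \<le> (\<integral>x. cmod (f x) \<partial>lborel)"
proof -
  have "cmod (fourier f \<xi>) \<le> (\<integral>x. cmod (exp (- \<i> * complex_of_real (x \<bullet> \<xi>)) * f x) \<partial>lborel)"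
    unfolding fourier_def by (rule integral_norm_bound)
  then show ?thesis by (simp only: norm_mult norm_exp_i mult_1)
qed

lemma fourier_measurable [measurable]:
  assumes "f \<in> borel_measurable borel"
  shows "fourier f \<in> borel_measurable borel"
proof -
  have [measurable]: "f \<in> borel_measurable borel" by fact
  have "(\<lambda>\<xi>. \<integral>x. exp (- \<i> * complex_of_real (x \<bullet> \<xi>)) * f x \<partial>lborel) \<in> borel_measurable lborel"
    by (rule lborel.borel_measurable_lebesgue_integral) measurable
  then show ?thesis by (simp add: fourier_def[abs_def])
qed

lemma fourier_mult_formula:
  assumes f: "integrable lborel f" and g: "integrable lborel g"
  shows "(\<integral>\<xi>. fourier f \<xi> * g \<xi> \<partial>lborel) = (\<integral>x. f x * fourier g x \<partial>lborel)"
proof -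
  define k where "k z = exp (- \<i> * complex_of_real (fst z \<bullet> snd z))" for z :: "'a \<times> 'a"
  have k: "integrable (lborel \<Otimes>\<^sub>M lborel) (\<lambda>(x, y). f x * g y * k (x, y))"
    by (rule integrable_kernel[OF f g, where C=1]) (auto simp: k_def norm_exp_i)
  from lborel_pair.Fubini_integral[OF this]
  have "(\<integral>y. (\<integral>x. f x * g y * k (x, y) \<partial>lborel) \<partial>lborel) = (\<integral>x. (\<integral>y. f x * g y * k (x, y) \<partial>lborel) \<partial>lborel)"
    by simp
  moreover have "(\<integral>x. f x * g y * k (x, y) \<partial>lborel) = fourier f y * g y" for y
    unfolding fourier_def k_def
    by (subst Bochner_Integration.integral_mult_left_zero[symmetric]) (simp add: mult_ac)
  moreover have "(\<integral>y. f x * g y * k (x, y) \<partial>lborel) = f x * fourier g x" for x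
    unfolding fourier_def k_def
    by (subst integral_mult_right_zero[symmetric]) (simp add: mult_ac inner_commute)
  ultimately show ?thesis by simp
qed

text \<open>Reflection with conjugation conjugates the transform, and the shift by \<open>x\<close>
  becomes a phase. This produces the square modulus in Plancherel's identity and later the
  transforms of translated mollifiers.\<close>

lemma fourier_cnj_reflect:
  fixes f :: "'a::euclidean_space \<Rightarrow> complex"
  assumes f: "integrable lborel f"
  shows "fourier (\<lambda>y. cnj (f (x - y))) \<xi> = exp (- \<i> * complex_of_real (x \<bullet> \<xi>)) * cnj (fourier f \<xi>)"
proof -
  have [measurable]: "f \<in> borel_measurable borel" using f by auto
  have "fourier (\<lambda>y. cnj (f (x - y))) \<xi> = (\<integral>y. exp (- \<i> * complex_of_real ((x - y) \<bullet> \<xi>)) * cnj (f y) \<partial>lborel)"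
    unfolding fourier_def
    by (subst lborel_integral_affine[of "-1" _ x]) (simp_all add: scaleR_minus1_left)
  also have "\<dots> = (\<integral>y. exp (- \<i> * complex_of_real (x \<bullet> \<xi>)) * cnj (exp (- \<i> * complex_of_real (y \<bullet> \<xi>)) * f y) \<partial>lborel)"
    by (rule Bochner_Integration.integral_cong)
       (auto simp: inner_diff_left right_diff_distrib exp_cnj exp_add[symmetric] simp flip: mult.assoc)
  also have "\<dots> = exp (- \<i> * complex_of_real (x \<bullet> \<xi>)) * cnj (fourier f \<xi>)"
    unfolding fourier_def by (subst integral_mult_right_zero) (simp only: Bochner_Integration.integral_cnj)
  finally show ?thesis .
qed

text \<open>With a Gaussian factor on the Fourier side everything is absolutely convergent; as it flattens, the right-hand
  side tends to \<open>\<parallel>f\<parallel>\<^sup>2\<close> by continuity of translations in \<open>L\<^sup>2\<close>.\<close>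

lemma plancherel_gaussian:
  fixes f :: "'a::euclidean_space \<Rightarrow> complex"
  assumes f: "integrable lborel f" and f2: "L2 f" and t: "t > 0"
  shows "integrable lborel (\<lambda>\<xi>. (cmod (fourier f \<xi>))\<^sup>2 * exp (- (t * norm \<xi>)\<^sup>2 / 2))" (is ?I)
    and "(\<integral>\<xi>. (cmod (fourier f \<xi>))\<^sup>2 * exp (- (t * norm \<xi>)\<^sup>2 / 2) \<partial>lborel)
     = (sqrt (2 * pi)) ^ DIM('a) * (\<integral>z. exp (- (norm z)\<^sup>2 / 2) * inner (cls f) (cls (\<lambda>x. f (x + - (t *\<^sub>R z)))) \<partial>lborel)"
proof -
  have [measurable]: "f \<in> borel_measurable borel" using f by auto
  define G where "G \<xi> = complex_of_real (exp (- (t * norm \<xi>)\<^sup>2 / 2))" for \<xi> :: 'a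
  define B where "B = (\<integral>x. cmod (f x) \<partial>lborel)"
  define c where "c = (sqrt (2 * pi)) ^ DIM('a)"
  have [measurable]: "G \<in> borel_measurable borel" unfolding G_def by measurable
  have Gi: "integrable lborel G"
    using integrable_of_real[OF integrable_gaussian[OF t]] by (simp add: G_def[abs_def])
  have gi: "integrable lborel (\<lambda>\<xi>. cnj (fourier f \<xi>) * G \<xi>)"
    by (rule integrable_bounded_mult[OF Gi, where C=B]) (auto simp: B_def fourier_bounded)
  have gi2: "integrable lborel (\<lambda>\<xi>. fourier f \<xi> * (cnj (fourier f \<xi>) * G \<xi>))"
    by (rule integrable_bounded_mult[OF gi, where C=B]) (auto simp: B_def fourier_bounded)
  have eqr: "fourier f \<xi> * (cnj (fourier f \<xi>) * G \<xi>) = complex_of_real ((cmod (fourier f \<xi>))\<^sup>2 * exp (- (t * norm \<xi>)\<^sup>2 / 2))" for \<xi>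
    by (simp only: G_def of_real_mult complex_norm_square mult.assoc)
  have Ls: "L2 (\<lambda>x. f (x - w))" for w using L2_affine[of 1 f "- w"] f2 by simp
  \<comment> \<open>Uniform in the shift \<open>w\<close>, so the Gaussian in z alone makes the
    double integral below absolutely convergent.\<close>
  have bd: "(\<integral>x. cmod (f x * cnj (f (x - w))) \<partial>lborel) \<le> 2 * (norm (cls f))\<^sup>2" for w
  proof -
    have "(\<integral>x. cmod (f x * cnj (f (x - w))) \<partial>lborel) \<le> (\<integral>x. (cmod (f x))\<^sup>2 + (cmod (f (x - w)))\<^sup>2 \<partial>lborel)"
    proof (rule integral_mono)
      show "integrable lborel (\<lambda>x. cmod (f x * cnj (f (x - w))))"
        by (intro integrable_norm L2_integrable_mult f2 L2_cnj Ls)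
      show "integrable lborel (\<lambda>x. (cmod (f x))\<^sup>2 + (cmod (f (x - w)))\<^sup>2)"
        by (intro Bochner_Integration.integrable_add L2_integrable_sq f2 Ls)
      fix x
      show "cmod (f x * cnj (f (x - w))) \<le> (cmod (f x))\<^sup>2 + (cmod (f (x - w)))\<^sup>2"
        using sum_squares_bound[of "cmod (f x)" "cmod (f (x - w))"]
          mult_nonneg_nonneg[OF norm_ge_zero[of "f x"] norm_ge_zero[of "f (x - w)"]]
        unfolding norm_mult complex_mod_cnj by linarith
    qed
    also have "\<dots> = (norm (cls f))\<^sup>2 + (norm (cls (\<lambda>x. f (x - w))))\<^sup>2"
      by (simp add: norm_cls_sq f2 Ls L2_integrable_sq)
    also have "norm (cls (\<lambda>x. f (x - w))) = norm (cls f)"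
      using norm_cls_shift[OF f2, of "- w"] by simp
    finally show ?thesis by simp
  qed
  show ?I using integrable_Re[OF gi2] unfolding eqr by simp
  have "(\<integral>\<xi>. fourier f \<xi> * (cnj (fourier f \<xi>) * G \<xi>) \<partial>lborel) = (\<integral>x. f x * fourier (\<lambda>\<xi>. cnj (fourier f \<xi>) * G \<xi>) x \<partial>lborel)"
    by (rule fourier_mult_formula[OF f gi])
  also have "\<dots> = (\<integral>x. (\<integral>z. f x * (cnj (f (x - t *\<^sub>R z)) * complex_of_real (c * exp (- (norm z)\<^sup>2 / 2))) \<partial>lborel) \<partial>lborel)"
  proof (rule Bochner_Integration.integral_cong[OF refl])
    fix x
    have fi: "integrable lborel (\<lambda>y. cnj (f (x - y)))"
      using lborel_integrable_affine[OF _ f, of "-1" x] by (simp add: scaleR_minus1_left)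
    have "fourier (\<lambda>\<xi>. cnj (fourier f \<xi>) * G \<xi>) x = (\<integral>\<xi>. fourier (\<lambda>y. cnj (f (x - y))) \<xi> * G \<xi> \<partial>lborel)"
      unfolding fourier_cnj_reflect[OF f] by (simp add: fourier_def mult.assoc inner_commute)
    also have "\<dots> = (\<integral>y. cnj (f (x - y)) * fourier G y \<partial>lborel)"
      by (rule fourier_mult_formula[OF fi Gi])
    \<comment> \<open>Substitution y = t z: the Jacobian t^d cancels the factor t^(-d) in the
      transform of the Gaussian. A fixed Gaussian weight remains, with shifts of size t |z|.\<close>
    also have "\<dots> = t ^ DIM('a) *\<^sub>R (\<integral>z. cnj (f (x - t *\<^sub>R z)) * fourier G (t *\<^sub>R z) \<partial>lborel)"
      using t by (subst lborel_integral_affine[of t _ 0]) auto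
    also have "\<dots> = (\<integral>z. cnj (f (x - t *\<^sub>R z)) * complex_of_real (c * exp (- (norm z)\<^sup>2 / 2)) \<partial>lborel)"
    proof -
      have "t ^ DIM('a) *\<^sub>R (cnj (f (x - t *\<^sub>R z)) * fourier G (t *\<^sub>R z))
          = cnj (f (x - t *\<^sub>R z)) * complex_of_real (c * exp (- (norm z)\<^sup>2 / 2))" for z
        unfolding G_def[abs_def] fourier_gaussian[OF t] c_def
        using t by (simp add: scaleR_conv_of_real power_divide)
      then show ?thesis by (simp only: integral_scaleR_right[symmetric])
    qed
    finally show "f x * fourier (\<lambda>\<xi>. cnj (fourier f \<xi>) * G \<xi>) x
      = (\<integral>z. f x * (cnj (f (x - t *\<^sub>R z)) * complex_of_real (c * exp (- (norm z)\<^sup>2 / 2))) \<partial>lborel)"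
      by simp
  qed
  also have "\<dots> = (\<integral>z. (\<integral>x. f x * (cnj (f (x - t *\<^sub>R z)) * complex_of_real (c * exp (- (norm z)\<^sup>2 / 2))) \<partial>lborel) \<partial>lborel)"
  proof -
    have "integrable (lborel \<Otimes>\<^sub>M lborel) (\<lambda>q. f (snd q) * (cnj (f (snd q - t *\<^sub>R fst q)) * complex_of_real (c * exp (- (norm (fst q))\<^sup>2 / 2))))"
    proof (rule lborel_pair.Fubini_integrable)
      show "AE z in lborel. integrable lborel (\<lambda>x. f (snd (z, x)) * (cnj (f (snd (z, x) - t *\<^sub>R fst (z, x))) * complex_of_real (c * exp (- (norm (fst (z, x)))\<^sup>2 / 2))))"
        by (intro AE_I2) (simp add: mult.assoc[symmetric] L2_integrable_mult L2_cnj f2 Ls)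
      show "integrable lborel (\<lambda>z. \<integral>x. norm (f (snd (z, x)) * (cnj (f (snd (z, x) - t *\<^sub>R fst (z, x))) * complex_of_real (c * exp (- (norm (fst (z, x)))\<^sup>2 / 2)))) \<partial>lborel)"
      proof (rule Bochner_Integration.integrable_bound)
        show "integrable lborel (\<lambda>z::'a. (2 * (norm (cls f))\<^sup>2 * c) * exp (- (1 * norm z)\<^sup>2 / 2))"
          by (intro integrable_mult_right integrable_gaussian) auto
        show "AE z in lborel. norm (\<integral>x. norm (f (snd (z, x)) * (cnj (f (snd (z, x) - t *\<^sub>R fst (z, x))) * complex_of_real (c * exp (- (norm (fst (z, x)))\<^sup>2 / 2)))) \<partial>lborel)
          \<le> norm ((2 * (norm (cls f))\<^sup>2 * c) * exp (- (1 * norm z)\<^sup>2 / 2))"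
        proof (rule AE_I2)
          fix z :: 'a
          have c0: "c \<ge> 0" by (simp add: c_def)
          have "(\<integral>x. norm (f x * (cnj (f (x - t *\<^sub>R z)) * complex_of_real (c * exp (- (norm z)\<^sup>2 / 2)))) \<partial>lborel)
             = (\<integral>x. norm (f x * cnj (f (x - t *\<^sub>R z))) * (c * exp (- (norm z)\<^sup>2 / 2)) \<partial>lborel)"
            using c0 by (intro Bochner_Integration.integral_cong) (auto simp: norm_mult)
          also have "\<dots> = (\<integral>x. norm (f x * cnj (f (x - t *\<^sub>R z))) \<partial>lborel) * (c * exp (- (norm z)\<^sup>2 / 2))"
            by (rule integral_mult_left_zero)
          also have "\<dots> \<le> (2 * (norm (cls f))\<^sup>2) * (c * exp (- (norm z)\<^sup>2 / 2))"
            by (rule mult_right_mono[OF bd]) (simp add: c0)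
          finally show "norm (\<integral>x. norm (f (snd (z, x)) * (cnj (f (snd (z, x) - t *\<^sub>R fst (z, x))) * complex_of_real (c * exp (- (norm (fst (z, x)))\<^sup>2 / 2)))) \<partial>lborel)
            \<le> norm ((2 * (norm (cls f))\<^sup>2 * c) * exp (- (1 * norm z)\<^sup>2 / 2))"
            using c0 by (simp add: mult_ac)
        qed
      qed measurable
    qed measurable
    from lborel_pair.Fubini_integral[of "\<lambda>z x. f x * (cnj (f (x - t *\<^sub>R z)) * complex_of_real (c * exp (- (norm z)\<^sup>2 / 2)))"] this
    show ?thesis by (simp add: case_prod_beta')
  qed
  finally have eq: "(\<integral>\<xi>. complex_of_real ((cmod (fourier f \<xi>))\<^sup>2 * exp (- (t * norm \<xi>)\<^sup>2 / 2)) \<partial>lborel)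
      = (\<integral>z. (\<integral>x. f x * cnj (f (x - t *\<^sub>R z)) \<partial>lborel) * complex_of_real (c * exp (- (norm z)\<^sup>2 / 2)) \<partial>lborel)" (is "_ = (\<integral>z. ?K z \<partial>lborel)")
    unfolding eqr by (simp only: mult.assoc[symmetric] integral_mult_left_zero)
  have Kr: "?K z = complex_of_real c * (complex_of_real (exp (- (norm z)\<^sup>2 / 2)) * (\<integral>x. f x * cnj (f (x - t *\<^sub>R z)) \<partial>lborel))" for z
    by (simp add: mult_ac)
  have "(\<integral>\<xi>. (cmod (fourier f \<xi>))\<^sup>2 * exp (- (t * norm \<xi>)\<^sup>2 / 2) \<partial>lborel) = Re (\<integral>z. ?K z \<partial>lborel)"
    unfolding eq[symmetric] by (simp only: integral_complex_of_real Re_complex_of_real)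
  also have "\<dots> = (\<integral>z. c * (exp (- (norm z)\<^sup>2 / 2) * inner (cls f) (cls (\<lambda>x. f (x + - (t *\<^sub>R z))))) \<partial>lborel)"
  proof -
    have "integrable lborel (\<lambda>z. ?K z)"
    proof (rule Bochner_Integration.integrable_bound)
      show "integrable lborel (\<lambda>z::'a. (2 * (norm (cls f))\<^sup>2 * c) * exp (- (1 * norm z)\<^sup>2 / 2))"
        by (intro integrable_mult_right integrable_gaussian) auto
      have "(\<lambda>z. \<integral>x. f x * cnj (f (x - t *\<^sub>R z)) \<partial>lborel) \<in> borel_measurable lborel"
        by (rule lborel.borel_measurable_lebesgue_integral) measurable
      then show "(\<lambda>z. ?K z) \<in> borel_measurable lborel" by measurable
      show "AE z in lborel. norm (?K z) \<le> norm ((2 * (norm (cls f))\<^sup>2 * c) * exp (- (1 * norm z)\<^sup>2 / 2))"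
      proof (rule AE_I2)
        fix z :: 'a
        have c0: "c \<ge> 0" by (simp add: c_def)
        have "cmod (\<integral>x. f x * cnj (f (x - t *\<^sub>R z)) \<partial>lborel) \<le> 2 * (norm (cls f))\<^sup>2"
        proof -
          from order_trans[OF integral_norm_bound bd[of "t *\<^sub>R z"]] show ?thesis by simp
        qed
        from mult_right_mono[OF this, of "c * exp (- (norm z)\<^sup>2 / 2)"]
        show "norm (?K z) \<le> norm ((2 * (norm (cls f))\<^sup>2 * c) * exp (- (1 * norm z)\<^sup>2 / 2))"
          using c0 by (simp add: norm_mult mult_ac)
      qed
    qed
    from integral_Re[OF this] have "Re (\<integral>z. ?K z \<partial>lborel) = (\<integral>z. Re (?K z) \<partial>lborel)" by simp
    also have "\<dots> = (\<integral>z. c * (exp (- (norm z)\<^sup>2 / 2) * inner (cls f) (cls (\<lambda>x. f (x + - (t *\<^sub>R z))))) \<partial>lborel)"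
      unfolding Kr using f2 Ls by (simp add: inner_cls)
    finally show ?thesis .
  qed
  also have "\<dots> = c * (\<integral>z. exp (- (norm z)\<^sup>2 / 2) * inner (cls f) (cls (\<lambda>x. f (x + - (t *\<^sub>R z)))) \<partial>lborel)"
    by (rule integral_mult_right_zero)
  finally show "(\<integral>\<xi>. (cmod (fourier f \<xi>))\<^sup>2 * exp (- (t * norm \<xi>)\<^sup>2 / 2) \<partial>lborel)
     = (sqrt (2 * pi)) ^ DIM('a) * (\<integral>z. exp (- (norm z)\<^sup>2 / 2) * inner (cls f) (cls (\<lambda>x. f (x + - (t *\<^sub>R z)))) \<partial>lborel)"
    by (simp add: c_def)
qed

lemma plancherel:
  fixes f :: "'a::euclidean_space \<Rightarrow> complex"
  assumes f: "integrable lborel f" and f2: "L2 f"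
  shows L2_fourier: "L2 (fourier f)"
    and norm_fourier: "norm (cls (fourier f)) = sqrt ((2 * pi) ^ DIM('a)) * norm (cls f)"
proof -
  have fm [measurable]: "f \<in> borel_measurable borel" using f by auto
  define t where "t n = 1 / real (Suc n)" for n
  have t: "t n > 0" for n by (simp add: t_def)
  have t0: "t \<longlonglongrightarrow> 0" unfolding t_def by (rule LIMSEQ_Suc[OF lim_1_over_n])
  have tdec: "t (Suc n) \<le> t n" for n by (simp add: t_def field_simps)
  define H where "H n \<xi> = (cmod (fourier f \<xi>))\<^sup>2 * exp (- (t n * norm \<xi>)\<^sup>2 / 2)" for n \<xi>
  define J where "J n z = exp (- (norm z)\<^sup>2 / 2) * inner (cls f) (cls (\<lambda>x. f (x + - (t n *\<^sub>R z))))" for n and z :: 'a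
  define c where "c = (sqrt (2 * pi)) ^ DIM('a)"
  have g: "(\<integral>(z::'a). exp (- (norm z)\<^sup>2 / 2) \<partial>lborel) = c"
  proof -
    have "complex_of_real (\<integral>(z::'a). exp (- (1 * norm z)\<^sup>2 / 2) \<partial>lborel) = complex_of_real c"
      using fourier_gaussian[of 1 "0::'a"] unfolding integral_complex_of_real[symmetric] by (simp add: fourier_def c_def)
    then show ?thesis by (simp only: of_real_eq_iff mult_1)
  qed
  have Ls: "L2 (\<lambda>x. f (x + w))" for w using L2_affine[of 1 f w] f2 by (simp add: add.commute)
  have Jlim: "(\<lambda>n. \<integral>z. J n z \<partial>lborel) \<longlonglongrightarrow> (\<integral>(z::'a). exp (- (norm z)\<^sup>2 / 2) * (norm (cls f))\<^sup>2 \<partial>lborel)"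
  proof (rule integral_dominated_convergence)
    show "integrable lborel (\<lambda>z::'a. exp (- (1 * norm z)\<^sup>2 / 2) * (norm (cls f))\<^sup>2)"
      by (intro integrable_mult_left integrable_gaussian) auto
    show "AE z in lborel. (\<lambda>n. J n z) \<longlonglongrightarrow> exp (- (norm z)\<^sup>2 / 2) * (norm (cls f))\<^sup>2"
    proof (rule AE_I2)
      fix z :: 'a
      have "(\<lambda>n. - (t n *\<^sub>R z)) \<longlonglongrightarrow> - (0 *\<^sub>R z)" by (intro tendsto_intros t0)
      then have "(\<lambda>n. cls (\<lambda>x. f (x + - (t n *\<^sub>R z)))) \<longlonglongrightarrow> cls f"
        by (intro L2_translation_continuous f2) simp
      then show "(\<lambda>n. J n z) \<longlonglongrightarrow> exp (- (norm z)\<^sup>2 / 2) * (norm (cls f))\<^sup>2"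
        unfolding J_def power2_norm_eq_inner[of "cls f"] by (intro tendsto_intros)
    qed
    show "AE z in lborel. norm (J n z) \<le> exp (- (1 * norm z)\<^sup>2 / 2) * (norm (cls f))\<^sup>2" for n
    proof (rule AE_I2)
      fix z :: 'a
      have "\<bar>inner (cls f) (cls (\<lambda>x. f (x + - (t n *\<^sub>R z))))\<bar> \<le> norm (cls f) * norm (cls (\<lambda>x. f (x + - (t n *\<^sub>R z))))"
        by (rule Cauchy_Schwarz_ineq2)
      also have "norm (cls (\<lambda>x. f (x + - (t n *\<^sub>R z)))) = norm (cls f)" by (rule norm_cls_shift[OF f2])
      finally show "norm (J n z) \<le> exp (- (1 * norm z)\<^sup>2 / 2) * (norm (cls f))\<^sup>2"
        by (simp add: J_def abs_mult power2_eq_square)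
    qed
    show "J n \<in> borel_measurable lborel" for n
    proof -
      have "(\<lambda>z. \<integral>x. f x * cnj (f (x + - (t n *\<^sub>R z))) \<partial>lborel) \<in> borel_measurable lborel"
        by (rule lborel.borel_measurable_lebesgue_integral) measurable
      then have "(\<lambda>z. exp (- (norm z)\<^sup>2 / 2) * Re (\<integral>x. f x * cnj (f (x + - (t n *\<^sub>R z))) \<partial>lborel)) \<in> borel_measurable lborel"
        by measurable
      then show ?thesis unfolding J_def inner_cls[OF f2 Ls] .
    qed
  qed measurable
  have Hi: "integrable lborel (H n)" for n
    using plancherel_gaussian(1)[OF f f2 t[of n]] by (simp add: H_def[abs_def])
  have H_int: "(\<integral>\<^sup>+\<xi>. ennreal (H n \<xi>) \<partial>lborel) = ennreal (c * (\<integral>z. J n z \<partial>lborel))" for n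
    using plancherel_gaussian(2)[OF f f2 t[of n]] Hi[of n]
    by (subst nn_integral_eq_integral) (auto simp: H_def[abs_def] J_def[abs_def] c_def)
  \<comment> \<open>Monotone convergence in the extended nonnegative reals requires no prior
    integrability; finiteness of the limit then proves that the transform is
    square-integrable.\<close>
  have "(\<lambda>n. \<integral>\<^sup>+\<xi>. ennreal (H n \<xi>) \<partial>lborel) \<longlonglongrightarrow> (\<integral>\<^sup>+\<xi>. ennreal ((cmod (fourier f \<xi>))\<^sup>2) \<partial>lborel)"
  proof (rule nn_integral_LIMSEQ)
    show "incseq (\<lambda>n \<xi>. ennreal (H n \<xi>))"
    proof (rule incseq_SucI, rule le_funI)
      fix n and \<xi> :: 'a
      have "(t (Suc n) * norm \<xi>)\<^sup>2 \<le> (t n * norm \<xi>)\<^sup>2"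
        using t[of "Suc n"] by (intro power_mono mult_right_mono tdec) auto
      then show "ennreal (H n \<xi>) \<le> ennreal (H (Suc n) \<xi>)"
        unfolding H_def by (intro ennreal_leI mult_left_mono) auto
    qed
    show "(\<lambda>n. ennreal (H n \<xi>)) \<longlonglongrightarrow> ennreal ((cmod (fourier f \<xi>))\<^sup>2)" for \<xi>
    proof -
      have "(\<lambda>n. H n \<xi>) \<longlonglongrightarrow> (cmod (fourier f \<xi>))\<^sup>2 * exp (- (0 * norm \<xi>)\<^sup>2 / 2)"
        unfolding H_def by (intro tendsto_intros t0) auto
      then show ?thesis by (intro tendsto_ennrealI) simp
    qed
  qed (simp add: H_def[abs_def])
  moreover have "(\<lambda>n. \<integral>\<^sup>+\<xi>. ennreal (H n \<xi>) \<partial>lborel) \<longlonglongrightarrow> ennreal (c * (c * (norm (cls f))\<^sup>2))"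
    unfolding H_int using Jlim unfolding integral_mult_left_zero g by (intro tendsto_ennrealI tendsto_mult_left)
  ultimately have eq: "(\<integral>\<^sup>+\<xi>. ennreal ((cmod (fourier f \<xi>))\<^sup>2) \<partial>lborel) = ennreal (c * (c * (norm (cls f))\<^sup>2))"
    by (rule LIMSEQ_unique)
  then show L: "L2 (fourier f)" by (simp add: L2_def)
  \<comment> \<open>One factor \<open>c\<close> comes from the transform of the Gaussian, the other
    from the integral of the Gaussian weight.\<close>
  have c2: "c * c = (2 * pi) ^ DIM('a)" unfolding c_def power_mult_distrib[symmetric] by simp
  have c0: "c \<ge> 0" by (simp add: c_def)
  from eq have "(norm (cls (fourier f)))\<^sup>2 = c * (c * (norm (cls f))\<^sup>2)"
    using c0 by (simp add: nn_integral_cls[OF L])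
  also have "\<dots> = (sqrt ((2 * pi) ^ DIM('a)) * norm (cls f))\<^sup>2"
    by (simp add: power_mult_distrib c2 flip: mult.assoc)
  finally show "norm (cls (fourier f)) = sqrt ((2 * pi) ^ DIM('a)) * norm (cls f)"
    by (rule power2_eq_imp_eq) auto
qed

section \<open>Extension of the Fourier transform to L2\<close>

text \<open>Used in two roles: in space it makes square-integrable functions integrable, in
  frequency it is the projection of the strong form of the equation.\<close>

definition trunc :: "nat \<Rightarrow> 'a::euclidean_space \<Rightarrow> complex" where
  "trunc n t = (if norm t \<le> real n then 1 else 0)"

lemma trunc_measurable [measurable]: "trunc n \<in> borel_measurable borel"
  unfolding trunc_def[abs_def] by measurable

lemma trunc_bounded: "cmod (trunc n t) \<le> 1"
  by (simp add: trunc_def)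

lemma bmeas_trunc [simp]: "bmeas (trunc n)"
  by (rule bmeasI[OF trunc_measurable trunc_bounded])

lemma trunc_pointwise: "(\<lambda>n. trunc n t) \<longlonglongrightarrow> 1"
proof -
  obtain N where "norm t \<le> real N" using real_arch_simple by blast
  then show ?thesis
    by (intro tendsto_eventually eventually_sequentiallyI[of N]) (auto simp: trunc_def)
qed

lemma mul_trunc_tendsto: "(\<lambda>n. mul (trunc n) x) \<longlonglongrightarrow> x"
proof -
  have "(\<lambda>n. mul (trunc n) x) \<longlonglongrightarrow> mul (\<lambda>_. 1) x"
    by (rule mul_tendsto[where c=1]) (simp_all add: trunc_bounded trunc_pointwise)
  then show ?thesis by simp
qed

lemma L2_trunc: "L2 f \<Longrightarrow> L2 (\<lambda>t. trunc n t * f t)"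
  by (rule L2_bmeas_mult) simp

lemma integrable_trunc: assumes "L2 f" shows "integrable lborel (\<lambda>t. trunc n t * f t)"
proof (rule L2_integrable_mult)
  show "L2 (trunc n)"
    by (rule L2_bounded_support[of _ 1 "real n"]) (auto simp: trunc_def)
qed (rule assms)

text \<open>The kernel of the transform carries no normalisation, so squared norms grow by this
  factor. The type argument only transports the dimension.\<close>

definition FT_const :: "'a::euclidean_space itself \<Rightarrow> real" where
  "FT_const _ = (2 * pi) ^ DIM('a)"

lemma FT_const_pos [simp]: "FT_const t > 0"
  by (simp add: FT_const_def)

lemma FT_const_nonzero [simp]: "FT_const t \<noteq> 0"
  by (simp add: FT_const_def)

text \<open>The limit exists because the space cutoffs of \<open>x\<close> form a Cauchy sequence
  and Plancherel's identity transports this to the transforms; see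
  \<open>FF_tendsto\<close>.\<close>

definition FF :: "'a::euclidean_space l2 \<Rightarrow> 'a l2" where
  "FF x = lim (\<lambda>n. cls (fourier (\<lambda>t. trunc n t * rep x t)))"

lemma fourier_add:
  "integrable lborel f \<Longrightarrow> integrable lborel g \<Longrightarrow> fourier (\<lambda>t. f t + g t) = (\<lambda>\<xi>. fourier f \<xi> + fourier g \<xi>)"
  unfolding fourier_def using fourier_integrand[of f] fourier_integrand[of g]
  by (simp add: distrib_left)

lemma fourier_diff:
  "integrable lborel f \<Longrightarrow> integrable lborel g \<Longrightarrow> fourier (\<lambda>t. f t - g t) = (\<lambda>\<xi>. fourier f \<xi> - fourier g \<xi>)"
  unfolding fourier_def using fourier_integrand[of f] fourier_integrand[of g]
  by (simp add: right_diff_distrib)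

lemma fourier_cmult: "fourier (\<lambda>t. c * f t) \<xi> = c * fourier f \<xi>"
  unfolding fourier_def
  by (simp only: mult.left_commute[of _ c] integral_mult_right_zero)

lemma fourier_cong_AE:
  assumes "f \<in> borel_measurable borel" "g \<in> borel_measurable borel" "AE t in lborel. f t = g t"
  shows "fourier f = fourier g"
proof
  fix \<xi>
  have [measurable]: "f \<in> borel_measurable borel" "g \<in> borel_measurable borel" by fact+
  show "fourier f \<xi> = fourier g \<xi>"
    unfolding fourier_def
  proof (rule integral_cong_AE)
    show "AE x in lborel. exp (- \<i> * complex_of_real (x \<bullet> \<xi>)) * f x = exp (- \<i> * complex_of_real (x \<bullet> \<xi>)) * g x"
      using assms(3) by eventually_elim simp
  qed measurable
qed

lemma norm_fourier_diff:
  fixes f g :: "'a::euclidean_space \<Rightarrow> complex"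
  assumes "integrable lborel f" "integrable lborel g" "L2 f" "L2 g"
  shows "norm (cls (fourier f) - cls (fourier g)) = sqrt (FT_const TYPE('a)) * norm (cls f - cls g)"
proof -
  have "cls (fourier f) - cls (fourier g) = cls (fourier (\<lambda>t. f t - g t))"
    using assms by (simp add: cls_diff L2_fourier fourier_diff)
  then show ?thesis
    using assms norm_fourier[of "\<lambda>t. f t - g t"] by (simp add: cls_diff L2_diff FT_const_def)
qed

lemma FF_tendsto:
  assumes f: "L2 f"
  shows "(\<lambda>n. cls (fourier (\<lambda>t. trunc n t * f t))) \<longlonglongrightarrow> FF (cls f)"
proof -
  have C: "Cauchy (\<lambda>n. mul (trunc n) (cls f))"
    by (rule LIMSEQ_imp_Cauchy[OF mul_trunc_tendsto])
  have eq: "fourier (\<lambda>t. trunc n t * rep (cls f) t) = fourier (\<lambda>t. trunc n t * f t)" for n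
  proof (rule fourier_cong_AE)
    have [measurable]: "f \<in> borel_measurable borel" using L2_measurable[OF f] by simp
    show "(\<lambda>t. trunc n t * f t) \<in> borel_measurable borel" by measurable
    show "AE t in lborel. trunc n t * rep (cls f) t = trunc n t * f t"
      using rep_cls[OF f] by eventually_elim simp
  qed measurable
  have "Cauchy (\<lambda>n. cls (fourier (\<lambda>t. trunc n t * f t)))"
    unfolding Cauchy_iff
  proof (intro allI impI)
    fix e :: real assume e: "e > 0"
    have k: "sqrt (FT_const TYPE('a)) > 0" by (simp add: FT_const_def)
    with e have "e / sqrt (FT_const TYPE('a)) > 0" by simp
    then obtain M where M: "\<And>m n. m \<ge> M \<Longrightarrow> n \<ge> M \<Longrightarrow> norm (mul (trunc m) (cls f) - mul (trunc n) (cls f)) < e / sqrt (FT_const TYPE('a))"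
      using C unfolding Cauchy_iff by meson
    show "\<exists>M. \<forall>m\<ge>M. \<forall>n\<ge>M. norm (cls (fourier (\<lambda>t. trunc m t * f t)) - cls (fourier (\<lambda>t. trunc n t * f t))) < e"
    proof (intro exI allI impI)
      fix m n assume "m \<ge> M" "n \<ge> M"
      from M[OF this] show "norm (cls (fourier (\<lambda>t. trunc m t * f t)) - cls (fourier (\<lambda>t. trunc n t * f t))) < e"
        unfolding pos_less_divide_eq[OF k]
        by (simp add: norm_fourier_diff integrable_trunc L2_trunc f mul_cls mult.commute[of _ "sqrt _"])
    qed
  qed
  then show ?thesis
    by (simp add: FF_def eq Cauchy_convergent_iff convergent_LIMSEQ_iff)
qed

lemma FF_cls:
  fixes f :: "'a::euclidean_space \<Rightarrow> complex"
  assumes f: "L2 f" "integrable lborel f"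
  shows "FF (cls f) = cls (fourier f)"
proof (rule LIMSEQ_unique[OF FF_tendsto[OF f(1)]])
  have "(\<lambda>n. sqrt (FT_const TYPE('a)) * norm (mul (trunc n) (cls f) - cls f)) \<longlonglongrightarrow> sqrt (FT_const TYPE('a)) * norm (cls f - cls f)"
    by (intro tendsto_intros mul_trunc_tendsto)
  then have "(\<lambda>n. norm (cls (fourier (\<lambda>t. trunc n t * f t)) - cls (fourier f))) \<longlonglongrightarrow> 0"
    using f by (simp add: norm_fourier_diff integrable_trunc L2_trunc mul_cls)
  then show "(\<lambda>n. cls (fourier (\<lambda>t. trunc n t * f t))) \<longlonglongrightarrow> cls (fourier f)"
    by (simp add: tendsto_norm_zero_iff LIM_zero_iff)
qed

lemma FF_add: "FF (x + y) = FF x + FF y"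
proof -
  obtain f where f: "L2 f" "x = cls f" by (rule l2_cases)
  obtain g where g: "L2 g" "y = cls g" by (rule l2_cases)
  have "(\<lambda>n. cls (fourier (\<lambda>t. trunc n t * f t)) + cls (fourier (\<lambda>t. trunc n t * g t))) \<longlonglongrightarrow> FF x + FF y"
    using f g by (intro tendsto_add) (auto intro: FF_tendsto)
  moreover have "cls (fourier (\<lambda>t. trunc n t * f t)) + cls (fourier (\<lambda>t. trunc n t * g t)) = cls (fourier (\<lambda>t. trunc n t * (f t + g t)))" for n
    using f g by (simp add: cls_add L2_fourier integrable_trunc L2_trunc distrib_left fourier_add)
  moreover have "(\<lambda>n. cls (fourier (\<lambda>t. trunc n t * (f t + g t)))) \<longlonglongrightarrow> FF (x + y)"
    using FF_tendsto[OF L2_add[OF f(1) g(1)]] f g by (simp add: cls_add)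
  ultimately show ?thesis by (simp add: LIMSEQ_unique)
qed

lemma FF_cmult: "FF (mul (\<lambda>_. c) x) = mul (\<lambda>_. c) (FF x)"
proof -
  obtain f where f: "L2 f" "x = cls f" by (rule l2_cases)
  have "(\<lambda>n. mul (\<lambda>_. c) (cls (fourier (\<lambda>t. trunc n t * f t)))) \<longlonglongrightarrow> mul (\<lambda>_. c) (FF x)"
    using f by (auto intro: bounded_linear.tendsto[OF bounded_linear_mul] FF_tendsto)
  moreover have "mul (\<lambda>_. c) (cls (fourier (\<lambda>t. trunc n t * f t))) = cls (fourier (\<lambda>t. trunc n t * (c * f t)))" for n
    using f by (simp add: mul_cls L2_fourier integrable_trunc L2_trunc mult.left_commute[of _ c] fourier_cmult[abs_def])
  moreover have "(\<lambda>n. cls (fourier (\<lambda>t. trunc n t * (c * f t)))) \<longlonglongrightarrow> FF (mul (\<lambda>_. c) x)"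
    using FF_tendsto[OF L2_cmult[OF f(1)], of c] f by (simp add: mul_cls)
  ultimately show ?thesis by (simp add: LIMSEQ_unique)
qed

lemma mul_of_real_const: "mul (\<lambda>_. complex_of_real r) x = r *\<^sub>R x"
  by (simp add: mul_def scaleR_l2_def scaleR_conv_of_real)

lemma norm_FF: "norm (FF x) = sqrt (FT_const TYPE('a)) * norm (x :: 'a::euclidean_space l2)"
proof -
  obtain f where f: "L2 f" "x = cls f" by (rule l2_cases)
  have "(\<lambda>n. norm (cls (fourier (\<lambda>t. trunc n t * f t)))) \<longlonglongrightarrow> norm (FF x)"
    using f by (auto intro: tendsto_norm FF_tendsto)
  moreover have "norm (cls (fourier (\<lambda>t. trunc n t * f t))) = sqrt (FT_const TYPE('a)) * norm (mul (trunc n) x)" for n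
    using f by (simp add: norm_fourier integrable_trunc L2_trunc FT_const_def mul_cls)
  moreover have "(\<lambda>n. sqrt (FT_const TYPE('a)) * norm (mul (trunc n) x)) \<longlonglongrightarrow> sqrt (FT_const TYPE('a)) * norm x"
    by (intro tendsto_intros mul_trunc_tendsto)
  ultimately show ?thesis by (simp add: LIMSEQ_unique)
qed

lemma bounded_linear_FF: "bounded_linear FF"
proof (rule bounded_linear_intro)
  show "FF (x + y) = FF x + FF y" for x y :: "'a l2" by (rule FF_add)
  show "FF (r *\<^sub>R x) = r *\<^sub>R FF x" for r and x :: "'a l2"
    using FF_cmult[of "complex_of_real r" x] by (simp add: mul_of_real_const)
  show "norm (FF x) \<le> norm x * sqrt (FT_const TYPE('a))" for x :: "'a l2"
    by (simp add: norm_FF)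
qed

lemmas FF_diff = linear_diff[OF bounded_linear.linear[OF bounded_linear_FF]]
lemmas FF_scaleR = linear_scale[OF bounded_linear.linear[OF bounded_linear_FF]]
lemmas FF_zero [simp] = linear_0[OF bounded_linear.linear[OF bounded_linear_FF]]

lemma inner_FF: "inner (FF x) (FF y) = FT_const TYPE('a) * inner x (y :: 'a::euclidean_space l2)"
proof -
  have sq: "(norm (FF z))\<^sup>2 = FT_const TYPE('a) * (norm z)\<^sup>2" for z :: "'a l2"
    by (simp add: norm_FF power_mult_distrib less_imp_le)
  show ?thesis
    unfolding dot_norm[of "FF x"] dot_norm[of x] FF_add[symmetric] sq by (simp add: algebra_simps)
qed

section \<open>Conjugation, reflection and Fourier inversion\<close>

definition cj :: "'a::euclidean_space l2 \<Rightarrow> 'a l2" where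
  "cj x = cls (\<lambda>t. cnj (rep x t))"

definition refl :: "'a::euclidean_space l2 \<Rightarrow> 'a l2" where
  "refl x = cls (\<lambda>t. rep x (- t))"

lemma L2_reflect: "L2 f \<Longrightarrow> L2 (\<lambda>t. f (- t))"
  using L2_affine[of "-1" f 0] by simp

lemma AE_reflect:
  fixes P :: "'a::euclidean_space \<Rightarrow> bool"
  shows "Measurable.pred borel P \<Longrightarrow> AE x in lborel. P x \<Longrightarrow> AE x in lborel. P (- x)"
  using AE_lborel_affine[of "-1" P 0] by simp

lemma cj_cls: "L2 f \<Longrightarrow> cj (cls f) = cls (\<lambda>t. cnj (f t))"
  unfolding cj_def using rep_cls[of f] by (intro cls_eqI L2_cnj) auto

lemma refl_cls:
  assumes f: "L2 f" shows "refl (cls f) = cls (\<lambda>t. f (- t))"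
proof -
  have [measurable]: "f \<in> borel_measurable borel" using L2_measurable[OF f] by simp
  have "AE t in lborel. rep (cls f) (- t) = f (- t)"
    by (rule AE_reflect[of "\<lambda>t. rep (cls f) t = f t"]) (use rep_cls[OF f] in auto)
  then show ?thesis unfolding refl_def using f by (intro cls_eqI L2_reflect) auto
qed

lemma norm_cj: "norm (cj x) = norm x"
proof -
  obtain f where f: "L2 f" "x = cls f" by (rule l2_cases)
  have "(norm (cj x))\<^sup>2 = (norm x)\<^sup>2" using f by (simp add: cj_cls norm_cls_sq L2_cnj)
  then show ?thesis by simp
qed

lemma norm_refl: "norm (refl x) = norm x"
proof -
  obtain f where f: "L2 f" "x = cls f" by (rule l2_cases)
  have [measurable]: "f \<in> borel_measurable borel" using L2_measurable[OF f(1)] by simp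
  have "(norm (refl x))\<^sup>2 = (norm x)\<^sup>2"
    using f lborel_integral_affine[of "-1" "\<lambda>t. (cmod (f t))\<^sup>2" 0]
    by (simp add: refl_cls norm_cls_sq L2_reflect)
  then show ?thesis by simp
qed

lemma cj_add: "cj (x + y) = cj x + cj y"
proof -
  obtain f where f: "L2 f" "x = cls f" by (rule l2_cases)
  obtain g where g: "L2 g" "y = cls g" by (rule l2_cases)
  show ?thesis using f g by (simp add: cj_cls cls_add L2_add L2_cnj)
qed

lemma cj_scaleR: "cj (r *\<^sub>R x) = r *\<^sub>R cj x"
proof -
  obtain f where f: "L2 f" "x = cls f" by (rule l2_cases)
  show ?thesis using f by (simp add: cj_cls cls_scaleR L2_scaleR L2_cnj)
qed

lemma refl_add: "refl (x + y) = refl x + refl y"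
proof -
  obtain f where f: "L2 f" "x = cls f" by (rule l2_cases)
  obtain g where g: "L2 g" "y = cls g" by (rule l2_cases)
  show ?thesis using f g by (simp add: refl_cls cls_add L2_add L2_reflect)
qed

lemma refl_scaleR: "refl (r *\<^sub>R x) = r *\<^sub>R refl x"
proof -
  obtain f where f: "L2 f" "x = cls f" by (rule l2_cases)
  show ?thesis using f by (simp add: refl_cls cls_scaleR L2_scaleR L2_reflect)
qed

lemma bounded_linear_cj: "bounded_linear cj"
  by (rule bounded_linear_intro[where K=1]) (simp_all add: cj_add cj_scaleR norm_cj)

lemma bounded_linear_refl: "bounded_linear refl"
  by (rule bounded_linear_intro[where K=1]) (simp_all add: refl_add refl_scaleR norm_refl)

lemma cj_cj [simp]: "cj (cj x) = x"
proof -
  obtain f where f: "L2 f" "x = cls f" by (rule l2_cases)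
  show ?thesis using f by (simp add: cj_cls L2_cnj)
qed

lemma refl_refl [simp]: "refl (refl x) = x"
proof -
  obtain f where f: "L2 f" "x = cls f" by (rule l2_cases)
  show ?thesis using f by (simp add: refl_cls L2_reflect)
qed

text \<open>Space cutoffs are integrable and converge to \<open>x\<close>, so a closed property
  passes from them to \<open>x\<close>.\<close>

lemma L2_limit_truncated:
  assumes "\<And>f. L2 f \<Longrightarrow> integrable lborel f \<Longrightarrow> P (cls f)"
    and "closed {x. P x}"
  shows "P (x :: 'a::euclidean_space l2)"
proof -
  obtain f where f: "L2 f" "x = cls f" by (rule l2_cases)
  have "mul (trunc n) x \<in> {x. P x}" for n
    using f assms(1)[OF L2_trunc[OF f(1)] integrable_trunc[OF f(1)]] by (simp add: mul_cls)
  from closed_sequentially[OF assms(2) this mul_trunc_tendsto] show ?thesis by simp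
qed

lemma fourier_reflect:
  fixes f :: "'a::euclidean_space \<Rightarrow> complex"
  assumes [measurable]: "f \<in> borel_measurable borel"
  shows "fourier (\<lambda>t. f (- t)) = (\<lambda>\<xi>. fourier f (- \<xi>))"
  unfolding fourier_def
  by (subst lborel_integral_affine[of "-1" _ 0]) simp_all

lemma fourier_cnj: "fourier (\<lambda>t. cnj (f t)) \<xi> = cnj (fourier f (- \<xi>))"
proof -
  have "cnj (fourier f (- \<xi>)) = (\<integral>x. cnj (exp (- \<i> * complex_of_real (x \<bullet> - \<xi>)) * f x) \<partial>lborel)"
    unfolding fourier_def by (rule Bochner_Integration.integral_cnj[symmetric])
  then show ?thesis by (simp add: fourier_def exp_cnj)
qed

lemma FF_refl: "FF (refl x) = refl (FF x)"
proof (rule L2_limit_truncated[where P="\<lambda>x. FF (refl x) = refl (FF x)"])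
  fix f :: "'a \<Rightarrow> complex" assume f: "L2 f" "integrable lborel f"
  have i: "integrable lborel (\<lambda>t. f (- t))" using lborel_integrable_affine[OF _ f(2), of "-1" 0] by simp
  have [measurable]: "f \<in> borel_measurable borel" using L2_measurable[OF f(1)] by simp
  show "FF (refl (cls f)) = refl (FF (cls f))"
    using f i by (simp add: refl_cls FF_cls L2_reflect L2_fourier fourier_reflect)
next
  show "closed {x::'a l2. FF (refl x) = refl (FF x)}"
    by (intro closed_Collect_eq linear_continuous_on bounded_linear_compose[OF bounded_linear_FF bounded_linear_refl, unfolded o_def]
      bounded_linear_compose[OF bounded_linear_refl bounded_linear_FF, unfolded o_def])
qed

lemma FF_cj: "FF (cj x) = cj (refl (FF x))"
proof (rule L2_limit_truncated[where P="\<lambda>x. FF (cj x) = cj (refl (FF x))"])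
  fix f :: "'a \<Rightarrow> complex" assume f: "L2 f" "integrable lborel f"
  show "FF (cj (cls f)) = cj (refl (FF (cls f)))"
    using f by (simp add: cj_cls refl_cls FF_cls L2_reflect L2_fourier L2_cnj fourier_cnj[abs_def])
next
  show "closed {x::'a l2. FF (cj x) = cj (refl (FF x))}"
    by (intro closed_Collect_eq linear_continuous_on bounded_linear_compose[OF bounded_linear_FF bounded_linear_cj, unfolded o_def]
      bounded_linear_compose[OF bounded_linear_cj bounded_linear_compose[OF bounded_linear_refl bounded_linear_FF], unfolded o_def])
qed

text \<open>The complex sesquilinear and bilinear pairings, expressed through the real inner product
  so that continuity and isometry properties carry over.\<close>

definition cip :: "'a::euclidean_space l2 \<Rightarrow> 'a l2 \<Rightarrow> complex" where
  "cip x y = Complex (inner x y) (inner x (mul (\<lambda>_. \<i>) y))"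

definition bp :: "'a::euclidean_space l2 \<Rightarrow> 'a l2 \<Rightarrow> complex" where
  "bp x y = cip x (cj y)"

lemma cip_cls:
  assumes "L2 f" "L2 g" shows "cip (cls f) (cls g) = (\<integral>t. f t * cnj (g t) \<partial>lborel)"
proof (rule complex_eqI)
  show "Re (cip (cls f) (cls g)) = Re (\<integral>t. f t * cnj (g t) \<partial>lborel)"
    using assms by (simp add: cip_def inner_cls)
  have "(\<integral>t. f t * cnj (\<i> * g t) \<partial>lborel) = (\<integral>t. - \<i> * (f t * cnj (g t)) \<partial>lborel)"
    by (rule Bochner_Integration.integral_cong) (auto simp: mult_ac)
  also have "\<dots> = - \<i> * (\<integral>t. f t * cnj (g t) \<partial>lborel)" by (rule integral_mult_right_zero)
  finally show "Im (cip (cls f) (cls g)) = Im (\<integral>t. f t * cnj (g t) \<partial>lborel)"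
    using assms by (simp add: cip_def inner_cls mul_cls L2_cmult)
qed

lemma bp_cls:
  assumes "L2 f" "L2 g" shows "bp (cls f) (cls g) = (\<integral>t. f t * g t \<partial>lborel)"
  using assms cip_cls[of f "\<lambda>t. cnj (g t)"] by (simp add: bp_def cj_cls L2_cnj)

lemma cip_tendsto:
  assumes "(f \<longlongrightarrow> x) F" "(g \<longlongrightarrow> y) F"
  shows "((\<lambda>n. cip (f n) (g n)) \<longlongrightarrow> cip x y) F"
  unfolding cip_def using assms
  by (intro tendsto_Complex tendsto_inner bounded_linear.tendsto[OF bounded_linear_mul])

lemma bp_tendsto:
  assumes "(f \<longlongrightarrow> x) F" "(g \<longlongrightarrow> y) F"
  shows "((\<lambda>n. bp (f n) (g n)) \<longlongrightarrow> bp x y) F"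
  unfolding bp_def using assms by (intro cip_tendsto bounded_linear.tendsto[OF bounded_linear_cj])

lemma cip_FF: "cip (FF x) (FF y) = complex_of_real (FT_const TYPE('a)) * cip x (y :: 'a::euclidean_space l2)"
  by (rule complex_eqI) (simp_all add: cip_def inner_FF FF_cmult[symmetric])

text \<open>Both sides are continuous in \<open>x\<close> and \<open>y\<close>; on cutoffs this is
  the multiplication formula for integrable functions.\<close>

lemma bp_FF: "bp (FF x) y = bp x (FF y)"
proof -
  obtain f where f: "L2 f" "x = cls f" by (rule l2_cases)
  obtain g where g: "L2 g" "y = cls g" by (rule l2_cases)
  let ?x = "\<lambda>n. mul (trunc n) x" and ?y = "\<lambda>n. mul (trunc n) y"
  have "bp (FF (?x n)) (?y n) = bp (?x n) (FF (?y n))" for n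
    using f g fourier_mult_formula[OF integrable_trunc[OF f(1), of n] integrable_trunc[OF g(1), of n]]
    by (simp add: mul_cls FF_cls L2_trunc integrable_trunc bp_cls L2_fourier)
  moreover have "(\<lambda>n. bp (FF (?x n)) (?y n)) \<longlonglongrightarrow> bp (FF x) y"
    by (intro bp_tendsto bounded_linear.tendsto[OF bounded_linear_FF] mul_trunc_tendsto)
  moreover have "(\<lambda>n. bp (?x n) (FF (?y n))) \<longlonglongrightarrow> bp x (FF y)"
    by (intro bp_tendsto bounded_linear.tendsto[OF bounded_linear_FF] mul_trunc_tendsto)
  ultimately show ?thesis by (simp add: LIMSEQ_unique)
qed

lemma bp_refl: "bp (refl x) (refl y) = bp x y"
proof -
  obtain f where f: "L2 f" "x = cls f" by (rule l2_cases)
  obtain g where g: "L2 g" "y = cls g" by (rule l2_cases)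
  have [measurable]: "f \<in> borel_measurable borel" "g \<in> borel_measurable borel"
    using L2_measurable[OF f(1)] L2_measurable[OF g(1)] by simp_all
  show ?thesis
    using f g lborel_integral_affine[of "-1" "\<lambda>t. f t * g t" 0]
    by (simp add: refl_cls bp_cls L2_reflect)
qed

lemma parseval_bp: "bp (FF x) (refl (FF y)) = complex_of_real (FT_const TYPE('a)) * bp x (y :: 'a::euclidean_space l2)"
  using cip_FF[of x "cj y"] by (simp add: bp_def FF_cj)

lemma bp_eqI:
  assumes "\<And>z. bp x z = bp y z" shows "x = y"
proof -
  have "inner x (cj z) = inner y (cj z)" for z
    using assms[of z] by (simp add: bp_def cip_def)
  from this[of "cj (x - y)"] have "inner (x - y) (x - y) = 0" by (simp add: inner_diff_left)
  then show ?thesis by simp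
qed

text \<open>Fourier inversion without pointwise formulas: moving one transform across the bilinear
  pairing and applying Parseval tests both sides against an arbitrary \<open>z\<close>.\<close>

lemma FF_FF: "FF (FF x) = FT_const TYPE('a) *\<^sub>R refl (x :: 'a::euclidean_space l2)"
proof (rule bp_eqI)
  fix z :: "'a l2"
  have "bp (FF (FF x)) z = bp (FF x) (FF z)" by (rule bp_FF)
  also have "\<dots> = bp (FF x) (refl (FF (refl z)))" by (simp add: FF_refl)
  also have "\<dots> = complex_of_real (FT_const TYPE('a)) * bp x (refl z)" by (rule parseval_bp)
  also have "bp x (refl z) = bp (refl x) z" using bp_refl[of x "refl z"] by simp
  also have "complex_of_real (FT_const TYPE('a)) * bp (refl x) z = bp (FT_const TYPE('a) *\<^sub>R refl x) z"
    by (rule complex_eqI) (simp_all add: bp_def cip_def)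
  finally show "bp (FF (FF x)) z = bp (FT_const TYPE('a) *\<^sub>R refl x) z" .
qed

definition FI :: "'a::euclidean_space l2 \<Rightarrow> 'a l2" where
  "FI y = inverse (FT_const TYPE('a)) *\<^sub>R refl (FF y)"

lemma FF_FI [simp]: "FF (FI y) = y"
proof -
  have "FT_const TYPE('a) \<noteq> 0" using FT_const_pos[of "TYPE('a)"] by linarith
  then show ?thesis
    by (simp add: FI_def FF_scaleR FF_refl FF_FF linear_scale[OF bounded_linear.linear[OF bounded_linear_refl]])
qed

lemma FF_eq_iff: "FF x = FF y \<longleftrightarrow> x = (y :: 'a::euclidean_space l2)"
proof
  assume "FF x = FF y"
  then have "norm (FF (x - y)) = 0" by (simp add: FF_diff)
  then show "x = y" using FT_const_pos[of "TYPE('a)"] by (simp add: norm_FF)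
qed simp

lemma FI_FF [simp]: "FI (FF x) = x"
  by (subst FF_eq_iff[symmetric]) (rule FF_FI)

lemma bounded_linear_FI: "bounded_linear FI"
  unfolding FI_def[abs_def]
  by (intro bounded_linear_scaleR_right[THEN bounded_linear_compose, unfolded o_def]
    bounded_linear_compose[OF bounded_linear_refl bounded_linear_FF, unfolded o_def])

lemma inner_FI: "inner (FI x) (FI y) = inverse (FT_const TYPE('a)) * inner x (y :: 'a::euclidean_space l2)"
  using inner_FF[of "FI x" "FI y"] FT_const_pos[of "TYPE('a)"] by (simp add: field_simps)

section \<open>Decay of Fourier transforms of test functions\<close>

lemma Ck_continuous: "Ck k f \<Longrightarrow> continuous_on UNIV f"
proof (cases k)
  case (Suc n)
  assume "Ck k f"
  then obtain f' where "\<forall>x. (f has_derivative f' x) (at x)" by (auto simp: Suc)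
  then show ?thesis by (intro continuous_at_imp_continuous_on ballI) (blast intro: has_derivative_continuous)
qed simp

lemma Ck_affine:
  fixes f :: "'a::euclidean_space \<Rightarrow> 'b::real_normed_vector"
  shows "Ck k f \<Longrightarrow> Ck k (\<lambda>y. f (a + c *\<^sub>R y))"
proof (induction k arbitrary: f)
  case 0
  then show ?case by (auto intro!: continuous_on_compose2[of UNIV f] continuous_intros)
next
  case (Suc k)
  then obtain f' where f': "\<And>x. (f has_derivative f' x) (at x)" "\<And>v. Ck k (\<lambda>x. f' x v)" by auto
  have "((\<lambda>y. f (a + c *\<^sub>R y)) has_derivative (\<lambda>v. f' (a + c *\<^sub>R x) (c *\<^sub>R v))) (at x)" for x
  proof -
    have "((\<lambda>y. a + c *\<^sub>R y) has_derivative (\<lambda>v. c *\<^sub>R v)) (at x)"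
      by (auto intro!: derivative_eq_intros)
    from diff_chain_at[OF this f'(1)] show ?thesis by (simp add: o_def)
  qed
  moreover have "Ck k (\<lambda>y. f' (a + c *\<^sub>R y) (c *\<^sub>R v))" for v
    using Suc.IH[OF f'(2)[of "c *\<^sub>R v"]] .
  ultimately show ?case
    unfolding Ck.simps by (intro exI[of _ "\<lambda>x v. f' (a + c *\<^sub>R x) (c *\<^sub>R v)"]) auto
qed

lemma Ck_linear:
  fixes f :: "'a::euclidean_space \<Rightarrow> 'b::real_normed_vector"
  assumes L: "bounded_linear L"
  shows "Ck k f \<Longrightarrow> Ck k (\<lambda>y. L (f y))"
proof (induction k arbitrary: f)
  case 0
  then show ?case by (auto intro!: bounded_linear.continuous_on[OF L])
next
  case (Suc k)
  then obtain f' where f': "\<And>x. (f has_derivative f' x) (at x)" "\<And>v. Ck k (\<lambda>x. f' x v)" by auto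
  have "((\<lambda>y. L (f y)) has_derivative (\<lambda>v. L (f' x v))) (at x)" for x
    by (rule bounded_linear.has_derivative[OF L f'(1)])
  then show ?case
    using Suc.IH[OF f'(2)] unfolding Ck.simps by (intro exI[of _ "\<lambda>x v. L (f' x v)"]) auto
qed

lemma test_fun_bounds:
  fixes f :: "'a::euclidean_space \<Rightarrow> 'b::real_normed_vector"
  assumes "test_fun f"
  obtains B R where "continuous_on UNIV f" "\<And>x. norm (f x) \<le> B" "\<And>x. norm x > R \<Longrightarrow> f x = 0" "R \<ge> 0"
proof -
  have c: "continuous_on UNIV f" using assms Ck_continuous by (auto simp: test_fun_def)
  have "bounded {x. f x \<noteq> 0}" using assms by (simp add: test_fun_def)
  then obtain R where "\<forall>x\<in>{x. f x \<noteq> 0}. norm x \<le> R" by (auto simp: bounded_iff)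
  then have R: "norm x > max R 0 \<Longrightarrow> f x = 0" for x by force
  have "bounded (f ` cball 0 (max R 0))"
    by (intro compact_imp_bounded compact_continuous_image continuous_on_subset[OF c]) auto
  then obtain B where B: "\<forall>x\<in>cball 0 (max R 0). norm (f x) \<le> B" by (auto simp: bounded_iff)
  have "norm (f x) \<le> max B 0" for x
    using B R[of x] by (cases "norm x > max R 0") (auto simp: not_less le_max_iff_disj)
  then show ?thesis by (rule that[where R="max R 0", OF c _ R]) auto
qed

lemma test_fun_L2:
  assumes "test_fun (f :: 'a::euclidean_space \<Rightarrow> complex)"
  shows "L2 f" "integrable lborel f"
proof -
  obtain B R where b: "continuous_on UNIV f" "\<And>x. norm (f x) \<le> B" "\<And>x. norm x > R \<Longrightarrow> f x = 0"
    using test_fun_bounds[OF assms] by metis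
  show "L2 f" "integrable lborel f"
    by (rule L2_bounded_support[OF borel_measurable_continuous_onI[OF b(1)] b(2,3)]; simp)+
qed

lemma test_fun_derivative:
  fixes f :: "'a::euclidean_space \<Rightarrow> complex" and v :: 'a
  assumes f: "test_fun f"
  obtains f' where "test_fun f'" "\<And>x. ((\<lambda>s. f (x + s *\<^sub>R v)) has_vector_derivative f' x) (at 0)"
proof -
  define f' where "f' x = frechet_derivative f (at x) v" for x
  have Ck: "Ck k f" for k using f by (simp add: test_fun_def)
  have d: "(f has_derivative frechet_derivative f (at x)) (at x)" for x
    using Ck[of 1] by (auto simp: differentiable_def frechet_derivative_works[symmetric])
  \<comment> \<open>\<open>Ck (Suc k)\<close> supplies some derivative for each k separately.
    Uniqueness of derivatives identifies them all with \<open>f'\<close>, so every order concerns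
    the same function.\<close>
  have "Ck k f'" for k
  proof -
    obtain g where g: "\<And>x. (f has_derivative g x) (at x)" "\<And>v. Ck k (\<lambda>x. g x v)"
      using Ck[of "Suc k"] by auto
    have "f' = (\<lambda>x. g x v)" by (auto simp: f'_def frechet_derivative_at[OF g(1)])
    then show ?thesis using g(2)[of v] by simp
  qed
  moreover have "f' x = 0" if x: "x \<notin> closure {x. f x \<noteq> 0}" for x
  proof -
    have "(f has_derivative (\<lambda>_. 0)) (at x)"
    proof (rule has_derivative_transform_within_open[of "\<lambda>_. 0" _ x UNIV "- closure {x. f x \<noteq> 0}"])
      fix y assume "y \<in> - closure {x. f x \<noteq> 0}"
      then have "y \<notin> {x. f x \<noteq> 0}" using closure_subset[of "{x. f x \<noteq> 0}"] by blast
      then show "0 = f y" by simp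
    qed (use x in auto)
    from frechet_derivative_at[OF this, symmetric] show ?thesis by (simp add: f'_def)
  qed
  then have "{x. f' x \<noteq> 0} \<subseteq> closure {x. f x \<noteq> 0}" by auto
  then have "compact (closure {x. f' x \<noteq> 0})"
    using f by (auto simp: test_fun_def intro: bounded_subset compact_imp_bounded)
  ultimately have "test_fun f'" by (simp add: test_fun_def)
  moreover have "((\<lambda>s. f (x + s *\<^sub>R v)) has_vector_derivative f' x) (at 0)" for x
  proof -
    have "((\<lambda>s. x + s *\<^sub>R v) has_derivative (\<lambda>s. s *\<^sub>R v)) (at 0)"
      by (auto intro!: derivative_eq_intros)
    from diff_chain_at[OF this, of f "frechet_derivative f (at x)"] d[of x]
    have *: "((\<lambda>s. f (x + s *\<^sub>R v)) has_derivative (\<lambda>s. frechet_derivative f (at x) (s *\<^sub>R v))) (at 0)"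
      by (simp add: o_def)
    have "frechet_derivative f (at x) (s *\<^sub>R v) = s *\<^sub>R f' x" for s
      unfolding f'_def by (rule linear_scale[OF has_derivative_linear[OF d]])
    with * show ?thesis by (simp add: has_vector_derivative_def)
  qed
  ultimately show ?thesis by (rule that)
qed

text \<open>Difference quotients replace integration by parts: a shift by h v becomes the phase
  exp(i h (v . xi)), so the transform of the quotient is known exactly, and its limit is computed on
  both sides.\<close>

lemma fourier_derivative:
  fixes f :: "'a::euclidean_space \<Rightarrow> complex" and v :: 'a
  assumes f: "test_fun f" and f': "test_fun f'"
    and d: "\<And>x. ((\<lambda>s. f (x + s *\<^sub>R v)) has_vector_derivative f' x) (at 0)"
  shows "fourier f' \<xi> = \<i> * complex_of_real (v \<bullet> \<xi>) * fourier f \<xi>"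
proof -
  obtain B R where b: "continuous_on UNIV f" "\<And>x. norm (f x) \<le> B" "\<And>x. norm x > R \<Longrightarrow> f x = 0" "R \<ge> 0"
    using test_fun_bounds[OF f] by metis
  obtain B' R' where b': "continuous_on UNIV f'" "\<And>x. norm (f' x) \<le> B'" "\<And>x. norm x > R' \<Longrightarrow> f' x = 0"
    using test_fun_bounds[OF f'] by metis
  have [measurable]: "f \<in> borel_measurable borel" "f' \<in> borel_measurable borel"
    by (rule borel_measurable_continuous_onI, fact)+
  define h where "h n = 1 / real (Suc n)" for n
  have h: "h n > 0" "h n \<le> 1" for n by (simp_all add: h_def)
  have h0: "h \<longlonglongrightarrow> 0" unfolding h_def by (rule LIMSEQ_Suc[OF lim_1_over_n])
  have ds: "((\<lambda>s. f (x + s *\<^sub>R v)) has_vector_derivative f' (x + s *\<^sub>R v)) (at s)" for x s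
  proof -
    have "((\<lambda>r. f ((x + s *\<^sub>R v) + r *\<^sub>R v)) \<circ> (\<lambda>r. r - s) has_vector_derivative (1 *\<^sub>R f' (x + s *\<^sub>R v))) (at s)"
      by (rule vector_diff_chain_at) (auto intro!: derivative_eq_intros d)
    then show ?thesis by (simp add: o_def algebra_simps)
  qed
  define q where "q n x = (f (x + h n *\<^sub>R v) - f x) /\<^sub>R h n" for n x
  \<comment> \<open>The mean value inequality along the segment bounds the quotients by the bound of
    the derivative; with the common support from \<open>qs\<close> they are dominated by one
    multiple of an indicator.\<close>
  have qb: "cmod (q n x) \<le> B'" for n x
  proof -
    have "norm (f (x + h n *\<^sub>R v) - f (x + 0 *\<^sub>R v)) \<le> B' * norm (h n - 0)"
    proof (rule differentiable_bound[where S=UNIV and f'="\<lambda>s r. r *\<^sub>R f' (x + s *\<^sub>R v)"])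
      show "((\<lambda>s. f (x + s *\<^sub>R v)) has_derivative (\<lambda>r. r *\<^sub>R f' (x + s *\<^sub>R v))) (at s within UNIV)" for s
        using ds by (simp add: has_vector_derivative_def)
      show "onorm (\<lambda>r. r *\<^sub>R f' (x + s *\<^sub>R v)) \<le> B'" for s
      proof (rule onorm_bound)
        show "0 \<le> B'" by (rule order_trans[OF norm_ge_zero b'(2)])
        show "norm (r *\<^sub>R f' (x + s *\<^sub>R v)) \<le> B' * norm r" for r
          using mult_left_mono[OF b'(2)[of "x + s *\<^sub>R v"], of "\<bar>r\<bar>"] by (simp add: mult.commute)
      qed
    qed auto
    then have "norm (f (x + h n *\<^sub>R v) - f x) / h n \<le> B'"
      using h[of n] by (simp add: pos_divide_le_eq)
    then show ?thesis using h[of n] by (simp add: q_def divide_inverse mult.commute)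
  qed
  have qs: "q n x = 0" if "norm x > R + norm v" for n x
  proof -
    have "norm (h n *\<^sub>R v) \<le> norm v" using h[of n] mult_right_mono[of "h n" 1 "norm v"] by simp
    moreover have "norm x \<le> norm (x + h n *\<^sub>R v) + norm (h n *\<^sub>R v)"
      using norm_triangle_ineq4[of "x + h n *\<^sub>R v" "h n *\<^sub>R v"] by simp
    ultimately have "norm (x + h n *\<^sub>R v) > R" using that by linarith
    moreover have "norm x > R" using that norm_ge_zero[of v] by linarith
    ultimately show ?thesis by (simp add: q_def b(3))
  qed
  have B'0: "B' \<ge> 0" using order_trans[OF norm_ge_zero b'(2)] .
  have 1: "(\<lambda>n. fourier (q n) \<xi>) \<longlonglongrightarrow> fourier f' \<xi>"
    unfolding fourier_def
  proof (rule integral_dominated_convergence)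
    show "integrable lborel (\<lambda>x::'a. cmod (complex_of_real (B' * indicator (cball 0 (R + norm v)) x)))"
      by (intro integrable_norm L2_bounded_support(2)[of _ B' "R + norm v"]) (use B'0 in \<open>auto simp: indicator_def\<close>)
    show "AE x in lborel. (\<lambda>n. exp (- \<i> * complex_of_real (x \<bullet> \<xi>)) * q n x) \<longlonglongrightarrow> exp (- \<i> * complex_of_real (x \<bullet> \<xi>)) * f' x"
    proof (intro AE_I2 tendsto_mult tendsto_const)
      fix x
      have "((\<lambda>r. norm (f (x + (0 + r) *\<^sub>R v) - f (x + 0 *\<^sub>R v) - r *\<^sub>R f' x) / norm r) \<longlongrightarrow> 0) (at 0)"
        using d[of x] unfolding has_vector_derivative_def has_derivative_at by blast
      moreover have "filterlim h (at 0) sequentially"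
        unfolding filterlim_at using h0 h(1) by (auto simp: less_imp_neq[symmetric])
      ultimately have "(\<lambda>n. norm (f (x + (0 + h n) *\<^sub>R v) - f (x + 0 *\<^sub>R v) - h n *\<^sub>R f' x) / norm (h n)) \<longlonglongrightarrow> 0"
        by (rule filterlim_compose)
      moreover have "norm (f (x + (0 + h n) *\<^sub>R v) - f (x + 0 *\<^sub>R v) - h n *\<^sub>R f' x) / norm (h n) = norm (q n x - f' x)" for n
      proof -
        have "f (x + (0 + h n) *\<^sub>R v) - f (x + 0 *\<^sub>R v) - h n *\<^sub>R f' x = h n *\<^sub>R (q n x - f' x)"
          using h(1)[of n] by (simp add: q_def algebra_simps)
        then show ?thesis using h(1)[of n] by simp
      qed
      ultimately show "(\<lambda>n. q n x) \<longlonglongrightarrow> f' x"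
        by (simp add: tendsto_norm_zero_iff LIM_zero_iff)
    qed
    show "AE x in lborel. norm (exp (- \<i> * complex_of_real (x \<bullet> \<xi>)) * q n x) \<le> cmod (complex_of_real (B' * indicator (cball 0 (R + norm v)) x))" for n
    proof (rule AE_I2)
      fix x show "norm (exp (- \<i> * complex_of_real (x \<bullet> \<xi>)) * q n x) \<le> cmod (complex_of_real (B' * indicator (cball 0 (R + norm v)) x))"
        unfolding norm_mult norm_exp_i
        using qb[of n x] qs[of x n] B'0 by (cases "norm x > R + norm v") (auto simp: indicator_def)
    qed
  qed (auto simp: q_def[abs_def])
  have fi: "integrable lborel f" by (rule test_fun_L2[OF f])
  have q: "fourier (q n) \<xi> = ((exp (\<i> * complex_of_real (v \<bullet> \<xi>) * h n) - 1) / h n) * fourier f \<xi>" for n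
  proof -
    have si: "integrable lborel (\<lambda>x. f (x + h n *\<^sub>R v))"
      using lborel_integrable_affine[OF _ fi, of 1 "h n *\<^sub>R v"] by (simp add: add.commute)
    have "fourier f \<xi> = (\<integral>x. exp (- \<i> * complex_of_real ((h n *\<^sub>R v + x) \<bullet> \<xi>)) * f (h n *\<^sub>R v + x) \<partial>lborel)"
      unfolding fourier_def by (subst lborel_integral_affine[of 1 _ "h n *\<^sub>R v"]) simp_all
    also have "\<dots> = (\<integral>x. exp (- \<i> * complex_of_real (v \<bullet> \<xi>) * h n) * (exp (- \<i> * complex_of_real (x \<bullet> \<xi>)) * f (x + h n *\<^sub>R v)) \<partial>lborel)"
    proof (rule Bochner_Integration.integral_cong[OF refl])
      fix x
      have "exp (- \<i> * complex_of_real ((h n *\<^sub>R v + x) \<bullet> \<xi>))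
          = exp (- \<i> * complex_of_real (v \<bullet> \<xi>) * h n) * exp (- \<i> * complex_of_real (x \<bullet> \<xi>))"
        by (simp only: exp_add[symmetric]) (simp add: inner_add_left algebra_simps)
      then show "exp (- \<i> * complex_of_real ((h n *\<^sub>R v + x) \<bullet> \<xi>)) * f (h n *\<^sub>R v + x)
          = exp (- \<i> * complex_of_real (v \<bullet> \<xi>) * h n) * (exp (- \<i> * complex_of_real (x \<bullet> \<xi>)) * f (x + h n *\<^sub>R v))"
        by (simp only: mult.assoc add.commute[of x])
    qed
    also have "\<dots> = exp (- \<i> * complex_of_real (v \<bullet> \<xi>) * h n) * fourier (\<lambda>x. f (x + h n *\<^sub>R v)) \<xi>"
      unfolding fourier_def by (rule integral_mult_right_zero)
    finally have "fourier (\<lambda>x. f (x + h n *\<^sub>R v)) \<xi> = exp (\<i> * complex_of_real (v \<bullet> \<xi>) * h n) * fourier f \<xi>"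
      by (simp add: exp_minus field_simps)
    moreover have "q n = (\<lambda>x. complex_of_real (1 / h n) * (f (x + h n *\<^sub>R v) - f x))"
      by (auto simp: q_def scaleR_conv_of_real divide_inverse)
    ultimately show ?thesis
      by (simp only: fourier_cmult fourier_diff[OF si fi]) (simp add: algebra_simps divide_inverse)
  qed
  have "(\<lambda>n. fourier (q n) \<xi>) \<longlonglongrightarrow> \<i> * complex_of_real (v \<bullet> \<xi>) * fourier f \<xi>"
    unfolding q
  proof (intro tendsto_mult tendsto_const)
    define a where "a = \<i> * complex_of_real (v \<bullet> \<xi>)"
    have "((\<lambda>z. exp (a * z)) has_field_derivative a * exp (a * 0)) (at 0)"
      by (auto intro!: derivative_eq_intros)
    then have "((\<lambda>z. (exp (a * z) - 1) / z) \<longlongrightarrow> a) (at 0)"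
      by (simp add: has_field_derivative_iff)
    moreover have "filterlim (\<lambda>n. complex_of_real (h n)) (at 0) sequentially"
      unfolding filterlim_at
    proof
      show "\<forall>\<^sub>F n in sequentially. complex_of_real (h n) \<in> UNIV \<and> complex_of_real (h n) \<noteq> 0"
        using h(1) by (auto simp: less_imp_neq[symmetric])
      show "(\<lambda>n. complex_of_real (h n)) \<longlonglongrightarrow> 0" using tendsto_of_real[OF h0, where 'a=complex] by simp
    qed
    ultimately show "(\<lambda>n. (exp (\<i> * complex_of_real (v \<bullet> \<xi>) * complex_of_real (h n)) - 1) / complex_of_real (h n)) \<longlonglongrightarrow> \<i> * complex_of_real (v \<bullet> \<xi>)"
      unfolding a_def by (rule filterlim_compose)
  qed
  from LIMSEQ_unique[OF 1 this] show ?thesis .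
qed

lemma fourier_decay_component:
  fixes f :: "'a::euclidean_space \<Rightarrow> complex"
  assumes "test_fun f"
  shows "\<exists>C. \<forall>\<xi>. \<bar>b \<bullet> \<xi>\<bar> ^ k * cmod (fourier f \<xi>) \<le> C"
  using assms
proof (induction k arbitrary: f)
  case 0
  then show ?case using fourier_bounded[of f] by auto
next
  case (Suc k)
  obtain f' where f': "test_fun f'" "\<And>x. ((\<lambda>s. f (x + s *\<^sub>R b)) has_vector_derivative f' x) (at 0)"
    using test_fun_derivative[OF Suc.prems] by blast
  from Suc.IH[OF f'(1)] obtain C where C: "\<And>\<xi>. \<bar>b \<bullet> \<xi>\<bar> ^ k * cmod (fourier f' \<xi>) \<le> C" by auto
  have "\<bar>b \<bullet> \<xi>\<bar> ^ Suc k * cmod (fourier f \<xi>) \<le> C" for \<xi>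
    using C[of \<xi>] unfolding fourier_derivative[OF Suc.prems f'] by (simp add: norm_mult mult_ac)
  then show ?case by blast
qed

lemma fourier_decay:
  fixes f :: "'a::euclidean_space \<Rightarrow> complex"
  assumes f: "test_fun f"
  shows "\<exists>C. \<forall>\<xi>. (1 + (norm \<xi>)\<^sup>2) powr r * cmod (fourier f \<xi>) \<le> C"
proof -
  \<comment> \<open>An integer exponent at least \<open>r\<close>, so that the real power of the
    bracket is bounded by a polynomial, to which the decay in each coordinate applies.\<close>
  define m where "m = nat \<lceil>\<bar>r\<bar>\<rceil>"
  have "\<forall>b. \<exists>C. \<forall>\<xi>. \<bar>b \<bullet> \<xi>\<bar> ^ (2 * m) * cmod (fourier f \<xi>) \<le> C"
    using fourier_decay_component[OF f] by blast
  then obtain C where C: "\<And>b \<xi>. \<bar>b \<bullet> \<xi>\<bar> ^ (2 * m) * cmod (fourier f \<xi>) \<le> C b" by metis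
  define B where "B = (\<integral>x. cmod (f x) \<partial>lborel)"
  define d where "d = real DIM('a)"
  have "(1 + (norm \<xi>)\<^sup>2) powr r * cmod (fourier f \<xi>) \<le> 2 ^ m * (B + d ^ (2 * m) * (\<Sum>b\<in>Basis. C b))" for \<xi>
  proof -
    have "(1 + (norm \<xi>)\<^sup>2) powr r \<le> (1 + (norm \<xi>)\<^sup>2) powr real m"
    proof (rule powr_mono)
      show "r \<le> real m" using real_nat_ceiling_ge[of "\<bar>r\<bar>"] unfolding m_def by linarith
    qed simp
    also have "\<dots> = (1 + (norm \<xi>)\<^sup>2) ^ m"
      by (rule powr_realpow) (simp add: add_pos_nonneg)
    also have "\<dots> \<le> (2 * max 1 ((norm \<xi>)\<^sup>2)) ^ m"
      by (rule power_mono) auto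
    also have "\<dots> = 2 ^ m * max 1 ((norm \<xi>)\<^sup>2) ^ m" by (rule power_mult_distrib)
    also have "max 1 ((norm \<xi>)\<^sup>2) ^ m \<le> 1 + norm \<xi> ^ (2 * m)"
      by (cases "1 \<le> (norm \<xi>)\<^sup>2") (auto simp: max_def power_mult)
    finally have 1: "(1 + (norm \<xi>)\<^sup>2) powr r \<le> 2 ^ m * (1 + norm \<xi> ^ (2 * m))" by simp
    have "norm \<xi> ^ (2 * m) \<le> d ^ (2 * m) * (\<Sum>b\<in>Basis. \<bar>b \<bullet> \<xi>\<bar> ^ (2 * m))"
    proof -
      \<comment> \<open>The direction in which \<xi> has its largest coordinate: the norm is at most
        d times that single coordinate.\<close>
      obtain b where b: "b \<in> (Basis::'a set)" "\<And>c. c \<in> Basis \<Longrightarrow> \<bar>c \<bullet> \<xi>\<bar> \<le> \<bar>b \<bullet> \<xi>\<bar>"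
        using Max_in[of "(\<lambda>b. \<bar>b \<bullet> \<xi>\<bar>) ` Basis"] Max_ge[of "(\<lambda>b. \<bar>b \<bullet> \<xi>\<bar>) ` Basis"] by fastforce
      have "norm \<xi> \<le> (\<Sum>c\<in>Basis. \<bar>\<xi> \<bullet> c\<bar>)" by (rule norm_le_l1)
      also have "\<dots> \<le> (\<Sum>c\<in>(Basis::'a set). \<bar>b \<bullet> \<xi>\<bar>)"
        by (intro sum_mono) (use b in \<open>simp add: inner_commute\<close>)
      also have "\<dots> = d * \<bar>b \<bullet> \<xi>\<bar>" by (simp add: d_def)
      finally have "norm \<xi> ^ (2 * m) \<le> (d * \<bar>b \<bullet> \<xi>\<bar>) ^ (2 * m)" by (rule power_mono) simp
      also have "\<dots> = d ^ (2 * m) * \<bar>b \<bullet> \<xi>\<bar> ^ (2 * m)" by (rule power_mult_distrib)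
      also have "\<dots> \<le> d ^ (2 * m) * (\<Sum>b\<in>Basis. \<bar>b \<bullet> \<xi>\<bar> ^ (2 * m))"
        by (intro mult_left_mono member_le_sum[of b]) (use b in \<open>auto simp: d_def\<close>)
      finally show ?thesis .
    qed
    then have "norm \<xi> ^ (2 * m) * cmod (fourier f \<xi>) \<le> d ^ (2 * m) * (\<Sum>b\<in>Basis. \<bar>b \<bullet> \<xi>\<bar> ^ (2 * m)) * cmod (fourier f \<xi>)"
      by (rule mult_right_mono) simp
    also have "\<dots> = d ^ (2 * m) * (\<Sum>b\<in>Basis. \<bar>b \<bullet> \<xi>\<bar> ^ (2 * m) * cmod (fourier f \<xi>))"
      by (simp add: sum_distrib_right mult.assoc)
    also have "\<dots> \<le> d ^ (2 * m) * (\<Sum>b\<in>Basis. C b)"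
      by (intro mult_left_mono sum_mono C) (simp add: d_def)
    finally have 2: "norm \<xi> ^ (2 * m) * cmod (fourier f \<xi>) \<le> d ^ (2 * m) * (\<Sum>b\<in>Basis. C b)" .
    have "(1 + (norm \<xi>)\<^sup>2) powr r * cmod (fourier f \<xi>) \<le> 2 ^ m * (1 + norm \<xi> ^ (2 * m)) * cmod (fourier f \<xi>)"
      by (rule mult_right_mono[OF 1]) simp
    also have "\<dots> = 2 ^ m * (cmod (fourier f \<xi>) + norm \<xi> ^ (2 * m) * cmod (fourier f \<xi>))"
      by (simp add: algebra_simps)
    also have "\<dots> \<le> 2 ^ m * (B + d ^ (2 * m) * (\<Sum>b\<in>Basis. C b))"
      by (intro mult_left_mono add_mono 2) (auto simp: B_def fourier_bounded)
    finally show ?thesis .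
  qed
  then show ?thesis by blast
qed

section \<open>Integrability of the bracket weights\<close>

text \<open>Inside [-1, 1] compare with 1, outside with |t|^(-2r). The antiderivative of the latter
  vanishes at infinity because p = 2r - 1 is positive.\<close>

lemma integrable_bracket_1d:
  assumes "r > 1 / 2" shows "integrable lborel (\<lambda>t::real. (1 + t\<^sup>2) powr (- r))"
proof -
  define p where "p = 2 * r - 1"
  have p: "p > 0" using assms by (simp add: p_def)
  have "(\<integral>\<^sup>+t. ennreal (t powr (- 2 * r)) * indicator {1..} t \<partial>lborel) = ennreal (0 - (- (1 powr (- p) / p)))"
  proof (rule nn_integral_FTC_atLeast)
    show "(\<lambda>t. t powr (- 2 * r)) \<in> borel_measurable borel" by measurable
    show "((\<lambda>t. - (t powr (- p) / p)) has_real_derivative t powr (- 2 * r)) (at t)" if "1 \<le> t" for t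
    proof -
      have "((\<lambda>t. - (t powr (- p) / p)) has_real_derivative - ((- p) * t powr (- p - 1) / p)) (at t)"
        using that p by (auto intro!: derivative_eq_intros)
      moreover have "- ((- p) * t powr (- p - 1) / p) = t powr (- p - 1)" using p by simp
      moreover have "- p - 1 = - 2 * r" by (simp add: p_def)
      ultimately show ?thesis by simp
    qed
    have "((\<lambda>t. t powr (- p)) \<longlongrightarrow> 0) at_top"
      by (rule tendsto_neg_powr) (use p in \<open>auto intro: filterlim_ident\<close>)
    then have "((\<lambda>t. - (t powr (- p) / p)) \<longlongrightarrow> - (0 / p)) at_top"
      by (intro tendsto_minus tendsto_divide tendsto_const) (use p in auto)
    then show "((\<lambda>t. - (t powr (- p) / p)) \<longlongrightarrow> 0) at_top" by simp
  qed auto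
  moreover have "(\<integral>\<^sup>+t. ennreal (t powr (- 2 * r)) * indicator {1..} t \<partial>lborel)
      = (\<integral>\<^sup>+t. ennreal (t powr (- 2 * r) * indicator {1..} t) \<partial>lborel)"
    by (rule nn_integral_cong) (simp add: indicator_def)
  ultimately have "(\<integral>\<^sup>+t. ennreal (t powr (- 2 * r) * indicator {1..} t) \<partial>lborel) = ennreal (0 - (- (1 powr (- p) / p)))"
    by metis
  then have i: "integrable lborel (\<lambda>t. t powr (- 2 * r) * indicator {1..} t)"
    by (intro integrableI_nonneg) (simp_all only: ennreal_less_top infinity_ennreal_def, auto)
  have i': "integrable lborel (\<lambda>t. (- t) powr (- 2 * r) * indicator {1..} (- t))"
    using lborel_integrable_affine[OF _ i, of "-1" 0] by simp
  have sq: "(t\<^sup>2) powr (- r) = t powr (- 2 * r)" if "t > 1" for t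
  proof -
    have "t powr (- 2 * r) = (t powr 2) powr (- r)" by (simp only: powr_powr) simp
    then show ?thesis using that by simp
  qed
  have i0: "integrable lborel (indicator {-1..1} :: real \<Rightarrow> real)" by simp
  show ?thesis
  proof (rule Bochner_Integration.integrable_bound[OF Bochner_Integration.integrable_add[OF i0 Bochner_Integration.integrable_add[OF i i']]])
    show "AE t in lborel. norm ((1 + t\<^sup>2) powr (- r)) \<le>
      norm (indicator {-1..1} t + (t powr (- 2 * r) * indicator {1..} t + (- t) powr (- 2 * r) * indicator {1..} (- t)))"
    proof (rule AE_I2)
      fix t :: real
      consider "\<bar>t\<bar> \<le> 1" | "t > 1" | "t < -1" by linarith
      then show "norm ((1 + t\<^sup>2) powr (- r)) \<le>
        norm (indicator {-1..1} t + (t powr (- 2 * r) * indicator {1..} t + (- t) powr (- 2 * r) * indicator {1..} (- t)))"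
      proof cases
        case 1
        have ind: "indicator {-1..1} t = (1::real)" using 1 by (simp add: indicator_def abs_le_iff)
        have "(1 + t\<^sup>2) powr (- r) \<le> 1 powr (- r)" by (rule powr_mono2') (use assms in auto)
        moreover have "0 \<le> t powr (- 2 * r) * indicator {1..} t + (- t) powr (- 2 * r) * indicator {1..} (- t)" by simp
        ultimately show ?thesis unfolding ind real_norm_def powr_one_eq_one using powr_ge_zero[of "1 + t\<^sup>2" "- r"] by linarith
      next
        case 2
        have "(1 + t\<^sup>2) powr (- r) \<le> (t\<^sup>2) powr (- r)" by (rule powr_mono2') (use assms 2 in auto)
        also have "\<dots> = t powr (- 2 * r)" using 2 by (rule sq)
        finally show ?thesis using 2 by (simp add: indicator_def)
      next
        case 3
        have "(1 + t\<^sup>2) powr (- r) \<le> ((- t)\<^sup>2) powr (- r)" by (rule powr_mono2') (use assms 3 in auto)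
        also have "\<dots> = (- t) powr (- 2 * r)" using 3 by (intro sq) simp
        finally show ?thesis using 3 by (simp add: indicator_def)
      qed
    qed
  qed measurable
qed

text \<open>The exponent is shared equally: with r = s/d > 1/2 each factor (1 + (xi . b)^2)^(-r)
  dominates (1 + |xi|^2)^(-r), so the product over the coordinates is an integrable majorant. The
  sharp threshold d/2 survives this comparison.\<close>

lemma integrable_bracket:
  assumes s: "s > real DIM('a::euclidean_space) / 2"
  shows "integrable lborel (\<lambda>\<xi>::'a. (1 + (norm \<xi>)\<^sup>2) powr (- s))"
proof (rule Bochner_Integration.integrable_bound)
  define r where "r = s / real DIM('a)"
  have r: "r > 1/2" using s by (simp add: r_def field_simps)
  have sr: "s = r * real DIM('a)" by (simp add: r_def)
  show "integrable lborel (\<lambda>\<xi>::'a. \<Prod>b\<in>Basis. (1 + (\<xi> \<bullet> b)\<^sup>2) powr (- r))"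
    by (rule integrable_lborel_prod) (rule integrable_bracket_1d[OF r])
  show "AE \<xi> in lborel. norm ((1 + (norm \<xi>)\<^sup>2) powr (- s)) \<le> norm (\<Prod>b\<in>(Basis::'a set). (1 + (\<xi> \<bullet> b)\<^sup>2) powr (- r))"
  proof (rule AE_I2)
    fix \<xi> :: 'a
    have "(1 + (norm \<xi>)\<^sup>2) powr (- s) = ((1 + (norm \<xi>)\<^sup>2) powr (- r)) powr real DIM('a)"
      by (simp add: sr powr_powr)
    also have "\<dots> = ((1 + (norm \<xi>)\<^sup>2) powr (- r)) ^ DIM('a)"
      by (rule powr_realpow) (simp add: add_pos_nonneg add_nonneg_eq_0_iff)
    also have "\<dots> = (\<Prod>b\<in>(Basis::'a set). (1 + (norm \<xi>)\<^sup>2) powr (- r))" by simp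
    also have "\<dots> \<le> (\<Prod>b\<in>Basis. (1 + (\<xi> \<bullet> b)\<^sup>2) powr (- r))"
    proof (intro prod_mono conjI)
      fix b :: 'a assume b: "b \<in> Basis"
      have "(\<xi> \<bullet> b)\<^sup>2 \<le> (norm \<xi>)\<^sup>2" using power_mono[OF Basis_le_norm[OF b, of \<xi>], of 2] by simp
      then show "(1 + (norm \<xi>)\<^sup>2) powr (- r) \<le> (1 + (\<xi> \<bullet> b)\<^sup>2) powr (- r)"
        using r by (intro powr_mono2') (auto simp: add_pos_nonneg)
    qed simp
    finally show "norm ((1 + (norm \<xi>)\<^sup>2) powr (- s)) \<le> norm (\<Prod>b\<in>(Basis::'a set). (1 + (\<xi> \<bullet> b)\<^sup>2) powr (- r))"
      by (simp add: abs_of_nonneg prod_nonneg)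
  qed
qed measurable

section \<open>Sobolev weights and mollifiers as test functions\<close>

text \<open>\<open>Z\<close> is continuous, so \<open>Y 0\<close> plus its integral is a
  norm-differentiable candidate. Every functional of the family is constant along the difference of
  \<open>Y\<close> and the integral; as the family separates points, \<open>Y\<close> is the
  candidate. The family need not be a space or be dense.\<close>

lemma weak_derivative_strong:
  fixes Y Z :: "real \<Rightarrow> 'b::banach" and D :: "('b \<Rightarrow> complex) set"
  assumes Z: "continuous_on {0..T} Z"
    and D: "\<And>L. L \<in> D \<Longrightarrow> bounded_linear L"
    and sep: "\<And>x. (\<And>L. L \<in> D \<Longrightarrow> L x = 0) \<Longrightarrow> x = 0"
    and der: "\<And>L t. L \<in> D \<Longrightarrow> t \<in> {0..T} \<Longrightarrow> ((\<lambda>t. L (Y t)) has_vector_derivative L (Z t)) (at t within {0..T})"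
    and t: "t \<in> {0..T}"
  shows "(Y has_vector_derivative Z t) (at t within {0..T})"
proof -
  define I where "I t = integral {0..t} Z" for t
  have I: "(I has_vector_derivative Z t) (at t within {0..T})" if "t \<in> {0..T}" for t
    unfolding I_def by (rule integral_has_vector_derivative[OF Z that])
  have I0: "I 0 = 0" by (simp add: I_def)
  have W: "Y r - I r - Y 0 = 0" if r: "r \<in> {0..T}" for r
  proof (rule sep)
    fix L assume L: "L \<in> D"
    interpret L: bounded_linear L by (rule D[OF L])
    have "((\<lambda>t. L (Y t) - L (I t)) has_vector_derivative 0) (at t within {0..T})" if "t \<in> {0..T}" for t
      using has_vector_derivative_diff[OF der[OF L that] L.has_vector_derivative[OF I[OF that]]] by simp
    then obtain c where c: "\<And>t. t \<in> {0..T} \<Longrightarrow> L (Y t) - L (I t) = c"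
      using has_vector_derivative_zero_constant[of "{0..T}" "\<lambda>t. L (Y t) - L (I t)"] by auto
    show "L (Y r - I r - Y 0) = 0"
      using c[OF r] c[of 0] r by (simp add: L.diff I0 L.zero)
  qed
  then have YI: "Y r = Y 0 + I r" if "r \<in> {0..T}" for r
    using W[OF that] by (simp add: diff_eq_eq)
  have "((\<lambda>r. Y 0 + I r) has_vector_derivative Z t) (at t within {0..T})"
    using has_vector_derivative_add[OF has_vector_derivative_const I[OF t], of "Y 0"] by simp
  then show ?thesis by (rule has_vector_derivative_transform[OF t, rotated]) (rule YI)
qed

lemma bounded_linear_bp: "bounded_linear (\<lambda>x. bp x y)"
proof -
  have "(\<lambda>x. bp x y) = (\<lambda>x. complex_of_real (inner x (cj y)) + \<i> * complex_of_real (inner x (mul (\<lambda>_. \<i>) (cj y))))"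
    by (rule ext) (simp add: bp_def cip_def complex_eq_iff)
  moreover have "bounded_linear \<dots>"
    by (intro bounded_linear_add bounded_linear_compose[OF bounded_linear_of_real bounded_linear_inner_left]
      bounded_linear_compose[OF bounded_linear_mult_right] )
  ultimately show ?thesis by simp
qed

text \<open>In terms of the bracket <xi> = (1 + |xi|^2)^(1/2) this is <xi>^(2r); multiplication by
  \<open>wt (s / 2)\<close> therefore turns the H^s norm into the L2 norm.\<close>

definition wt :: "real \<Rightarrow> 'a::euclidean_space \<Rightarrow> complex" where
  "wt r \<xi> = complex_of_real ((1 + (norm \<xi>)\<^sup>2) powr r)"

lemma wt_measurable [measurable]: "wt r \<in> borel_measurable borel"
  unfolding wt_def[abs_def] by measurable

lemma wt_mult: "wt a \<xi> * wt b \<xi> = wt (a + b) \<xi>"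
  by (simp add: wt_def powr_add)

lemma wt_zero [simp]: "wt 0 \<xi> = 1"
  using zero_le_power2[of "norm \<xi>"] by (simp add: wt_def add_nonneg_eq_0_iff)

lemma norm_wt: "cmod (wt r \<xi>) = (1 + (norm \<xi>)\<^sup>2) powr r"
  by (simp add: wt_def)

lemma wt_nonzero [simp]: "wt r \<xi> \<noteq> 0"
  using zero_le_power2[of "norm \<xi>"] by (simp add: wt_def add_nonneg_eq_0_iff)

lemma cnj_wt [simp]: "cnj (wt r \<xi>) = wt r \<xi>"
  by (simp add: wt_def)

lemma norm_wt_le_1: "r \<le> 0 \<Longrightarrow> cmod (wt r \<xi>) \<le> 1"
  using powr_mono[of r 0 "1 + (norm \<xi>)\<^sup>2"] by (simp add: norm_wt split: if_splits)

lemma bmeas_wt: "r \<le> 0 \<Longrightarrow> bmeas (wt r)"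
  by (rule bmeasI[OF wt_measurable norm_wt_le_1])

definition lap :: "real \<Rightarrow> 'a::euclidean_space \<Rightarrow> complex" where
  "lap s \<xi> = complex_of_real (norm \<xi> powr (2 * s))"

lemma lap_measurable [measurable]: "lap r \<in> borel_measurable borel"
  unfolding lap_def[abs_def] by measurable

lemma norm_lap_le: "s \<ge> 0 \<Longrightarrow> cmod (lap s \<xi>) \<le> (1 + (norm \<xi>)\<^sup>2) powr s"
proof -
  assume s: "s \<ge> 0"
  have "norm \<xi> powr (2 * s) = ((norm \<xi>)\<^sup>2) powr s"
    by (cases "\<xi> = 0") (simp_all add: powr_powr flip: powr_numeral)
  also have "\<dots> \<le> (1 + (norm \<xi>)\<^sup>2) powr s" by (rule powr_mono2) (use s in auto)
  finally show ?thesis by (simp add: lap_def)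
qed

lemma bmeas_lap_wt:
  assumes "s \<ge> 0" "r \<le> - s" shows "bmeas (\<lambda>\<xi>. lap s \<xi> * wt r \<xi>)"
proof (rule bmeasI[of _ 1])
  fix \<xi> :: 'a
  have "cmod (lap s \<xi> * wt r \<xi>) \<le> (1 + (norm \<xi>)\<^sup>2) powr s * (1 + (norm \<xi>)\<^sup>2) powr r"
    unfolding norm_mult norm_wt by (rule mult_right_mono[OF norm_lap_le[OF assms(1)]]) simp
  also have "\<dots> = cmod (wt (s + r) \<xi>)" by (simp add: norm_wt powr_add)
  also have "\<dots> \<le> 1" by (rule norm_wt_le_1) (use assms in simp)
  finally show "cmod (lap s \<xi> * wt r \<xi>) \<le> 1" .
qed measurable

lemma trunc_weight_bound:
  assumes "s \<ge> 0" shows "cmod (trunc n \<xi> * wt s \<xi>) \<le> (1 + (real n)\<^sup>2) powr s"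
proof (cases "norm \<xi> \<le> real n")
  case True
  then have "(1 + (norm \<xi>)\<^sup>2) powr s \<le> (1 + (real n)\<^sup>2) powr s"
    by (intro powr_mono2 add_left_mono power_mono) (use assms in auto)
  with True show ?thesis by (simp add: trunc_def norm_wt)
qed (simp add: trunc_def)

lemma bmeas_trunc_wt: "s \<ge> 0 \<Longrightarrow> bmeas (\<lambda>\<xi>. trunc n \<xi> * wt s \<xi>)"
  by (rule bmeasI[OF _ trunc_weight_bound]) measurable

lemma bmeas_trunc_lap: assumes "s \<ge> 0" shows "bmeas (\<lambda>\<xi>. trunc n \<xi> * lap s \<xi>)"
proof (rule bmeasI)
  fix \<xi> :: 'a
  have "cmod (trunc n \<xi> * lap s \<xi>) \<le> cmod (trunc n \<xi> * wt s \<xi>)"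
    unfolding norm_mult norm_wt by (rule mult_left_mono[OF norm_lap_le[OF assms]]) simp
  also have "\<dots> \<le> (1 + (real n)\<^sup>2) powr s" by (rule trunc_weight_bound[OF assms])
  finally show "cmod (trunc n \<xi> * lap s \<xi>) \<le> (1 + (real n)\<^sup>2) powr s" .
qed measurable

lemma fourier_tendsto:
  assumes f: "integrable lborel f" and x: "x \<longlonglongrightarrow> \<xi>"
  shows "(\<lambda>n. fourier f (x n)) \<longlonglongrightarrow> fourier f \<xi>"
  unfolding fourier_def
proof (rule integral_dominated_convergence)
  show "integrable lborel (\<lambda>t. cmod (f t))" using f by simp
  show "AE t in lborel. (\<lambda>n. exp (- \<i> * complex_of_real (t \<bullet> x n)) * f t) \<longlonglongrightarrow> exp (- \<i> * complex_of_real (t \<bullet> \<xi>)) * f t"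
    by (intro AE_I2 tendsto_intros x)
  show "AE t in lborel. norm (exp (- \<i> * complex_of_real (t \<bullet> x n)) * f t) \<le> cmod (f t)" for n
    by (intro AE_I2) (simp only: norm_mult norm_exp_i mult_1 order_refl)
qed (use f in auto)

section \<open>Translated and dilated mollifiers as a separating family\<close>

text \<open>The profile plays two roles: it regularises the data of the theorem, and it generates
  all test functions against which the weak equation is evaluated.\<close>

locale mollifier =
  fixes \<psi> :: "'a::euclidean_space \<Rightarrow> real"
  assumes psi_test: "test_fun \<psi>" and psi_int: "(\<integral>x. \<psi> x \<partial>lborel) = 1"
begin

lemma psi_measurable [measurable]: "\<psi> \<in> borel_measurable borel"
proof -
  obtain B R where "continuous_on UNIV \<psi>" using test_fun_bounds[OF psi_test] by metis
  then show ?thesis by (rule borel_measurable_continuous_onI)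
qed

text \<open>Reflected, so that its transform is a phase times the conjugate transform of
  \<open>pk\<close>: varying \<open>x\<close> yields all phases, varying \<delta> avoids the
  zeros.\<close>

definition tst :: "'a \<Rightarrow> real \<Rightarrow> 'a \<Rightarrow> complex" where
  "tst x \<delta> y = complex_of_real (\<psi> ((x - y) /\<^sub>R \<delta>))"

definition pk :: "real \<Rightarrow> 'a \<Rightarrow> complex" where
  "pk \<delta> z = complex_of_real (\<psi> (z /\<^sub>R \<delta>))"

lemma test_fun_affine:
  assumes "c \<noteq> 0" shows "test_fun (\<lambda>y. complex_of_real (\<psi> (a + c *\<^sub>R y)))"
  unfolding test_fun_def
proof
  show "\<forall>k. Ck k (\<lambda>y. complex_of_real (\<psi> (a + c *\<^sub>R y)))"
    using psi_test Ck_linear[OF bounded_linear_of_real Ck_affine, of _ \<psi> a c] by (auto simp: test_fun_def)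
  obtain B R where R: "\<And>x. norm x > R \<Longrightarrow> \<psi> x = 0" using test_fun_bounds[OF psi_test] by metis
  have "norm y \<le> (R + norm a) / \<bar>c\<bar>" if "\<psi> (a + c *\<^sub>R y) \<noteq> 0" for y
  proof -
    have "norm (a + c *\<^sub>R y) \<le> R" using R that by (meson not_le)
    moreover have "norm (c *\<^sub>R y) \<le> norm (a + c *\<^sub>R y) + norm a"
      using norm_triangle_ineq4[of "a + c *\<^sub>R y" a] by simp
    ultimately have "\<bar>c\<bar> * norm y \<le> R + norm a" by simp
    then show ?thesis using assms by (simp add: field_simps)
  qed
  then show "compact (closure {x. complex_of_real (\<psi> (a + c *\<^sub>R x)) \<noteq> 0})"
    by (auto simp: bounded_iff)
qed

lemma tst_test: "\<delta> > 0 \<Longrightarrow> test_fun (tst x \<delta>)"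
  using test_fun_affine[of "- inverse \<delta>" "x /\<^sub>R \<delta>"] by (simp add: tst_def[abs_def] scaleR_diff_right)

lemma pk_test: "\<delta> > 0 \<Longrightarrow> test_fun (pk \<delta>)"
  using test_fun_affine[of "inverse \<delta>" 0] by (simp add: pk_def[abs_def])

lemma fourier_tst: "\<delta> > 0 \<Longrightarrow> fourier (tst x \<delta>) \<xi> = exp (- \<i> * complex_of_real (x \<bullet> \<xi>)) * cnj (fourier (pk \<delta>) \<xi>)"
  using fourier_cnj_reflect[OF test_fun_L2(2)[OF pk_test], of \<delta> x \<xi>] by (simp add: tst_def[abs_def] pk_def)

lemma fourier_pk_reflect: "cnj (fourier (pk \<delta>) (- \<xi>)) = fourier (pk \<delta>) \<xi>"
  using fourier_cnj[of "pk \<delta>" \<xi>] by (simp add: pk_def[abs_def])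

lemma fourier_pk_scale:
  assumes "\<delta> > 0" shows "fourier (pk \<delta>) \<xi> = complex_of_real (\<delta> ^ DIM('a)) * fourier (pk 1) (\<delta> *\<^sub>R \<xi>)"
proof -
  have [measurable]: "pk \<delta> \<in> borel_measurable borel"
    using L2_measurable[OF test_fun_L2(1)[OF pk_test[OF assms]]] by simp
  show ?thesis
    unfolding fourier_def using assms
    by (subst lborel_integral_affine[of \<delta> _ 0]) (simp_all add: pk_def scaleR_conv_of_real)
qed

lemma fourier_pk_0: "fourier (pk 1) 0 = 1"
  by (simp add: fourier_def pk_def psi_int)

text \<open>The transform of the profile is continuous and equals its integral, 1, at the origin;
  small dilations bring any frequency close to the origin.\<close>

lemma fourier_pk_nonzero: "\<exists>n. fourier (pk (1 / real (Suc n))) \<xi> \<noteq> 0"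
proof -
  have "(\<lambda>n. 1 / real (Suc n)) \<longlonglongrightarrow> 0" by (rule LIMSEQ_Suc[OF lim_1_over_n])
  then have "(\<lambda>n. (1 / real (Suc n)) *\<^sub>R \<xi>) \<longlonglongrightarrow> 0 *\<^sub>R \<xi>" by (intro tendsto_intros)
  then have "(\<lambda>n. fourier (pk 1) ((1 / real (Suc n)) *\<^sub>R \<xi>)) \<longlonglongrightarrow> fourier (pk 1) 0"
    by (intro fourier_tendsto test_fun_L2 pk_test) auto
  then have "eventually (\<lambda>n. fourier (pk 1) ((1 / real (Suc n)) *\<^sub>R \<xi>) \<noteq> 0) sequentially"
    by (rule tendsto_imp_eventually_ne) (simp add: fourier_pk_0)
  then obtain n where "fourier (pk 1) ((1 / real (Suc n)) *\<^sub>R \<xi>) \<noteq> 0"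
    by (auto simp: eventually_sequentially)
  moreover have "fourier (pk \<delta>) \<xi> \<noteq> 0" if "fourier (pk 1) (\<delta> *\<^sub>R \<xi>) \<noteq> 0" "\<delta> > 0" for \<delta>
    using that by (simp add: fourier_pk_scale[of \<delta>])
  ultimately show ?thesis by (intro exI[of _ n]) simp
qed

lemma wt_fourier_pk:
  assumes "\<delta> > 0"
  shows "bmeas (\<lambda>\<xi>. wt r \<xi> * fourier (pk \<delta>) \<xi>)" and "L2 (\<lambda>\<xi>. wt r \<xi> * fourier (pk \<delta>) \<xi>)"
proof -
  have b: "bmeas (\<lambda>\<xi>. wt r \<xi> * fourier (pk \<delta>) \<xi>)" for r
  proof -
    have [measurable]: "pk \<delta> \<in> borel_measurable borel"
      using L2_measurable[OF test_fun_L2(1)[OF pk_test[OF assms]]] by simp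
    obtain C where C: "\<And>\<xi>. (1 + (norm \<xi>)\<^sup>2) powr r * cmod (fourier (pk \<delta>) \<xi>) \<le> C"
      using fourier_decay[OF pk_test[OF assms], of r] by auto
    show ?thesis by (rule bmeasI[of _ C]) (use C in \<open>auto simp: norm_mult norm_wt\<close>)
  qed
  show "bmeas (\<lambda>\<xi>. wt r \<xi> * fourier (pk \<delta>) \<xi>)" by (rule b)
  \<comment> \<open>Any exponent above d/2 would do: then \<open>wt (- p / 2)\<close> is
    square-integrable, and the rapid decay of the transform absorbs the compensating weight.\<close>
  define p where "p = real DIM('a) / 2 + 1"
  have i: "integrable lborel (\<lambda>\<xi>::'a. (1 + (norm \<xi>)\<^sup>2) powr (- p))"
    by (rule integrable_bracket) (simp add: p_def)
  have "L2 (wt (- p / 2) :: 'a \<Rightarrow> complex)"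
  proof (rule L2_bounded_by[OF i])
    show "AE \<xi> in lborel. (cmod (wt (- p / 2) \<xi>))\<^sup>2 \<le> (1 + (norm (\<xi>::'a))\<^sup>2) powr (- p)"
      by (intro AE_I2) (simp add: norm_wt power2_eq_square flip: powr_add)
  qed measurable
  from L2_bmeas_mult[OF b[of "r + p / 2"] this]
  have "L2 (\<lambda>\<xi>. wt (r + p / 2) \<xi> * fourier (pk \<delta>) \<xi> * wt (- p / 2) \<xi>)" .
  moreover have "wt (r + p / 2) \<xi> * fourier (pk \<delta>) \<xi> * wt (- p / 2) \<xi> = wt r \<xi> * fourier (pk \<delta>) \<xi>" for \<xi>
  proof -
    have "wt (r + p / 2) \<xi> * wt (- p / 2) \<xi> = wt r \<xi>" unfolding wt_mult by simp
    then show ?thesis by (metis mult.assoc mult.commute)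
  qed
  ultimately show "L2 (\<lambda>\<xi>. wt r \<xi> * fourier (pk \<delta>) \<xi>)" by (simp only:)
qed

lemma L2_wt_tst: assumes "\<delta> > 0" shows "L2 (\<lambda>\<xi>. wt r \<xi> * fourier (tst x \<delta>) (- \<xi>))"
proof -
  have "L2 (\<lambda>\<xi>. exp (- \<i> * complex_of_real (x \<bullet> (- \<xi>))) * (wt r \<xi> * fourier (pk \<delta>) \<xi>))"
    by (rule L2_mult_bounded[where c=1]) (auto simp: norm_exp_i wt_fourier_pk assms simp del: of_real_minus inner_minus_right)
  then show ?thesis
    unfolding fourier_tst[OF assms] fourier_pk_reflect by (simp add: mult_ac)
qed

text \<open>The product \<open>y \<langle>\<xi>\<rangle>\<^sup>2\<^sup>r \<psi>\<^sub>\<delta>^\<close> lies in \<open>L\<^sup>1 \<inter> L\<^sup>2\<close> and its Fourier transform vanishes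
  identically, so Plancherel kills it; finally \<open>\<psi>\<^sub>\<delta>^ \<rightarrow> 1\<close> up to scaling.\<close>

lemma weighted_total:
  fixes y :: "'a l2"
  assumes "\<And>x \<delta>. \<delta> > 0 \<Longrightarrow> bp y (cls (\<lambda>\<xi>. wt r \<xi> * fourier (tst x \<delta>) (- \<xi>))) = 0"
  shows "y = 0"
proof -
  have z: "AE \<xi> in lborel. rep y \<xi> * (wt r \<xi> * fourier (pk \<delta>) \<xi>) = 0" if d: "\<delta> > 0" for \<delta>
  proof -
    define K where "K \<xi> = (wt r \<xi> * fourier (pk \<delta>) \<xi>) * rep y \<xi>" for \<xi>
    have K: "L2 K" "integrable lborel K" unfolding K_def
      using wt_fourier_pk[OF d, of r] by (auto intro: L2_bmeas_mult L2_integrable_mult)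
    have "fourier K x = 0" for x
    proof -
      have "fourier K x = (\<integral>\<xi>. rep y \<xi> * (wt r \<xi> * fourier (tst (- x) \<delta>) (- \<xi>)) \<partial>lborel)"
        unfolding fourier_tst[OF d] fourier_pk_reflect fourier_def[of K] K_def
        by (simp add: mult_ac inner_commute)
      also have "\<dots> = bp y (cls (\<lambda>\<xi>. wt r \<xi> * fourier (tst (- x) \<delta>) (- \<xi>)))"
        using bp_cls[OF L2_rep[of y] L2_wt_tst[OF d, of r "- x"]] by simp
      finally show ?thesis using assms[OF d] by simp
    qed
    then have "fourier K = (\<lambda>_. 0)" by (rule ext)
    then have "cls (fourier K) = 0" by (simp add: zero_l2_def)
    then have "norm (cls K) = 0"
      using norm_fourier[OF K(2,1)] by simp
    then have "cls K = cls (\<lambda>_. 0)" by (simp add: zero_l2_def)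
    then have "AE \<xi> in lborel. K \<xi> = 0" using K by (simp add: cls_eq_iff)
    then show ?thesis by eventually_elim (auto simp: K_def)
  qed
  \<comment> \<open>Countably many scales keep the exceptional set null, and at each frequency one
    of them has a nonvanishing transform.\<close>
  have "AE \<xi> in lborel. \<forall>n. rep y \<xi> * (wt r \<xi> * fourier (pk (1 / real (Suc n))) \<xi>) = 0"
    unfolding AE_all_countable by (intro allI z) simp
  then have "AE \<xi> in lborel. rep y \<xi> = 0"
  proof eventually_elim
    case (elim \<xi>)
    from fourier_pk_nonzero[of \<xi>] obtain n where "fourier (pk (1 / real (Suc n))) \<xi> \<noteq> 0" by blast
    with elim[rule_format, of n] show ?case by simp
  qed
  then have "cls (rep y) = cls (\<lambda>_. 0)" by (intro cls_eqI) auto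
  then show ?thesis by (simp add: zero_l2_def)
qed

lemma refl_FF_cls:
  assumes "L2 \<phi>" "integrable lborel \<phi>"
  shows "refl (FF (cls \<phi>)) = cls (\<lambda>\<xi>. fourier \<phi> (- \<xi>))" "L2 (\<lambda>\<xi>. fourier \<phi> (- \<xi>))"
  using assms by (auto simp: FF_cls refl_cls L2_fourier intro: L2_reflect)

lemma bp_parseval:
  assumes "L2 \<phi>" "integrable lborel \<phi>"
  shows "complex_of_real (FT_const TYPE('a)) * bp (x :: 'a l2) (cls \<phi>) = bp (FF x) (cls (\<lambda>\<xi>. fourier \<phi> (- \<xi>)))"
  using parseval_bp[of x "cls \<phi>"] assms by (simp add: refl_FF_cls)

lemma tst_total:
  fixes y :: "'a l2"
  assumes "\<And>x \<delta>. \<delta> > 0 \<Longrightarrow> bp y (cls (tst x \<delta>)) = 0"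
  shows "y = 0"
proof -
  have "FF y = 0"
  proof (rule weighted_total[where r=0])
    fix x :: 'a and \<delta> :: real assume d: "\<delta> > 0"
    show "bp (FF y) (cls (\<lambda>\<xi>. wt 0 \<xi> * fourier (tst x \<delta>) (- \<xi>))) = 0"
      using bp_parseval[OF test_fun_L2[OF tst_test[OF d]], of y x] assms[OF d] by simp
  qed
  then show ?thesis using FF_eq_iff[of y 0] by simp
qed

text \<open>Bridge between the distributional transform of the problem and \<open>FF\<close>:
  testing against mollifiers already determines the class, so the choice made in \<open>FT\<close>
  is immaterial up to null sets.\<close>

lemma is_FT_iff:
  fixes w F :: "'a \<Rightarrow> complex"
  assumes w: "L2 w" shows "is_FT w F \<longleftrightarrow> L2 F \<and> cls F = FF (cls w)"
proof -
  have eq: "(\<integral>x. w x * fourier \<phi> x \<partial>lborel) = bp (FF (cls w)) (cls \<phi>)" if "test_fun \<phi>" for \<phi>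
    using test_fun_L2[OF that] w by (simp add: bp_FF FF_cls bp_cls L2_fourier)
  show ?thesis
  proof
    assume F: "is_FT w F"
    then have L: "L2 F" by (simp add: is_FT_def)
    have "cls F - FF (cls w) = 0"
    proof (rule tst_total)
      fix x :: 'a and \<delta> :: real assume "\<delta> > 0"
      note t = tst_test[OF this, of x]
      have "bp (cls F) (cls (tst x \<delta>)) = bp (FF (cls w)) (cls (tst x \<delta>))"
        using F t eq[OF t] test_fun_L2[OF t] L by (simp add: is_FT_def bp_cls)
      then show "bp (cls F - FF (cls w)) (cls (tst x \<delta>)) = 0"
        by (simp add: linear_diff[OF bounded_linear.linear[OF bounded_linear_bp]])
    qed
    with L show "L2 F \<and> cls F = FF (cls w)" by simp
  next
    assume F: "L2 F \<and> cls F = FF (cls w)"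
    then show "is_FT w F"
      unfolding is_FT_def
    proof (intro conjI allI impI)
      fix \<phi> :: "'a \<Rightarrow> complex" assume t: "test_fun \<phi>"
      have "(\<integral>\<xi>. F \<xi> * \<phi> \<xi> \<partial>lborel) = bp (cls F) (cls \<phi>)"
        using F bp_cls[OF _ test_fun_L2(1)[OF t], of F] by simp
      then show "(\<integral>x. w x * fourier \<phi> x \<partial>lborel) = (\<integral>\<xi>. F \<xi> * \<phi> \<xi> \<partial>lborel)"
        using F eq[OF t] by simp
    qed (use F in simp)
  qed
qed

lemma FT_cls: fixes w :: "'a \<Rightarrow> complex" assumes "L2 w" shows "L2 (FT w)" "cls (FT w) = FF (cls w)"
proof -
  have "is_FT w (rep (FF (cls w)))" using assms by (simp add: is_FT_iff)
  then have "is_FT w (FT w)" unfolding FT_def by (rule someI[of "is_FT w"])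
  then show "L2 (FT w)" "cls (FT w) = FF (cls w)" using assms by (simp_all add: is_FT_iff)
qed

lemma norm_wt_half_sq: "(cmod (wt (s / 2) \<xi> * z))\<^sup>2 = (1 + (norm \<xi>)\<^sup>2) powr s * (cmod z)\<^sup>2"
proof -
  have "((1 + (norm \<xi>)\<^sup>2) powr (s / 2))\<^sup>2 = (1 + (norm \<xi>)\<^sup>2) powr s"
    unfolding power2_eq_square powr_add[symmetric] by simp
  then show ?thesis by (simp only: norm_mult norm_wt power_mult_distrib)
qed

text \<open>The L2 norm of this class is the H^s norm of \<open>w\<close>, so continuity into H^s
  becomes norm continuity of a curve in L2.\<close>

definition HH :: "real \<Rightarrow> ('a \<Rightarrow> complex) \<Rightarrow> 'a l2" where
  "HH s w = cls (\<lambda>\<xi>. wt (s / 2) \<xi> * FT w \<xi>)"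

lemma in_Hs_D:
  fixes w :: "'a \<Rightarrow> complex"
  assumes "in_Hs s w"
  shows "L2 w" "L2 (\<lambda>\<xi>. wt (s / 2) \<xi> * FT w \<xi>)"
proof -
  show w: "L2 w" using assms by (simp add: in_Hs_def)
  obtain F where F: "is_FT w F" "(\<integral>\<^sup>+\<xi>. ennreal ((1 + (norm \<xi>)\<^sup>2) powr s * (cmod (F \<xi>))\<^sup>2) \<partial>lborel) < \<infinity>"
    using assms by (auto simp: in_Hs_def)
  have L: "L2 F" "cls F = FF (cls w)" using F(1) w by (simp_all add: is_FT_iff)
  have [measurable]: "F \<in> borel_measurable borel" "FT w \<in> borel_measurable borel"
    using L2_measurable[OF L(1)] L2_measurable[OF FT_cls(1)[OF w]] by simp_all
  have 1: "L2 (\<lambda>\<xi>. wt (s / 2) \<xi> * F \<xi>)"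
    using F(2) by (simp add: L2_def norm_wt_half_sq)
  \<comment> \<open>The transform witnessing membership need not be the chosen one; agreement almost
    everywhere transfers the weighted integrability.\<close>
  have "AE \<xi> in lborel. F \<xi> = FT w \<xi>"
    using L FT_cls[OF w] by (simp flip: cls_eq_iff)
  then have 2: "AE \<xi> in lborel. wt (s / 2) \<xi> * F \<xi> = wt (s / 2) \<xi> * FT w \<xi>" by eventually_elim simp
  show "L2 (\<lambda>\<xi>. wt (s / 2) \<xi> * FT w \<xi>)"
    by (rule L2_cong_AE[OF 1 _ 2]) measurable
qed

lemma FF_HH:
  assumes "in_Hs s w" "s \<ge> 0" shows "FF (cls w) = mul (wt (- s / 2)) (HH s w)"
proof -
  have "mul (wt (- s / 2)) (HH s w) = cls (\<lambda>\<xi>. wt (- s / 2) \<xi> * (wt (s / 2) \<xi> * FT w \<xi>))"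
    unfolding HH_def by (rule mul_cls) (use assms in_Hs_D in \<open>auto intro: bmeas_wt\<close>)
  also have "(\<lambda>\<xi>. wt (- s / 2) \<xi> * (wt (s / 2) \<xi> * FT w \<xi>)) = FT w"
    by (simp add: wt_mult flip: mult.assoc)
  finally show ?thesis using FT_cls(2)[OF in_Hs_D(1)[OF assms(1)]] by simp
qed

lemma Hs_norm2_diff:
  fixes w v :: "'a \<Rightarrow> complex"
  assumes w: "in_Hs s w" and v: "in_Hs s v"
  shows "Hs_norm2 s (\<lambda>x. w x - v x) = ennreal ((norm (HH s w - HH s v))\<^sup>2)"
proof -
  note L = in_Hs_D[OF w] in_Hs_D[OF v]
  have Ld: "L2 (\<lambda>x. w x - v x)" using L by (simp add: L2_diff)
  \<comment> \<open>The transform of the difference is a separate choice, so linearity holds only on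
    classes, through \<open>FF\<close>.\<close>
  have "cls (FT (\<lambda>x. w x - v x)) = cls (\<lambda>\<xi>. FT w \<xi> - FT v \<xi>)"
    unfolding FT_cls(2)[OF Ld] cls_diff[OF L(1,3), symmetric] FF_diff
    using L by (simp add: cls_diff FT_cls(1) flip: FT_cls(2))
  then have ae: "AE \<xi> in lborel. FT (\<lambda>x. w x - v x) \<xi> = FT w \<xi> - FT v \<xi>"
    by (rule iffD1[OF cls_eq_iff[OF FT_cls(1)[OF Ld] L2_diff[OF FT_cls(1)[OF L(1)] FT_cls(1)[OF L(3)]]]])
  have "Hs_norm2 s (\<lambda>x. w x - v x) = (\<integral>\<^sup>+\<xi>. ennreal ((cmod (wt (s / 2) \<xi> * FT w \<xi> - wt (s / 2) \<xi> * FT v \<xi>))\<^sup>2) \<partial>lborel)"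
    unfolding Hs_norm2_def
  proof (rule nn_integral_cong_AE, use ae in eventually_elim)
    case (elim \<xi>)
    show ?case by (simp only: elim norm_wt_half_sq[of s \<xi> "FT w \<xi> - FT v \<xi>", symmetric] right_diff_distrib)
  qed
  also have "\<dots> = ennreal ((norm (HH s w - HH s v))\<^sup>2)"
    unfolding HH_def cls_diff[OF L(2,4)] by (rule nn_integral_cls[OF L2_diff[OF L(2,4)]])
  finally show ?thesis .
qed

end

section \<open>Sobolev embedding and the evolution equation in \<open>L\<^sup>2\<close>\<close>

lemma L2_Hoelder:
  assumes f: "L2 f" and g: "L2 g"
  shows "integrable lborel (\<lambda>t. cmod (f t) * cmod (g t))"
    and "(\<integral>t. cmod (f t) * cmod (g t) \<partial>lborel) \<le> norm (cls f) * norm (cls g)"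
proof -
  show "integrable lborel (\<lambda>t. cmod (f t) * cmod (g t))"
    using integrable_norm[OF L2_integrable_mult[OF f g]] by (simp add: norm_mult)
  \<comment> \<open>Replacing functions by their moduli preserves the norms, and Cauchy-Schwarz for
    the real inner product then bounds the integral of the product of moduli.\<close>
  have L: "L2 (\<lambda>t. complex_of_real (cmod (k t)))" if "L2 k" for k :: "'a \<Rightarrow> complex"
    using that by (auto simp: L2_def)
  have n: "norm (cls (\<lambda>t. complex_of_real (cmod (k t)))) = norm (cls k)" if "L2 k" for k :: "'a \<Rightarrow> complex"
  proof -
    have "(norm (cls (\<lambda>t. complex_of_real (cmod (k t)))))\<^sup>2 = (norm (cls k))\<^sup>2"
      using that L[OF that] by (simp add: norm_cls_sq)
    then show ?thesis by simp
  qed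
  have "(\<integral>t. cmod (f t) * cmod (g t) \<partial>lborel) = inner (cls (\<lambda>t. complex_of_real (cmod (f t)))) (cls (\<lambda>t. complex_of_real (cmod (g t))))"
    using f g L by (simp add: inner_cls flip: of_real_mult)
  also have "\<dots> \<le> norm (cls f) * norm (cls g)"
    using norm_cauchy_schwarz[of "cls (\<lambda>t. complex_of_real (cmod (f t)))" "cls (\<lambda>t. complex_of_real (cmod (g t)))"]
    by (simp add: n f g)
  finally show "(\<integral>t. cmod (f t) * cmod (g t) \<partial>lborel) \<le> norm (cls f) * norm (cls g)" .
qed

lemma bp_mul_cls:
  assumes m: "bmeas m" and f: "L2 f"
  shows "bp (mul m z) (cls f) = bp z (cls (\<lambda>t. m t * f t))"
proof -
  obtain h where h: "L2 h" "z = cls h" by (rule l2_cases)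
  show ?thesis
    unfolding h(2) mul_cls[OF m h(1)] bp_cls[OF L2_bmeas_mult[OF m h(1)] f] bp_cls[OF h(1) L2_bmeas_mult[OF m f]]
    by (simp add: mult_ac)
qed

lemma bp_cmult: "bp (mul (\<lambda>_. c) x) y = c * bp x y"
proof -
  obtain f where f: "L2 f" "x = cls f" by (rule l2_cases)
  obtain g where g: "L2 g" "y = cls g" by (rule l2_cases)
  show ?thesis using f g by (simp add: mul_cls bp_cls L2_cmult mult.assoc)
qed

section \<open>The nonlinearity as a map on bounded classes\<close>

definition ess_bd :: "real \<Rightarrow> 'a::euclidean_space l2 \<Rightarrow> bool" where
  "ess_bd K x \<longleftrightarrow> (AE t in lborel. cmod (rep x t) \<le> K)"

definition ess_bdr :: "real \<Rightarrow> ('a::euclidean_space \<Rightarrow> real) \<Rightarrow> bool" where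
  "ess_bdr a V \<longleftrightarrow> V \<in> borel_measurable borel \<and> a \<ge> 0 \<and> (AE t in lborel. \<bar>V t\<bar> \<le> a)"

text \<open>The cubic term of a general class can leave L2, where \<open>cls\<close> means nothing;
  the facts about \<open>NL\<close> below therefore ask for an essential bound.\<close>

definition NL :: "('a::euclidean_space \<Rightarrow> real) \<Rightarrow> ('a \<Rightarrow> real) \<Rightarrow> 'a l2 \<Rightarrow> 'a l2" where
  "NL V g x = cls (\<lambda>t. complex_of_real (V t) * rep x t + complex_of_real (g t * (cmod (rep x t))\<^sup>2) * rep x t)"

lemma L2_nonlin:
  assumes V: "ess_bdr a V" and g: "ess_bdr b g" and f: "L2 f" "AE t in lborel. cmod (f t) \<le> K"
  shows "L2 (\<lambda>t. complex_of_real (V t) * f t + complex_of_real (g t * (cmod (f t))\<^sup>2) * f t)"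
proof -
  have [measurable]: "V \<in> borel_measurable borel" "g \<in> borel_measurable borel" "f \<in> borel_measurable borel"
    using V g L2_measurable[OF f(1)] by (simp_all add: ess_bdr_def)
  have "L2 (\<lambda>t. complex_of_real (V t + g t * (cmod (f t))\<^sup>2) * f t)"
  proof (rule L2_mult_bounded[OF f(1)])
    show "AE t in lborel. cmod (complex_of_real (V t + g t * (cmod (f t))\<^sup>2)) \<le> a + b * K\<^sup>2"
      using V[unfolded ess_bdr_def, THEN conjunct2, THEN conjunct2] g[unfolded ess_bdr_def, THEN conjunct2, THEN conjunct2] f(2)
    proof eventually_elim
      case (elim t)
      have "\<bar>g t\<bar> * (cmod (f t))\<^sup>2 \<le> b * K\<^sup>2"
        using elim g by (intro mult_mono power_mono) (auto simp: ess_bdr_def)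
      then have "\<bar>g t * (cmod (f t))\<^sup>2\<bar> \<le> b * K\<^sup>2" by (simp add: abs_mult)
      then have "\<bar>V t + g t * (cmod (f t))\<^sup>2\<bar> \<le> a + b * K\<^sup>2" using elim by linarith
      then show ?case by (simp only: norm_of_real)
    qed
  qed measurable
  then show ?thesis by (simp add: distrib_right)
qed

lemma rep_NL:
  assumes "ess_bdr a V" "ess_bdr b g" "ess_bd K x"
  shows "AE t in lborel. rep (NL V g x) t = complex_of_real (V t) * rep x t + complex_of_real (g t * (cmod (rep x t))\<^sup>2) * rep x t"
  unfolding NL_def
  by (rule rep_cls[OF L2_nonlin[OF assms(1,2) L2_rep]]) (use assms(3) in \<open>simp add: ess_bd_def\<close>)

lemma NL_cls:
  assumes V: "ess_bdr a V" and g: "ess_bdr b g" and f: "L2 f" and K: "ess_bd K (cls f)"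
  shows "NL V g (cls f) = cls (\<lambda>t. complex_of_real (V t) * f t + complex_of_real (g t * (cmod (f t))\<^sup>2) * f t)"
    and "L2 (\<lambda>t. complex_of_real (V t) * f t + complex_of_real (g t * (cmod (f t))\<^sup>2) * f t)"
proof -
  have "AE t in lborel. cmod (f t) \<le> K"
    using K rep_cls[OF f] unfolding ess_bd_def by eventually_elim simp
  with V g f show L: "L2 (\<lambda>t. complex_of_real (V t) * f t + complex_of_real (g t * (cmod (f t))\<^sup>2) * f t)"
    by (rule L2_nonlin)
  show "NL V g (cls f) = cls (\<lambda>t. complex_of_real (V t) * f t + complex_of_real (g t * (cmod (f t))\<^sup>2) * f t)"
    unfolding NL_def
  proof (rule cls_eqI[OF _ L])
    show "L2 (\<lambda>t. complex_of_real (V t) * rep (cls f) t + complex_of_real (g t * (cmod (rep (cls f) t))\<^sup>2) * rep (cls f) t)"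
      using K by (intro L2_nonlin[OF V g]) (auto simp: ess_bd_def)
    show "AE t in lborel. complex_of_real (V t) * rep (cls f) t + complex_of_real (g t * (cmod (rep (cls f) t))\<^sup>2) * rep (cls f) t
        = complex_of_real (V t) * f t + complex_of_real (g t * (cmod (f t))\<^sup>2) * f t"
      using rep_cls[OF f] by eventually_elim simp
  qed
qed

text \<open>Split into |x|^2 (x - y) and (|x|^2 - |y|^2) y. The first contributes K^2, the second 2
  K^2 because |x| + |y| is at most 2K.\<close>

lemma cubic_Lipschitz:
  fixes x y :: complex
  assumes x: "cmod x \<le> K" and y: "cmod y \<le> K"
  shows "cmod (complex_of_real ((cmod x)\<^sup>2) * x - complex_of_real ((cmod y)\<^sup>2) * y) \<le> 3 * K\<^sup>2 * cmod (x - y)"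
proof -
  have K: "K \<ge> 0" using order_trans[OF norm_ge_zero x] .
  have eq: "complex_of_real ((cmod x)\<^sup>2) * x - complex_of_real ((cmod y)\<^sup>2) * y
     = complex_of_real ((cmod x)\<^sup>2) * (x - y) + complex_of_real ((cmod x + cmod y) * (cmod x - cmod y)) * y"
    by (simp add: algebra_simps power2_eq_square)
  have 1: "cmod (complex_of_real ((cmod x)\<^sup>2) * (x - y)) \<le> K\<^sup>2 * cmod (x - y)"
    unfolding norm_mult norm_of_real using x by (intro mult_right_mono) (auto intro: power_mono)
  have "\<bar>cmod x - cmod y\<bar> \<le> cmod (x - y)" by (rule norm_triangle_ineq3)
  then have "(cmod x + cmod y) * \<bar>cmod x - cmod y\<bar> * cmod y \<le> (K + K) * cmod (x - y) * K"
    using x y K by (intro mult_mono) auto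
  then have 2: "cmod (complex_of_real ((cmod x + cmod y) * (cmod x - cmod y)) * y) \<le> 2 * K\<^sup>2 * cmod (x - y)"
    unfolding norm_mult norm_of_real abs_mult by (simp add: power2_eq_square algebra_simps)
  show ?thesis
    unfolding eq using norm_triangle_ineq[of "complex_of_real ((cmod x)\<^sup>2) * (x - y)"] 1 2
    by (smt (verit) distrib_right)
qed

lemma NL_Lipschitz:
  assumes V: "ess_bdr a V" and g: "ess_bdr b g" and x: "ess_bd K x" and y: "ess_bd K y"
  shows "norm (NL V g x - NL V g y) \<le> (a + 3 * b * K\<^sup>2) * norm (x - y)"
proof (rule norm_l2_mono)
  have a: "a \<ge> 0" and b: "b \<ge> 0" and Va: "AE t in lborel. \<bar>V t\<bar> \<le> a" and gb: "AE t in lborel. \<bar>g t\<bar> \<le> b"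
    using V g by (auto simp: ess_bdr_def)
  show "0 \<le> a + 3 * b * K\<^sup>2" using a b by simp
  show "AE t in lborel. cmod (rep (NL V g x - NL V g y) t) \<le> (a + 3 * b * K\<^sup>2) * cmod (rep (x - y) t)"
    using rep_diff[of "NL V g x" "NL V g y"] rep_diff[of x y] rep_NL[OF V g x] rep_NL[OF V g y] Va gb
      x[unfolded ess_bd_def] y[unfolded ess_bd_def]
  proof eventually_elim
    case (elim t)
    have "rep (NL V g x - NL V g y) t = complex_of_real (V t) * (rep x t - rep y t)
      + complex_of_real (g t) * (complex_of_real ((cmod (rep x t))\<^sup>2) * rep x t - complex_of_real ((cmod (rep y t))\<^sup>2) * rep y t)"
      by (simp add: elim(1,3,4) algebra_simps)
    also have "cmod \<dots> \<le> cmod (complex_of_real (V t) * (rep x t - rep y t))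
      + cmod (complex_of_real (g t) * (complex_of_real ((cmod (rep x t))\<^sup>2) * rep x t - complex_of_real ((cmod (rep y t))\<^sup>2) * rep y t))"
      by (rule norm_triangle_ineq)
    also have "\<dots> \<le> a * cmod (rep x t - rep y t) + b * (3 * K\<^sup>2 * cmod (rep x t - rep y t))"
      unfolding norm_mult norm_of_real using elim b
      by (intro add_mono mult_mono cubic_Lipschitz) auto
    also have "\<dots> = (a + 3 * b * K\<^sup>2) * cmod (rep (x - y) t)" by (simp add: elim(2) algebra_simps)
    finally show ?case .
  qed
qed

lemma NL_continuous:
  assumes V: "ess_bdr a V" and g: "ess_bdr b g" and X: "continuous_on S X" and K: "\<And>t. t \<in> S \<Longrightarrow> ess_bd K (X t)"
  shows "continuous_on S (\<lambda>t. NL V g (X t))"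
  unfolding continuous_on_def
proof
  fix t assume t: "t \<in> S"
  define L where "L = a + 3 * b * K\<^sup>2"
  have "((\<lambda>t'. L * norm (X t' - X t)) \<longlongrightarrow> L * norm (X t - X t)) (at t within S)"
    using X t by (intro tendsto_intros) (auto simp: continuous_on_def)
  then have l0: "((\<lambda>t'. L * norm (X t' - X t)) \<longlongrightarrow> 0) (at t within S)" by simp
  have "((\<lambda>t'. NL V g (X t') - NL V g (X t)) \<longlongrightarrow> 0) (at t within S)"
  proof (rule Lim_null_comparison[OF _ l0])
    show "\<forall>\<^sub>F t' in at t within S. norm (NL V g (X t') - NL V g (X t)) \<le> L * norm (X t' - X t)"
      unfolding eventually_at_filter L_def
      by (intro always_eventually allI impI NL_Lipschitz[OF V g] K t)
  qed
  then show "((\<lambda>t. NL V g (X t)) \<longlongrightarrow> NL V g (X t)) (at t within S)" by (simp add: LIM_zero_iff)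
qed

lemma NL_perturb:
  assumes V: "ess_bdr a V" and g: "ess_bdr b g" and V': "ess_bdr a' V'" and g': "ess_bdr b' g'" and x: "ess_bd K x"
    and dV: "AE t in lborel. \<bar>V' t - V t\<bar> \<le> p" and dg: "AE t in lborel. \<bar>g' t - g t\<bar> \<le> q" and pq: "p \<ge> 0" "q \<ge> 0"
  shows "norm (NL V' g' x - NL V g x) \<le> (p + q * K\<^sup>2) * norm x"
proof (rule norm_l2_mono)
  show "0 \<le> p + q * K\<^sup>2" using pq by simp
  show "AE t in lborel. cmod (rep (NL V' g' x - NL V g x) t) \<le> (p + q * K\<^sup>2) * cmod (rep x t)"
    using rep_diff[of "NL V' g' x" "NL V g x"] rep_NL[OF V g x] rep_NL[OF V' g' x] dV dg x[unfolded ess_bd_def]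
  proof eventually_elim
    case (elim t)
    have "rep (NL V' g' x - NL V g x) t = complex_of_real (V' t - V t) * rep x t
      + complex_of_real ((g' t - g t) * (cmod (rep x t))\<^sup>2) * rep x t"
      by (simp add: elim(1-3) algebra_simps)
    also have "cmod \<dots> \<le> cmod (complex_of_real (V' t - V t) * rep x t) + cmod (complex_of_real ((g' t - g t) * (cmod (rep x t))\<^sup>2) * rep x t)"
      by (rule norm_triangle_ineq)
    also have "\<dots> \<le> p * cmod (rep x t) + (q * K\<^sup>2) * cmod (rep x t)"
      unfolding norm_mult norm_of_real abs_mult using elim pq
      by (intro add_mono mult_right_mono mult_mono) (auto intro: power_mono)
    also have "\<dots> = (p + q * K\<^sup>2) * cmod (rep x t)" by (simp add: algebra_simps)
    finally show ?case .
  qed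
qed

text \<open>Here \<open>X\<close> is the solution and \<open>H\<close> its weighted Fourier transform \<open>\<langle>\<xi>\<rangle>\<^sup>s X^\<close>; the equation is imposed on every
  frequency truncation, where \<open>|\<xi>|\<^sup>2\<^sup>s\<close> is a bounded multiplier.\<close>

definition l2sol :: "real \<Rightarrow> ('a::euclidean_space \<Rightarrow> real) \<Rightarrow> ('a \<Rightarrow> real) \<Rightarrow> real \<Rightarrow> (real \<Rightarrow> 'a l2) \<Rightarrow> (real \<Rightarrow> 'a l2) \<Rightarrow> bool" where
  "l2sol s V g T X H \<longleftrightarrow> continuous_on {0..T} H \<and>
     (\<forall>t\<in>{0..T}. FF (X t) = mul (wt (- s / 2)) (H t)) \<and>
     (\<forall>M. \<forall>t\<in>{0..T}. ((\<lambda>t. mul (trunc M) (FF (X t))) has_vector_derivative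
        mul (\<lambda>_. - \<i>) (mul (\<lambda>\<xi>. trunc M \<xi> * lap s \<xi>) (FF (X t)) + mul (trunc M) (FF (NL V g (X t)))))
       (at t within {0..T}))"

context mollifier
begin

text \<open>By duality: test \<open>x\<close> against its conjugate phase on \<open>{|x| > B, |t| \<le> n}\<close>.\<close>

lemma sobolev:
  assumes s: "s > real DIM('a) / 2"
  shows "\<exists>C\<ge>0. \<forall>(x :: 'a l2) h. FF x = mul (wt (- s / 2)) h \<longrightarrow> ess_bd (C * norm h) x"
proof -
  have i: "integrable lborel (\<lambda>\<xi>::'a. (1 + (norm \<xi>)\<^sup>2) powr (- s))" by (rule integrable_bracket[OF s])
  have LS: "L2 (wt (- s / 2) :: 'a \<Rightarrow> complex)"
  proof (rule L2_bounded_by[OF i])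
    show "AE \<xi> in lborel. (cmod (wt (- s / 2) \<xi>))\<^sup>2 \<le> (1 + (norm (\<xi>::'a))\<^sup>2) powr (- s)"
      by (intro AE_I2) (simp add: norm_wt power2_eq_square flip: powr_add)
  qed measurable
  have s0: "s \<ge> 0" using s by (smt (verit) divide_nonneg_nonneg of_nat_0_le_iff)
  then have bS: "bmeas (wt (- s / 2) :: 'a \<Rightarrow> complex)" by (intro bmeas_wt) simp
  define S where "S = cls (wt (- s / 2) :: 'a \<Rightarrow> complex)"
  define c where "c = FT_const TYPE('a)"
  have c: "c > 0" by (simp add: c_def)
  \<comment> \<open>Cauchy-Schwarz between <xi>^(-s), square-integrable exactly because s > d/2, and
    \<open>h\<close>; the division by \<open>c\<close> is Parseval's.\<close>
  define C where "C = norm S / c"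
  have C0: "C \<ge> 0" using c by (simp add: C_def)
  have "ess_bd (C * norm h) x" if x: "FF x = mul (wt (- s / 2)) h" for x h :: "'a l2"
  proof -
    define B where "B = C * norm h"
    have B0: "B \<ge> 0" using C0 by (simp add: B_def)
    have A: "AE t in lborel. \<not> (cmod (rep x t) > B \<and> norm t \<le> real n)" for n
    proof -
      define A where "A = {t. cmod (rep x t) > B \<and> norm t \<le> real n}"
      have [measurable]: "A \<in> sets borel" unfolding A_def by measurable
      define \<phi> where "\<phi> t = indicator A t * cnj (sgn (rep x t))" for t
      have nphi: "cmod (\<phi> t) = indicator A t" for t
        using B0 by (auto simp: \<phi>_def A_def indicator_def norm_mult norm_sgn)
      have [measurable]: "\<phi> \<in> borel_measurable borel"
        unfolding \<phi>_def sgn_div_norm by measurable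
      have Lphi: "L2 \<phi>" "integrable lborel \<phi>"
      proof -
        have 1: "cmod (\<phi> t) \<le> 1" for t by (simp add: nphi indicator_def)
        have 2: "norm t > real n \<Longrightarrow> \<phi> t = 0" for t by (simp add: \<phi>_def A_def)
        show "L2 \<phi>" by (rule L2_bounded_support(1)[of \<phi> 1 "real n"]) (simp_all add: 1 2)
        show "integrable lborel \<phi>" by (rule L2_bounded_support(2)[of \<phi> 1 "real n"]) (simp_all add: 1 2)
      qed
      have iA: "integrable lborel (indicator A :: 'a \<Rightarrow> real)"
        using integrable_norm[OF Lphi(2)] by (simp add: nphi)
      have m: "rep x t * \<phi> t = complex_of_real (indicator A t * cmod (rep x t))" for t
      proof -
        have "rep x t * cnj (sgn (rep x t)) = rep x t * cnj (rep x t) / complex_of_real (cmod (rep x t))"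
          by (simp add: sgn_eq)
        also have "\<dots> = complex_of_real ((cmod (rep x t))\<^sup>2 / cmod (rep x t))"
          by (simp only: complex_norm_square of_real_divide)
        also have "(cmod (rep x t))\<^sup>2 / cmod (rep x t) = cmod (rep x t)" by (simp add: power2_eq_square)
        finally show ?thesis by (simp add: \<phi>_def indicator_def)
      qed
      have iAx: "integrable lborel (\<lambda>t. indicator A t * cmod (rep x t))"
        using integrable_Re[OF L2_integrable_mult[OF L2_rep[of x] Lphi(1)]] by (simp add: m)
      have bpx: "bp x (cls \<phi>) = complex_of_real (\<integral>t. indicator A t * cmod (rep x t) \<partial>lborel)"
        using bp_cls[OF L2_rep[of x] Lphi(1)] by (simp only: cls_rep m integral_complex_of_real)
      \<comment> \<open>The measure of \<open>A\<close>, which is also the L1 norm of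
        \<open>\<phi>\<close> and hence bounds its transform. The pairing is thus at most B times
        this measure, although the modulus exceeds B on \<open>A\<close>; so \<open>A\<close> is
        null.\<close>
      define k where "k = (\<integral>t. indicator A t \<partial>lborel :: real)"
      have fb: "cmod (fourier \<phi> \<xi>) \<le> k" for \<xi> using fourier_bounded[of \<phi> \<xi>] by (simp add: nphi k_def)
      have "c * cmod (bp x (cls \<phi>)) = cmod (bp (FF x) (cls (\<lambda>\<xi>. fourier \<phi> (- \<xi>))))"
        using arg_cong[OF bp_parseval[OF Lphi, of x], of cmod] by (simp add: norm_mult c_def abs_of_pos)
      also have "\<dots> = cmod (\<integral>\<xi>. rep h \<xi> * (wt (- s / 2) \<xi> * fourier \<phi> (- \<xi>)) \<partial>lborel)"
        unfolding x using bp_mul_cls[OF bS refl_FF_cls(2)[OF Lphi], of h] bp_cls[OF L2_rep[of h] L2_bmeas_mult[OF bS refl_FF_cls(2)[OF Lphi]]]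
        by simp
      also have "\<dots> \<le> (\<integral>\<xi>. (cmod (wt (- s / 2) \<xi>) * cmod (rep h \<xi>)) * k \<partial>lborel)"
      proof (rule order_trans[OF integral_norm_bound integral_mono])
        show "integrable lborel (\<lambda>\<xi>. norm (rep h \<xi> * (wt (- s / 2) \<xi> * fourier \<phi> (- \<xi>))))"
          by (intro integrable_norm L2_integrable_mult L2_bmeas_mult[OF bS] refl_FF_cls(2) Lphi L2_rep)
        show "integrable lborel (\<lambda>\<xi>. (cmod (wt (- s / 2) \<xi>) * cmod (rep h \<xi>)) * k)"
          by (intro integrable_mult_left L2_Hoelder LS L2_rep)
        show "norm (rep h \<xi> * (wt (- s / 2) \<xi> * fourier \<phi> (- \<xi>))) \<le> (cmod (wt (- s / 2) \<xi>) * cmod (rep h \<xi>)) * k" for \<xi>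
          using mult_left_mono[OF fb[of "- \<xi>"], of "cmod (wt (- s / 2) \<xi>) * cmod (rep h \<xi>)"]
          by (simp add: norm_mult mult_ac)
      qed
      also have "\<dots> = (\<integral>\<xi>. cmod (wt (- s / 2) \<xi>) * cmod (rep h \<xi>) \<partial>lborel) * k" by (rule integral_mult_left_zero)
      also have "\<dots> \<le> (norm S * norm h) * k"
        using L2_Hoelder(2)[OF LS L2_rep[of h]] by (intro mult_right_mono) (auto simp: S_def k_def)
      finally have "cmod (bp x (cls \<phi>)) \<le> B * k"
        using c by (simp add: B_def C_def field_simps)
      then have "(\<integral>t. indicator A t * cmod (rep x t) \<partial>lborel) \<le> B * k"
        unfolding bpx by simp
      then have "(\<integral>t. indicator A t * cmod (rep x t) - B * indicator A t \<partial>lborel) \<le> 0"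
        using iA iAx by (simp add: k_def)
      moreover have nn: "0 \<le> indicator A t * cmod (rep x t) - B * indicator A t" for t
        by (auto simp: indicator_def A_def)
      ultimately have "(\<integral>t. indicator A t * cmod (rep x t) - B * indicator A t \<partial>lborel) = 0"
        by (intro antisym integral_nonneg) auto
      then have "AE t in lborel. indicator A t * cmod (rep x t) - B * indicator A t = 0"
        using nn iA iAx by (subst (asm) integral_nonneg_eq_0_iff_AE) auto
      then show ?thesis by eventually_elim (auto simp: A_def indicator_def)
    qed
    have "AE t in lborel. \<forall>n::nat. \<not> (cmod (rep x t) > B \<and> norm t \<le> real n)"
      unfolding AE_all_countable using A by blast
    then show ?thesis
      unfolding ess_bd_def B_def[symmetric]
    proof eventually_elim
      case (elim t)
      obtain n where "norm t \<le> real n" using real_arch_simple by blast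
      with elim[rule_format, of n] show ?case by simp
    qed
  qed
  with C0 show ?thesis by blast
qed

text \<open>The product of |xi|^(2s) with the transform of u need not lie in L2, so that transform
  need not be differentiable there. Its multiple by <xi>^(-2s) is, with continuous derivative
  \<open>Z\<close>; multiplying by <xi>^(2s) on |xi| <= M, a bounded symbol, then gives the
  truncated equation.\<close>

lemma nls_l2sol:
  fixes u :: "real \<Rightarrow> 'a \<Rightarrow> complex"
  assumes sol: "nls_solution s V g u0 T u" and V: "ess_bdr a V" and g: "ess_bdr b g" and s: "s > real DIM('a) / 2"
  shows "l2sol s V g T (\<lambda>t. cls (u t)) (\<lambda>t. HH s (u t))"
proof -
  have s0: "s \<ge> 0" using s by (smt (verit) divide_nonneg_nonneg of_nat_0_le_iff)
  define X where "X t = cls (u t)" for t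
  define H where "H t = HH s (u t)" for t
  have inHs: "in_Hs s (u t)" if "t \<in> {0..T}" for t using sol that by (simp add: nls_solution_def)
  have Lu: "L2 (u t)" if "t \<in> {0..T}" for t using in_Hs_D(1)[OF inHs[OF that]] .
  have FX: "FF (X t) = mul (wt (- s / 2)) (H t)" if "t \<in> {0..T}" for t
    unfolding X_def H_def by (rule FF_HH[OF inHs[OF that] s0])
  have contH: "continuous_on {0..T} H"
    unfolding continuous_on_def
  proof
    fix t assume t: "t \<in> {0..T}"
    have "((\<lambda>t'. Hs_norm2 s (\<lambda>x. u t' x - u t x)) \<longlongrightarrow> 0) (at t within {0..T})"
      using sol t by (simp add: nls_solution_def)
    then have "((\<lambda>t'. ennreal ((norm (H t' - H t))\<^sup>2)) \<longlongrightarrow> ennreal 0) (at t within {0..T})"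
      unfolding ennreal_0
    proof (rule Lim_transform_eventually)
      show "\<forall>\<^sub>F t' in at t within {0..T}. Hs_norm2 s (\<lambda>x. u t' x - u t x) = ennreal ((norm (H t' - H t))\<^sup>2)"
        unfolding eventually_at_filter H_def
        by (intro always_eventually allI impI Hs_norm2_diff inHs t)
    qed
    then have "((\<lambda>t'. (norm (H t' - H t))\<^sup>2) \<longlongrightarrow> 0) (at t within {0..T})"
      by (rule tendsto_ennrealD) auto
    then have "((\<lambda>t'. sqrt ((norm (H t' - H t))\<^sup>2)) \<longlongrightarrow> sqrt 0) (at t within {0..T})"
      by (rule tendsto_real_sqrt)
    then show "(H \<longlongrightarrow> H t) (at t within {0..T})"
      by (simp add: tendsto_norm_zero_iff LIM_zero_iff)
  qed
  have contX: "continuous_on {0..T} X"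
  proof -
    have "continuous_on {0..T} (\<lambda>t. FI (mul (wt (- s / 2)) (H t)))"
      by (intro bounded_linear.continuous_on[OF bounded_linear_FI] bounded_linear.continuous_on[OF bounded_linear_mul] contH)
    moreover have "FI (mul (wt (- s / 2)) (H t)) = X t" if "t \<in> {0..T}" for t
      using FX[OF that, symmetric] by simp
    ultimately show ?thesis by (rule continuous_on_eq)
  qed
  obtain C where C: "C \<ge> 0" "\<And>(x :: 'a l2) h. FF x = mul (wt (- s / 2)) h \<Longrightarrow> ess_bd (C * norm h) x"
    using sobolev[OF s] by blast
  have "bounded (H ` {0..T})"
    by (intro compact_imp_bounded compact_continuous_image contH) auto
  then obtain B where "\<forall>t\<in>{0..T}. norm (H t) \<le> B" by (auto simp: bounded_iff)
  then have B: "norm (H t) \<le> B" if "t \<in> {0..T}" for t using that by blast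
  define K where "K = C * B"
  have K: "ess_bd K (X t)" if t: "t \<in> {0..T}" for t
  proof -
    have "C * norm (H t) \<le> K" unfolding K_def by (rule mult_left_mono[OF B[OF t] C(1)])
    then show ?thesis using C(2)[OF FX[OF t]] unfolding ess_bd_def by (auto elim: eventually_mono)
  qed
  define N where "N t = NL V g (X t)" for t
  have contN: "continuous_on {0..T} N"
    unfolding N_def by (rule NL_continuous[OF V g contX K])
  define Y where "Y t = mul (wt (- s)) (FF (X t))" for t
  \<comment> \<open>As \<open>H\<close> already contains <xi>^s, the factor <xi>^(-3s) leaves
    |xi|^(2s) <xi>^(-2s) times the transform of the solution, which is the dispersive term of the
    equation for \<open>Y\<close>.\<close>
  define m3 where "m3 \<xi> = lap s \<xi> * wt (- 3 * s / 2) \<xi>" for \<xi> :: 'a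
  have bm3: "bmeas m3" unfolding m3_def[abs_def] by (rule bmeas_lap_wt) (use s0 in auto)
  have bws: "bmeas (wt (- s) :: 'a \<Rightarrow> complex)" by (rule bmeas_wt) (use s0 in auto)
  define Z where "Z t = mul (\<lambda>_. - \<i>) (mul m3 (H t) + mul (wt (- s)) (FF (N t)))" for t
  have contZ: "continuous_on {0..T} Z"
    unfolding Z_def
    by (intro bounded_linear.continuous_on[OF bounded_linear_FF] bounded_linear.continuous_on[OF bounded_linear_mul]
      continuous_intros contH contN)
  \<comment> \<open>The weight on the test function cancels the one in \<open>Y\<close>, so pairing
    with \<open>E\<close> returns the original weak equation. Rapid decay keeps the weighted test
    function in L2.\<close>
  define E where "E x \<delta> = cls (\<lambda>\<xi>. wt s \<xi> * fourier (tst x \<delta>) (- \<xi>))" for x \<delta>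
  \<comment> \<open>Parseval's constant; it meets the factor (2 pi)^(-d) in
    \<open>frac_lap_pair\<close> and cancels it.\<close>
  define c where "c = complex_of_real (FT_const TYPE('a))"
  have c: "c \<noteq> 0" by (simp add: c_def)
  have E_eq: "bp (mul (wt (- s)) (FF z)) (E x \<delta>) = c * bp z (cls (tst x \<delta>))" if d: "\<delta> > 0" for x \<delta> and z :: "'a l2"
  proof -
    have "bp (mul (wt (- s)) (FF z)) (E x \<delta>) = bp (FF z) (cls (\<lambda>\<xi>. wt (- s) \<xi> * (wt s \<xi> * fourier (tst x \<delta>) (- \<xi>))))"
      unfolding E_def by (rule bp_mul_cls[OF bws L2_wt_tst[OF d]])
    also have "(\<lambda>\<xi>. wt (- s) \<xi> * (wt s \<xi> * fourier (tst x \<delta>) (- \<xi>))) = (\<lambda>\<xi>. fourier (tst x \<delta>) (- \<xi>))"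
      by (simp add: wt_mult flip: mult.assoc)
    also have "bp (FF z) (cls (\<lambda>\<xi>. fourier (tst x \<delta>) (- \<xi>))) = c * bp z (cls (tst x \<delta>))"
      unfolding c_def by (rule bp_parseval[OF test_fun_L2[OF tst_test[OF d]], symmetric])
    finally show ?thesis .
  qed
  have derY: "(Y has_vector_derivative Z t) (at t within {0..T})" if t: "t \<in> {0..T}" for t
  proof (rule weak_derivative_strong[where D="{(\<lambda>z. bp z (E x \<delta>)) | x \<delta>. \<delta> > 0}", OF contZ _ _ _ t])
    show "bounded_linear L" if "L \<in> {(\<lambda>z. bp z (E x \<delta>)) | x \<delta>. \<delta> > 0}" for L
      using that by (auto intro: bounded_linear_bp)
    show "z = 0" if "\<And>L. L \<in> {(\<lambda>z. bp z (E x \<delta>)) | x \<delta>. \<delta> > 0} \<Longrightarrow> L z = 0" for z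
    proof (rule weighted_total[where r=s])
      fix x :: 'a and \<delta> :: real assume "\<delta> > 0"
      then show "bp z (cls (\<lambda>\<xi>. wt s \<xi> * fourier (tst x \<delta>) (- \<xi>))) = 0"
        using that[of "\<lambda>z. bp z (E x \<delta>)"] by (auto simp: E_def)
    qed
    fix L t assume "L \<in> {(\<lambda>z. bp z (E x \<delta>)) | x \<delta>. \<delta> > 0}" and t: "t \<in> {0..T}"
    then obtain x \<delta> where L: "L = (\<lambda>z. bp z (E x \<delta>))" and d: "\<delta> > 0" by auto
    define \<phi> where "\<phi> = tst x \<delta>"
    have tphi: "test_fun \<phi>" unfolding \<phi>_def by (rule tst_test[OF d])
    note Lphi = test_fun_L2[OF tphi]
    have "((\<lambda>\<tau>. \<integral>y. u \<tau> y * \<phi> y \<partial>lborel) has_vector_derivative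
        (- \<i>) * (frac_lap_pair s (u t) \<phi> + (\<integral>y. (complex_of_real (V y) * u t y
                    + complex_of_real (g y * (cmod (u t y))\<^sup>2) * u t y) * \<phi> y \<partial>lborel))) (at t within {0..T})"
      using sol tphi t by (auto simp: nls_solution_def)
    from bounded_linear.has_vector_derivative[OF bounded_linear_mult_right this, of c]
    have der: "((\<lambda>\<tau>. c * (\<integral>y. u \<tau> y * \<phi> y \<partial>lborel)) has_vector_derivative
        c * ((- \<i>) * (frac_lap_pair s (u t) \<phi> + (\<integral>y. (complex_of_real (V y) * u t y
                    + complex_of_real (g y * (cmod (u t y))\<^sup>2) * u t y) * \<phi> y \<partial>lborel)))) (at t within {0..T})" .
    have 1: "L (Y \<tau>) = c * (\<integral>y. u \<tau> y * \<phi> y \<partial>lborel)" if "\<tau> \<in> {0..T}" for \<tau>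
      unfolding L Y_def E_eq[OF d] X_def \<phi>_def[symmetric] using bp_cls[OF Lu[OF that] Lphi(1)] by simp
    have NLt: "N t = cls (\<lambda>y. complex_of_real (V y) * u t y + complex_of_real (g y * (cmod (u t y))\<^sup>2) * u t y)"
      "L2 (\<lambda>y. complex_of_real (V y) * u t y + complex_of_real (g y * (cmod (u t y))\<^sup>2) * u t y)"
      unfolding N_def X_def using NL_cls[OF V g Lu[OF t] K[OF t, unfolded X_def]] by auto
    have 2: "bp (mul (wt (- s)) (FF (N t))) (E x \<delta>) = c * (\<integral>y. (complex_of_real (V y) * u t y
                    + complex_of_real (g y * (cmod (u t y))\<^sup>2) * u t y) * \<phi> y \<partial>lborel)"
      unfolding E_eq[OF d] \<phi>_def[symmetric] NLt(1) bp_cls[OF NLt(2) Lphi(1)] ..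
    have 3: "bp (mul m3 (H t)) (E x \<delta>) = c * frac_lap_pair s (u t) \<phi>"
    proof -
      have "bp (mul m3 (H t)) (E x \<delta>) = bp (H t) (cls (\<lambda>\<xi>. m3 \<xi> * (wt s \<xi> * fourier \<phi> (- \<xi>))))"
        unfolding E_def \<phi>_def by (rule bp_mul_cls[OF bm3 L2_wt_tst[OF d]])
      also have "\<dots> = (\<integral>\<xi>. (wt (s / 2) \<xi> * FT (u t) \<xi>) * (m3 \<xi> * (wt s \<xi> * fourier \<phi> (- \<xi>))) \<partial>lborel)"
        unfolding H_def HH_def \<phi>_def
        by (rule bp_cls[OF in_Hs_D(2)[OF inHs[OF t]] L2_bmeas_mult[OF bm3 L2_wt_tst[OF d]]])
      also have "\<dots> = (\<integral>\<xi>. complex_of_real (norm \<xi> powr (2 * s)) * FT (u t) \<xi> * fourier \<phi> (- \<xi>) \<partial>lborel)"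
      proof (rule Bochner_Integration.integral_cong[OF refl])
        fix \<xi> :: 'a
        have "wt (- 3 * s / 2) \<xi> * (wt (s / 2) \<xi> * wt s \<xi>) = 1" unfolding wt_mult by simp
        then show "(wt (s / 2) \<xi> * FT (u t) \<xi>) * (m3 \<xi> * (wt s \<xi> * fourier \<phi> (- \<xi>)))
          = complex_of_real (norm \<xi> powr (2 * s)) * FT (u t) \<xi> * fourier \<phi> (- \<xi>)"
          unfolding m3_def lap_def by algebra
      qed
      also have "\<dots> = c * frac_lap_pair s (u t) \<phi>"
      proof -
        have "c * complex_of_real ((2 * pi) powr (- real DIM('a))) = complex_of_real ((2 * pi) ^ DIM('a) * (2 * pi) powr (- real DIM('a)))"
          by (simp add: c_def FT_const_def)
        also have "(2 * pi) ^ DIM('a) * (2 * pi) powr (- real DIM('a)) = 1"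
          by (subst powr_realpow[symmetric]) (auto simp flip: powr_add)
        finally show ?thesis unfolding frac_lap_pair_def by (simp only: mult.assoc[symmetric]) simp
      qed
      finally show ?thesis .
    qed
    have 4: "L (Z t) = c * ((- \<i>) * (frac_lap_pair s (u t) \<phi> + (\<integral>y. (complex_of_real (V y) * u t y
                    + complex_of_real (g y * (cmod (u t y))\<^sup>2) * u t y) * \<phi> y \<partial>lborel)))"
      unfolding L Z_def bp_cmult linear_add[OF bounded_linear.linear[OF bounded_linear_bp]] 2 3
      by (simp add: algebra_simps)
    show "((\<lambda>t. L (Y t)) has_vector_derivative L (Z t)) (at t within {0..T})"
      unfolding 4 by (rule has_vector_derivative_transform[OF t _ der]) (rule 1)
  qed
  have "((\<lambda>t. mul (trunc M) (FF (X t))) has_vector_derivative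
        mul (\<lambda>_. - \<i>) (mul (\<lambda>\<xi>. trunc M \<xi> * lap s \<xi>) (FF (X t)) + mul (trunc M) (FF (NL V g (X t)))))
       (at t within {0..T})" if t: "t \<in> {0..T}" for M t
  proof -
    \<comment> \<open>Undoes the weight of \<open>Y\<close> on bounded frequencies, where its
      inverse is bounded.\<close>
    define m where "m \<xi> = trunc M \<xi> * wt s \<xi>" for \<xi> :: 'a
    have bm: "bmeas m" unfolding m_def[abs_def] by (rule bmeas_trunc_wt[OF s0])
    have bm2: "bmeas (wt (- s / 2) :: 'a \<Rightarrow> complex)" by (rule bmeas_wt) (use s0 in auto)
    have m1: "(\<lambda>\<xi>. m \<xi> * wt (- s) \<xi>) = trunc M"
      by (rule ext) (simp add: m_def wt_mult mult.assoc)
    have m2: "(\<lambda>\<xi>. m \<xi> * m3 \<xi>) = (\<lambda>\<xi>. (trunc M \<xi> * lap s \<xi>) * wt (- s / 2) \<xi>)"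
    proof
      fix \<xi> :: 'a
      have "wt s \<xi> * wt (- 3 * s / 2) \<xi> = wt (- s / 2) \<xi>" unfolding wt_mult by simp
      moreover have "m \<xi> * m3 \<xi> = (trunc M \<xi> * lap s \<xi>) * (wt s \<xi> * wt (- 3 * s / 2) \<xi>)"
        unfolding m_def m3_def by (simp only: mult_ac)
      ultimately show "m \<xi> * m3 \<xi> = (trunc M \<xi> * lap s \<xi>) * wt (- s / 2) \<xi>" by simp
    qed
    have "((\<lambda>t. mul m (Y t)) has_vector_derivative mul m (Z t)) (at t within {0..T})"
      by (rule bounded_linear.has_vector_derivative[OF bounded_linear_mul derY[OF t]])
    moreover have "mul m (Y t) = mul (trunc M) (FF (X t))" for t
      unfolding Y_def mul_mul[OF bm bws] m1 ..
    moreover have "mul m (Z t) = mul (\<lambda>_. - \<i>) (mul (\<lambda>\<xi>. trunc M \<xi> * lap s \<xi>) (FF (X t)) + mul (trunc M) (FF (NL V g (X t))))"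
    proof -
      have "mul m (Z t) = mul (\<lambda>_. - \<i>) (mul m (mul m3 (H t) + mul (wt (- s)) (FF (N t))))"
        unfolding Z_def by (simp add: mul_mul bm mult.commute)
      also have "mul m (mul m3 (H t) + mul (wt (- s)) (FF (N t)))
        = mul (\<lambda>\<xi>. trunc M \<xi> * lap s \<xi>) (FF (X t)) + mul (trunc M) (FF (NL V g (X t)))"
        unfolding mul_add mul_mul[OF bm bm3] mul_mul[OF bm bws] m1 m2 FX[OF t]
          mul_mul[OF bmeas_trunc_lap[OF s0] bm2] N_def ..
      finally show ?thesis .
    qed
    ultimately show ?thesis by simp
  qed
  then show ?thesis
    unfolding l2sol_def using contH FX by (simp add: X_def H_def)
qed

end

section \<open>Conservation laws\<close>

lemma mul_uminus_fun: assumes "bmeas m" shows "mul (\<lambda>t. - m t) x = - mul m x"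
  using mul_mul[OF bmeas_const[of "complex_of_real (- 1)"] assms, of x]
  by (simp only: mul_of_real_const) simp

text \<open>Multiplication by an imaginary symbol is skew-adjoint. This removes the dispersive term
  from the mass balance and the square term from the energy balance.\<close>

lemma inner_mul_imaginary:
  assumes m: "bmeas m" and im: "\<And>t. cnj (m t) = - m t"
  shows "inner x (mul m x) = 0"
proof -
  have "inner x (mul m x) = inner (mul m x) x" by (rule inner_commute)
  also have "\<dots> = - inner x (mul m x)"
    unfolding inner_mul[OF m] im mul_uminus_fun[OF m] by simp
  finally show ?thesis by simp
qed

lemma norm_mul_trunc: "norm (mul (trunc M) x) \<le> norm x"
proof -
  have "norm (mul (trunc M) x) \<le> 1 * norm x" by (rule norm_mul_le) (rule trunc_bounded)
  then show ?thesis by simp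
qed

text \<open>Truncations are contractions converging strongly, so on a totally bounded set
  convergence needs checking only on a finite e/3-net.\<close>

lemma trunc_uniform:
  fixes f :: "real \<Rightarrow> 'a::euclidean_space l2"
  assumes f: "continuous_on {0..T} f" and e: "e > 0"
  shows "eventually (\<lambda>M. \<forall>t\<in>{0..T}. norm (mul (trunc M) (f t) - f t) < e) sequentially"
proof -
  have "compact (f ` {0..T})" by (intro compact_continuous_image f) auto
  then have "\<exists>k. finite k \<and> f ` {0..T} \<subseteq> (\<Union>x\<in>k. ball x (e/3))"
    using e unfolding compact_eq_totally_bounded by simp
  then obtain k where k: "finite k" "f ` {0..T} \<subseteq> (\<Union>x\<in>k. ball x (e/3))" by blast
  have "eventually (\<lambda>M. \<forall>x\<in>k. norm (mul (trunc M) x - x) < e/3) sequentially"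
  proof (rule eventually_ball_finite[OF k(1)], rule ballI)
    fix x
    show "eventually (\<lambda>M. norm (mul (trunc M) x - x) < e/3) sequentially"
      using tendstoD[OF mul_trunc_tendsto[of x], of "e/3"] e by (simp add: dist_norm)
  qed
  then show ?thesis
  proof eventually_elim
    case (elim M)
    show ?case
    proof
      fix t assume "t \<in> {0..T}"
      then obtain x where x: "x \<in> k" "dist x (f t) < e/3" using k(2) by fastforce
      have "mul (trunc M) (f t) - f t = mul (trunc M) (f t - x) + (mul (trunc M) x - x) + (x - f t)"
        by (simp add: mul_diff)
      also have "norm \<dots> \<le> norm (mul (trunc M) (f t - x)) + norm (mul (trunc M) x - x) + norm (x - f t)"
        by (intro norm_triangle_le add_right_mono norm_triangle_ineq)
      also have "\<dots> < e/3 + e/3 + e/3"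
      proof -
        have "norm (x - f t) < e/3" using x(2) by (simp add: dist_norm)
        moreover have "norm (mul (trunc M) (f t - x)) \<le> norm (x - f t)"
          using norm_mul_trunc[of M "f t - x"] by (simp add: norm_minus_commute)
        moreover have "norm (mul (trunc M) x - x) < e/3" using elim x(1) by blast
        ultimately show ?thesis by linarith
      qed
      finally show "norm (mul (trunc M) (f t) - f t) < e" by simp
    qed
  qed
qed

lemma within_mono_bound:
  fixes G G' :: "real \<Rightarrow> real"
  assumes d: "\<And>t. t \<in> {0..T} \<Longrightarrow> (G has_vector_derivative G' t) (at t within {0..T})"
    and b: "\<And>t. t \<in> {0..T} \<Longrightarrow> G' t \<le> c" and t: "t \<in> {0..T}"
  shows "G t - G 0 \<le> c * t"
proof -
  have "\<exists>x\<in>{0..t}. G t - G 0 = (t - 0) *\<^sub>R G' x"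
  proof (rule mvt_very_simple)
    fix x assume "0 \<le> x" "x \<le> t"
    then show "(G has_derivative (\<lambda>h. h *\<^sub>R G' x)) (at x within {0..t})"
      using d[of x] t unfolding has_vector_derivative_def by (auto intro: has_derivative_subset)
  qed (use t in auto)
  then obtain x where x: "x \<in> {0..t}" "G t - G 0 = t * G' x" by auto
  have "t * G' x \<le> t * c" using b[of x] x(1) t by (intro mult_left_mono) auto
  then show ?thesis using x by (simp add: mult.commute)
qed

text \<open>The dispersive multiplier is imaginary and drops out. In the other term the projection
  is self-adjoint and idempotent, so it moves onto \<open>Y\<close>; \<open>F\<close> stays
  untruncated, as in the hypothesis of the Gronwall lemma.\<close>

lemma mass_derivative:
  fixes Y F :: "real \<Rightarrow> 'a::euclidean_space l2"
  assumes s: "s \<ge> 0" and d: "((\<lambda>t. mul (trunc M) (Y t)) has_vector_derivative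
        mul (\<lambda>_. - \<i>) (mul (\<lambda>\<xi>. trunc M \<xi> * lap s \<xi>) (Y t) + mul (trunc M) (F t))) (at t within S)"
  shows "((\<lambda>t. (norm (mul (trunc M) (Y t)))\<^sup>2) has_vector_derivative
        2 * inner (mul (trunc M) (Y t)) (mul (\<lambda>_. - \<i>) (F t))) (at t within S)"
proof -
  let ?P = "mul (trunc M)" and ?D = "mul (\<lambda>_. - \<i>) (mul (\<lambda>\<xi>. trunc M \<xi> * lap s \<xi>) (Y t) + mul (trunc M) (F t))"
  have bl: "bmeas (\<lambda>\<xi>. trunc M \<xi> * lap s \<xi>)" by (rule bmeas_trunc_lap[OF s])
  have "((\<lambda>t. inner (?P (Y t)) (?P (Y t))) has_derivative
      (\<lambda>h. inner (?P (Y t)) (h *\<^sub>R ?D) + inner (h *\<^sub>R ?D) (?P (Y t)))) (at t within S)"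
    using d unfolding has_vector_derivative_def by (intro has_derivative_inner)
  then have 1: "((\<lambda>t. (norm (?P (Y t)))\<^sup>2) has_vector_derivative 2 * inner (?P (Y t)) ?D) (at t within S)"
    unfolding has_vector_derivative_def power2_norm_eq_inner
    by (rule has_derivative_eq_rhs) (auto simp: inner_commute algebra_simps)
  have 2: "mul (\<lambda>_. - \<i>) (mul (\<lambda>\<xi>. trunc M \<xi> * lap s \<xi>) (Y t)) = mul (\<lambda>\<xi>. - \<i> * (trunc M \<xi> * lap s \<xi>)) (?P (Y t))"
    unfolding mul_mul[OF bmeas_const bl] mul_mul[OF bmeas_mult[OF bmeas_const bl] bmeas_trunc]
    by (rule arg_cong[of _ _ "\<lambda>m. mul m (Y t)"]) (auto simp: trunc_def)
  have 3: "inner (?P (Y t)) (mul (\<lambda>\<xi>. - \<i> * (trunc M \<xi> * lap s \<xi>)) (?P (Y t))) = 0"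
    by (rule inner_mul_imaginary[OF bmeas_mult[OF bmeas_const bl]]) (simp add: trunc_def lap_def)
  have 4: "inner (?P (Y t)) (mul (\<lambda>_. - \<i>) (?P (F t))) = inner (?P (Y t)) (mul (\<lambda>_. - \<i>) (F t))"
  proof -
    have "mul (\<lambda>_. - \<i>) (?P (F t)) = ?P (mul (\<lambda>_. - \<i>) (F t))"
      unfolding mul_mul[OF bmeas_const bmeas_trunc] mul_mul[OF bmeas_trunc bmeas_const] by (simp add: mult.commute)
    also have "inner (?P (Y t)) \<dots> = inner (mul (\<lambda>\<xi>. cnj (trunc M \<xi>)) (?P (Y t))) (mul (\<lambda>_. - \<i>) (F t))"
      by (subst inner_mul[OF bmeas_cnj[OF bmeas_trunc]]) simp
    also have "mul (\<lambda>\<xi>. cnj (trunc M \<xi>)) (?P (Y t)) = ?P (Y t)"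
      unfolding mul_mul[OF bmeas_cnj[OF bmeas_trunc] bmeas_trunc]
      by (rule arg_cong[of _ _ "\<lambda>m. mul m (Y t)"]) (auto simp: trunc_def)
    finally show ?thesis .
  qed
  have "inner (?P (Y t)) ?D = inner (?P (Y t)) (mul (\<lambda>_. - \<i>) (F t))"
    unfolding mul_add inner_add_right 2 3 4 by simp
  with 1 show ?thesis by simp
qed

text \<open>Gronwall's inequality for the truncated masses, with the truncation removed in the limit; the
  truncation errors are uniform in time because the curves have compact range.\<close>

lemma mass_gronwall:
  fixes Y F :: "real \<Rightarrow> 'a::euclidean_space l2"
  assumes s: "s \<ge> 0" and Y: "continuous_on {0..T} Y" and F: "continuous_on {0..T} F"
    and d: "\<And>M t. t \<in> {0..T} \<Longrightarrow> ((\<lambda>t. mul (trunc M) (Y t)) has_vector_derivative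
        mul (\<lambda>_. - \<i>) (mul (\<lambda>\<xi>. trunc M \<xi> * lap s \<xi>) (Y t) + mul (trunc M) (F t))) (at t within {0..T})"
    and k: "k \<ge> 0" and e: "e \<ge> 0"
    and le: "\<And>t. t \<in> {0..T} \<Longrightarrow> 2 * inner (Y t) (mul (\<lambda>_. - \<i>) (F t)) \<le> k * (norm (Y t))\<^sup>2 + e"
    and t: "t \<in> {0..T}"
  shows "(norm (Y t))\<^sup>2 \<le> exp (k * T) * ((norm (Y 0))\<^sup>2 + e * T)"
proof -
  have bnd: "\<exists>B>0. \<forall>t\<in>{0..T}. norm (f t) \<le> B" if "continuous_on {0..T} f" for f :: "real \<Rightarrow> 'a l2"
  proof -
    have "bounded (f ` {0..T})" by (intro compact_imp_bounded compact_continuous_image that) auto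
    then show ?thesis by (auto simp: bounded_pos)
  qed
  obtain A where A: "A > 0" "\<And>t. t \<in> {0..T} \<Longrightarrow> norm (Y t) \<le> A" using bnd[OF Y] by blast
  obtain B where B: "B > 0" "\<And>t. t \<in> {0..T} \<Longrightarrow> norm (F t) \<le> B" using bnd[OF F] by blast
  have T0: "T \<ge> 0" using t by simp
  have ev: "\<forall>\<^sub>F M in sequentially. (norm (mul (trunc M) (Y t)))\<^sup>2 \<le> exp (k * T) * ((norm (Y 0))\<^sup>2 + (e + \<eta>) * T)" if eta: "\<eta> > 0" for \<eta>
  proof -
    \<comment> \<open>The two truncation errors, 2 \<delta> B from the source and 2 k \<delta> A
      from the quadratic term, add up to \<eta>. Strict positivity of B covers k = 0.\<close>
    define \<delta> where "\<delta> = \<eta> / (2 * B + 2 * k * A)"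
    have den: "2 * B + 2 * k * A > 0" using A(1) B(1) k by (intro add_pos_nonneg) auto
    have delta: "\<delta> > 0" using eta den by (simp add: \<delta>_def)
    show ?thesis
      using trunc_uniform[OF Y delta]
    proof eventually_elim
      case (elim M)
      define y where "y t = (norm (mul (trunc M) (Y t)))\<^sup>2" for t
      define y' where "y' t = 2 * inner (mul (trunc M) (Y t)) (mul (\<lambda>_. - \<i>) (F t))" for t
      have P1: "norm (mul (trunc M) x) \<le> norm x" for x :: "'a l2"
        by (rule norm_mul_trunc)
      have dy: "(y has_vector_derivative y' t) (at t within {0..T})" if "t \<in> {0..T}" for t
        unfolding y_def y'_def by (rule mass_derivative[where M=M and Y=Y and F=F, OF s d[OF that]])
      have yb: "y' t - k * y t \<le> e + \<eta>" if t: "t \<in> {0..T}" for t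
      proof -
        have m: "norm (mul (trunc M) (Y t) - Y t) \<le> \<delta>" using elim t by (auto intro: less_imp_le)
        have "y' t = 2 * inner (Y t) (mul (\<lambda>_. - \<i>) (F t)) + 2 * inner (mul (trunc M) (Y t) - Y t) (mul (\<lambda>_. - \<i>) (F t))"
          unfolding y'_def by (simp add: inner_diff_left)
        moreover have "inner (mul (trunc M) (Y t) - Y t) (mul (\<lambda>_. - \<i>) (F t)) \<le> \<delta> * B"
        proof -
          have "norm (mul (\<lambda>_. - \<i>) (F t)) \<le> B" using norm_mul_le[of "\<lambda>_. - \<i>" 1 "F t"] B(2)[OF t] by simp
          with m delta show ?thesis
            by (intro order_trans[OF norm_cauchy_schwarz] mult_mono) auto
        qed
        moreover have "(norm (Y t))\<^sup>2 - y t \<le> \<delta> * (2 * A)"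
        proof -
          have "(norm (Y t))\<^sup>2 - y t = (norm (Y t) - norm (mul (trunc M) (Y t))) * (norm (Y t) + norm (mul (trunc M) (Y t)))"
            unfolding y_def by (simp add: power2_eq_square algebra_simps)
          also have "\<dots> \<le> \<delta> * (2 * A)"
          proof (rule mult_mono)
            show "norm (Y t) - norm (mul (trunc M) (Y t)) \<le> \<delta>"
              using norm_triangle_ineq2[of "Y t" "mul (trunc M) (Y t)"] m by (simp add: norm_minus_commute)
            show "norm (Y t) + norm (mul (trunc M) (Y t)) \<le> 2 * A" using P1[of "Y t"] A(2)[OF t] by simp
          qed (use delta in auto)
          finally show ?thesis .
        qed
        then have "k * ((norm (Y t))\<^sup>2 - y t) \<le> k * (\<delta> * (2 * A))" using k by (rule mult_left_mono)
        moreover have "2 * (\<delta> * B) + k * (\<delta> * (2 * A)) = \<eta>"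
        proof -
          have "2 * (\<delta> * B) + k * (\<delta> * (2 * A)) = \<delta> * (2 * B + 2 * k * A)" by (simp add: algebra_simps)
          then show ?thesis using den by (simp add: \<delta>_def)
        qed
        ultimately show ?thesis using le[OF t] by (simp add: algebra_simps)
      qed
      \<comment> \<open>Integrating factor: the differential inequality for \<open>y\<close> becomes
        an upper bound for the derivative of \<open>G\<close>.\<close>
      define G where "G t = exp (- k * t) * y t" for t
      have "(G has_vector_derivative (exp (- k * t) * (y' t - k * y t))) (at t within {0..T})" if "t \<in> {0..T}" for t
      proof -
        have "(y has_real_derivative y' t) (at t within {0..T})"
          using dy[OF that] by (simp add: has_real_derivative_iff_has_vector_derivative)
        then have "(G has_real_derivative (exp (- k * t) * (y' t - k * y t))) (at t within {0..T})"
          unfolding G_def by (auto intro!: derivative_eq_intros simp: algebra_simps)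
        then show ?thesis by (simp add: has_real_derivative_iff_has_vector_derivative)
      qed
      moreover have "exp (- k * t) * (y' t - k * y t) \<le> e + \<eta>" if t: "t \<in> {0..T}" for t
      proof -
        have "exp (- k * t) * (y' t - k * y t) \<le> exp (- k * t) * (e + \<eta>)"
          by (rule mult_left_mono[OF yb[OF t]]) simp
        also have "\<dots> \<le> 1 * (e + \<eta>)"
          by (rule mult_right_mono) (use k t e eta in auto)
        finally show ?thesis by simp
      qed
      ultimately have "G t - G 0 \<le> (e + \<eta>) * t" by (rule within_mono_bound) (use t in auto)
      moreover have "(e + \<eta>) * t \<le> (e + \<eta>) * T" using t e eta by (intro mult_left_mono) auto
      moreover have "G 0 \<le> (norm (Y 0))\<^sup>2" unfolding G_def y_def using P1[of "Y 0"] by (simp add: power_mono)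
      ultimately have "exp (- k * t) * y t \<le> (norm (Y 0))\<^sup>2 + (e + \<eta>) * T" unfolding G_def by linarith
      then have "exp (k * t) * (exp (- k * t) * y t) \<le> exp (k * t) * ((norm (Y 0))\<^sup>2 + (e + \<eta>) * T)"
        by (rule mult_left_mono) simp
      moreover have "exp (k * t) * (exp (- k * t) * y t) = y t" by (simp add: exp_minus)
      moreover have "exp (k * t) * ((norm (Y 0))\<^sup>2 + (e + \<eta>) * T) \<le> exp (k * T) * ((norm (Y 0))\<^sup>2 + (e + \<eta>) * T)"
        using t k e eta T0 by (intro mult_right_mono) (auto intro: mult_left_mono)
      ultimately show ?case unfolding y_def by linarith
    qed
  qed
  \<comment> \<open>The order of limits matters: M tends to infinity at fixed \<eta>, since the
    admissible M depend on \<eta>, and only then \<eta> tends to 0.\<close>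
  have 1: "(norm (Y t))\<^sup>2 \<le> exp (k * T) * ((norm (Y 0))\<^sup>2 + (e + \<eta>) * T)" if "\<eta> > 0" for \<eta>
    by (rule tendsto_upperbound[OF _ ev[OF that]]) (intro tendsto_intros mul_trunc_tendsto, simp)
  show ?thesis
  proof (rule tendsto_lowerbound)
    show "((\<lambda>\<eta>. exp (k * T) * ((norm (Y 0))\<^sup>2 + (e + \<eta>) * T)) \<longlongrightarrow> exp (k * T) * ((norm (Y 0))\<^sup>2 + e * T)) (at_right 0)"
      by (auto intro!: tendsto_eq_intros)
    show "\<forall>\<^sub>F \<eta> in at_right 0. (norm (Y t))\<^sup>2 \<le> exp (k * T) * ((norm (Y 0))\<^sup>2 + (e + \<eta>) * T)"
      using eventually_at_right_less[of 0] by eventually_elim (rule 1)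
  qed simp
qed

section \<open>Potential energy and its derivative along curves\<close>

text \<open>The factors 1/2 and 1/4 make \<open>NL V g\<close> its gradient for the real inner
  product.\<close>

definition pot :: "('a::euclidean_space \<Rightarrow> real) \<Rightarrow> ('a \<Rightarrow> real) \<Rightarrow> 'a l2 \<Rightarrow> real" where
  "pot V g x = (\<integral>t. V t / 2 * (cmod (rep x t))\<^sup>2 + g t / 4 * (cmod (rep x t)) ^ 4 \<partial>lborel)"

text \<open>With q = p + w, everything is a polynomial in |p|^2, |w|^2 and r = Re (p cnj w). Beyond
  the part linear in r, the quartic leaves g times |p|^2 |w|^2 / 2 + (|q|^2 - |p|^2)^2 / 4; since |
  |q|^2 - |p|^2 | is at most 2K |w|, the sum is bounded by (1/2 + 1) K^2 |w|^2.\<close>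

lemma quartic_expansion:
  fixes p q :: complex
  assumes p: "cmod p \<le> K" and q: "cmod q \<le> K" and V: "\<bar>V\<bar> \<le> a" and g: "\<bar>g\<bar> \<le> b"
  shows "\<bar>(V / 2 * (cmod q)\<^sup>2 + g / 4 * (cmod q) ^ 4) - (V / 2 * (cmod p)\<^sup>2 + g / 4 * (cmod p) ^ 4)
      - Re ((complex_of_real V * p + complex_of_real (g * (cmod p)\<^sup>2) * p) * cnj (q - p))\<bar> \<le> (a / 2 + 3 / 2 * b * K\<^sup>2) * (cmod (q - p))\<^sup>2"
proof -
  define w where "w = q - p"
  define r where "r = Re (p * cnj w)"
  have K: "K \<ge> 0" using order_trans[OF norm_ge_zero p] .
  have q2: "(cmod q)\<^sup>2 = (cmod p)\<^sup>2 + 2 * r + (cmod w)\<^sup>2"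
    by (simp only: w_def r_def cmod_power2) (simp add: power2_eq_square algebra_simps)
  have re: "Re ((complex_of_real V * p + complex_of_real (g * (cmod p)\<^sup>2) * p) * cnj w) = (V + g * (cmod p)\<^sup>2) * r"
    by (simp add: r_def algebra_simps)
  have p4: "z ^ 4 = (z\<^sup>2)\<^sup>2" for z :: real by simp
  have eq: "(V / 2 * (cmod q)\<^sup>2 + g / 4 * (cmod q) ^ 4) - (V / 2 * (cmod p)\<^sup>2 + g / 4 * (cmod p) ^ 4) - (V + g * (cmod p)\<^sup>2) * r
    = V / 2 * (cmod w)\<^sup>2 + g * ((cmod p)\<^sup>2 * (cmod w)\<^sup>2 / 2 + (2 * r + (cmod w)\<^sup>2)\<^sup>2 / 4)"
    unfolding p4 q2 by (simp add: power2_eq_square field_simps)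
  have "\<bar>cmod q - cmod p\<bar> \<le> cmod w" unfolding w_def by (rule norm_triangle_ineq3)
  moreover have "2 * r + (cmod w)\<^sup>2 = (cmod q - cmod p) * (cmod q + cmod p)"
    using q2 by (simp add: power2_eq_square algebra_simps)
  then have "\<bar>2 * r + (cmod w)\<^sup>2\<bar> = \<bar>cmod q - cmod p\<bar> * \<bar>cmod q + cmod p\<bar>"
    by (simp only: abs_mult)
  ultimately have "\<bar>2 * r + (cmod w)\<^sup>2\<bar> \<le> cmod w * (2 * K)"
    using p q K by (auto intro!: mult_mono)
  then have "(\<bar>2 * r + (cmod w)\<^sup>2\<bar>)\<^sup>2 \<le> (cmod w * (2 * K))\<^sup>2" by (rule power_mono) simp
  then have 1: "(2 * r + (cmod w)\<^sup>2)\<^sup>2 / 4 \<le> K\<^sup>2 * (cmod w)\<^sup>2" by (simp add: power_mult_distrib mult_ac)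
  have 2: "(cmod p)\<^sup>2 * (cmod w)\<^sup>2 / 2 \<le> K\<^sup>2 * (cmod w)\<^sup>2 / 2"
    using p by (intro divide_right_mono mult_right_mono power_mono) auto
  define S where "S = (cmod p)\<^sup>2 * (cmod w)\<^sup>2 / 2 + (2 * r + (cmod w)\<^sup>2)\<^sup>2 / 4"
  have S: "0 \<le> S" "S \<le> 3 / 2 * K\<^sup>2 * (cmod w)\<^sup>2" using 1 2 by (auto simp: S_def)
  have "\<bar>g * S\<bar> \<le> b * (3 / 2 * K\<^sup>2 * (cmod w)\<^sup>2)"
    unfolding abs_mult using S g by (intro mult_mono) auto
  moreover have "\<bar>V / 2 * (cmod w)\<^sup>2\<bar> \<le> a / 2 * (cmod w)\<^sup>2"
    unfolding abs_mult using V by (auto intro!: mult_right_mono)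
  ultimately have "\<bar>V / 2 * (cmod w)\<^sup>2 + g * S\<bar> \<le> a / 2 * (cmod w)\<^sup>2 + b * (3 / 2 * K\<^sup>2 * (cmod w)\<^sup>2)"
    by linarith
  then show ?thesis
    unfolding w_def[symmetric] re eq S_def[symmetric] by (simp add: algebra_simps)
qed

lemma pot_integrable:
  assumes V: "ess_bdr a V" and g: "ess_bdr b g" and x: "ess_bd K x"
  shows "integrable lborel (\<lambda>t. V t / 2 * (cmod (rep x t))\<^sup>2 + g t / 4 * (cmod (rep x t)) ^ 4)"
    and "\<bar>pot V g x\<bar> \<le> (a / 2 + b * K\<^sup>2 / 4) * (norm x)\<^sup>2"
proof -
  have [measurable]: "V \<in> borel_measurable borel" "g \<in> borel_measurable borel"
    using V g by (simp_all add: ess_bdr_def)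
  have b0: "b \<ge> 0" using g by (simp add: ess_bdr_def)
  have ae: "AE t in lborel. \<bar>V t / 2 * (cmod (rep x t))\<^sup>2 + g t / 4 * (cmod (rep x t)) ^ 4\<bar> \<le> (a / 2 + b * K\<^sup>2 / 4) * (cmod (rep x t))\<^sup>2"
    using V[unfolded ess_bdr_def, THEN conjunct2, THEN conjunct2] g[unfolded ess_bdr_def, THEN conjunct2, THEN conjunct2] x[unfolded ess_bd_def]
  proof eventually_elim
    case (elim t)
    have "\<bar>g t\<bar> * (cmod (rep x t))\<^sup>2 \<le> b * K\<^sup>2"
      using elim b0 by (intro mult_mono power_mono) auto
    then have "\<bar>V t / 2 + g t / 4 * (cmod (rep x t))\<^sup>2\<bar> \<le> a / 2 + b * K\<^sup>2 / 4"
      using elim abs_triangle_ineq[of "V t / 2" "g t / 4 * (cmod (rep x t))\<^sup>2"] by (simp add: abs_mult)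
    from mult_right_mono[OF this, of "(cmod (rep x t))\<^sup>2"]
    have "\<bar>(V t / 2 + g t / 4 * (cmod (rep x t))\<^sup>2) * (cmod (rep x t))\<^sup>2\<bar> \<le> (a / 2 + b * K\<^sup>2 / 4) * (cmod (rep x t))\<^sup>2"
      by (simp add: abs_mult)
    moreover have "(V t / 2 + g t / 4 * (cmod (rep x t))\<^sup>2) * (cmod (rep x t))\<^sup>2 = V t / 2 * (cmod (rep x t))\<^sup>2 + g t / 4 * (cmod (rep x t)) ^ 4"
      by (simp add: distrib_right flip: power_add)
    ultimately show ?case by simp
  qed
  have i: "integrable lborel (\<lambda>t. (a / 2 + b * K\<^sup>2 / 4) * (cmod (rep x t))\<^sup>2)"
    by (intro integrable_mult_right L2_integrable_sq L2_rep)
  show ii: "integrable lborel (\<lambda>t. V t / 2 * (cmod (rep x t))\<^sup>2 + g t / 4 * (cmod (rep x t)) ^ 4)"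
  proof (rule Bochner_Integration.integrable_bound[OF i])
    show "AE t in lborel. norm (V t / 2 * (cmod (rep x t))\<^sup>2 + g t / 4 * (cmod (rep x t)) ^ 4) \<le> norm ((a / 2 + b * K\<^sup>2 / 4) * (cmod (rep x t))\<^sup>2)"
      using ae
    proof eventually_elim
      case (elim t)
      show ?case unfolding real_norm_def by (rule order_trans[OF elim abs_ge_self])
    qed
  qed measurable
  have "\<bar>pot V g x\<bar> \<le> (\<integral>t. \<bar>V t / 2 * (cmod (rep x t))\<^sup>2 + g t / 4 * (cmod (rep x t)) ^ 4\<bar> \<partial>lborel)"
    unfolding pot_def by (rule integral_abs_bound)
  also have "\<dots> \<le> (\<integral>t. (a / 2 + b * K\<^sup>2 / 4) * (cmod (rep x t))\<^sup>2 \<partial>lborel)"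
    by (rule integral_mono_AE[OF integrable_abs[OF ii] i ae])
  also have "\<dots> = (a / 2 + b * K\<^sup>2 / 4) * (norm x)\<^sup>2" by (simp add: norm_l2_sq)
  finally show "\<bar>pot V g x\<bar> \<le> (a / 2 + b * K\<^sup>2 / 4) * (norm x)\<^sup>2" .
qed

lemma pot_expansion:
  assumes V: "ess_bdr a V" and g: "ess_bdr b g" and p: "ess_bd K p" and q: "ess_bd K q"
  shows "\<bar>pot V g q - pot V g p - inner (NL V g p) (q - p)\<bar> \<le> (a / 2 + 3 / 2 * b * K\<^sup>2) * (norm (q - p))\<^sup>2"
proof -
  note ip = pot_integrable(1)[OF V g p] and iq = pot_integrable(1)[OF V g q]
  have inn: "integrable lborel (\<lambda>t. Re (rep (NL V g p) t * cnj (rep (q - p) t)))"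
    by (intro integrable_Re L2_integrable_mult L2_cnj L2_rep)
  have r: "inner (NL V g p) (q - p) = (\<integral>t. Re (rep (NL V g p) t * cnj (rep (q - p) t)) \<partial>lborel)"
    unfolding inner_rep by (rule integral_Re[symmetric, OF L2_integrable_mult[OF L2_rep L2_cnj[OF L2_rep]]])
  have eq: "pot V g q - pot V g p - inner (NL V g p) (q - p) = (\<integral>t. (V t / 2 * (cmod (rep q t))\<^sup>2 + g t / 4 * (cmod (rep q t)) ^ 4)
     - (V t / 2 * (cmod (rep p t))\<^sup>2 + g t / 4 * (cmod (rep p t)) ^ 4) - Re (rep (NL V g p) t * cnj (rep (q - p) t)) \<partial>lborel)"
    unfolding r pot_def
    by (subst Bochner_Integration.integral_diff[OF Bochner_Integration.integrable_diff[OF iq ip] inn],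
        subst Bochner_Integration.integral_diff[OF iq ip]) (rule refl)
  have "\<bar>pot V g q - pot V g p - inner (NL V g p) (q - p)\<bar> \<le> (\<integral>t. \<bar>(V t / 2 * (cmod (rep q t))\<^sup>2 + g t / 4 * (cmod (rep q t)) ^ 4)
     - (V t / 2 * (cmod (rep p t))\<^sup>2 + g t / 4 * (cmod (rep p t)) ^ 4) - Re (rep (NL V g p) t * cnj (rep (q - p) t))\<bar> \<partial>lborel)"
    unfolding eq by (rule integral_abs_bound)
  also have "\<dots> \<le> (\<integral>t. (a / 2 + 3 / 2 * b * K\<^sup>2) * (cmod (rep (q - p) t))\<^sup>2 \<partial>lborel)"
  proof (rule integral_mono_AE)
    show "integrable lborel (\<lambda>t. \<bar>(V t / 2 * (cmod (rep q t))\<^sup>2 + g t / 4 * (cmod (rep q t)) ^ 4)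
     - (V t / 2 * (cmod (rep p t))\<^sup>2 + g t / 4 * (cmod (rep p t)) ^ 4) - Re (rep (NL V g p) t * cnj (rep (q - p) t))\<bar>)"
      by (rule integrable_abs[OF Bochner_Integration.integrable_diff[OF Bochner_Integration.integrable_diff[OF iq ip] inn]])
    show "integrable lborel (\<lambda>t. (a / 2 + 3 / 2 * b * K\<^sup>2) * (cmod (rep (q - p) t))\<^sup>2)"
      by (intro integrable_mult_right L2_integrable_sq L2_rep)
    show "AE t in lborel. \<bar>(V t / 2 * (cmod (rep q t))\<^sup>2 + g t / 4 * (cmod (rep q t)) ^ 4)
     - (V t / 2 * (cmod (rep p t))\<^sup>2 + g t / 4 * (cmod (rep p t)) ^ 4) - Re (rep (NL V g p) t * cnj (rep (q - p) t))\<bar>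
     \<le> (a / 2 + 3 / 2 * b * K\<^sup>2) * (cmod (rep (q - p) t))\<^sup>2"
      using V[unfolded ess_bdr_def, THEN conjunct2, THEN conjunct2] g[unfolded ess_bdr_def, THEN conjunct2, THEN conjunct2]
        p[unfolded ess_bd_def] q[unfolded ess_bd_def] rep_NL[OF V g p] rep_diff[of q p]
    proof eventually_elim
      case (elim t)
      show ?case using quartic_expansion[OF elim(3,4,1,2)] by (simp only: elim(5,6))
    qed
  qed
  also have "\<dots> = (a / 2 + 3 / 2 * b * K\<^sup>2) * (norm (q - p))\<^sup>2" by (simp add: norm_l2_sq)
  finally show ?thesis .
qed

text \<open>The energy is controlled only on essentially bounded sets, so the claim concerns curves
  staying in one. There the error of the linear expansion is at most a multiple of \<open>k\<close>,
  the squared increment of the curve, which has derivative 0 at \<open>t\<close>.\<close>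

lemma pot_derivative:
  fixes p :: "real \<Rightarrow> 'a::euclidean_space l2"
  assumes V: "ess_bdr a V" and g: "ess_bdr b g" and p: "\<And>t. t \<in> S \<Longrightarrow> ess_bd K (p t)"
    and d: "(p has_vector_derivative p') (at t within S)" and t: "t \<in> S"
  shows "((\<lambda>t. pot V g (p t)) has_vector_derivative inner (NL V g (p t)) p') (at t within S)"
proof -
  define C where "C = a / 2 + 3 / 2 * b * K\<^sup>2"
  define F where "F r = pot V g (p r) - inner (NL V g (p t)) (p r - p t)" for r
  define k where "k r = (norm (p r - p t))\<^sup>2" for r
  have dp: "((\<lambda>r. p r - p t) has_derivative (\<lambda>h. h *\<^sub>R p')) (at t within S)"
    using has_derivative_diff[OF d[unfolded has_vector_derivative_def] has_derivative_const] by simp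
  have "(k has_derivative (\<lambda>h. inner (p t - p t) (h *\<^sub>R p') + inner (h *\<^sub>R p') (p t - p t))) (at t within S)"
    unfolding k_def power2_norm_eq_inner by (rule has_derivative_inner[OF dp dp])
  then have "((\<lambda>r. (1 / norm (r - t)) *\<^sub>R (k r - (k t + 0))) \<longlongrightarrow> 0) (at t within S)"
    unfolding has_derivative_within by simp
  then have "((\<lambda>r. C * norm ((1 / norm (r - t)) *\<^sub>R (k r - (k t + 0)))) \<longlongrightarrow> C * norm (0::real)) (at t within S)"
    by (intro tendsto_intros)
  then have lim: "((\<lambda>r. C * norm ((1 / norm (r - t)) *\<^sub>R (k r - (k t + 0)))) \<longlongrightarrow> 0) (at t within S)" by simp
  have "(F has_derivative (\<lambda>h. 0)) (at t within S)"
    unfolding has_derivative_within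
  proof
    show "((\<lambda>r. (1 / norm (r - t)) *\<^sub>R (F r - (F t + 0))) \<longlongrightarrow> 0) (at t within S)"
    proof (rule Lim_null_comparison[OF _ lim], unfold eventually_at_filter, intro always_eventually allI impI)
      fix r assume "r \<in> S"
      have "\<bar>F r - F t\<bar> \<le> C * k r"
        using pot_expansion[OF V g p[OF t] p[OF \<open>r \<in> S\<close>]] by (simp add: F_def C_def k_def)
      moreover have "k t = 0" "k r \<ge> 0" by (simp_all add: k_def)
      ultimately show "norm ((1 / norm (r - t)) *\<^sub>R (F r - (F t + 0))) \<le> C * norm ((1 / norm (r - t)) *\<^sub>R (k r - (k t + 0)))"
        by (simp add: divide_right_mono)
    qed
  qed simp
  moreover have "((\<lambda>r. inner (NL V g (p t)) (p r - p t)) has_derivative (\<lambda>h. inner (NL V g (p t)) (h *\<^sub>R p'))) (at t within S)"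
    by (rule has_derivative_inner_right[OF dp])
  ultimately have "((\<lambda>r. F r + inner (NL V g (p t)) (p r - p t)) has_derivative (\<lambda>h. 0 + inner (NL V g (p t)) (h *\<^sub>R p'))) (at t within S)"
    by (rule has_derivative_add)
  then show ?thesis by (simp add: F_def has_vector_derivative_def)
qed

lemma inner_mul_real:
  assumes "bmeas m" "\<And>t. cnj (m t) = m t" shows "inner x (mul m y) = inner (mul m x) y"
  using inner_mul[OF assms(1), of x y] assms(2) by simp

lemma cnj_trunc [simp]: "cnj (trunc M t) = trunc M t"
  by (simp add: trunc_def)

lemma trunc_idem [simp]: "trunc M t * trunc M t = trunc M t" "trunc M t * (trunc M t * z) = trunc M t * z"
  by (simp_all add: trunc_def)

lemma cnj_lap [simp]: "cnj (lap s t) = lap s t"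
  by (simp add: lap_def)

lemma lap_half: "lap (s / 2) \<xi> * lap (s / 2) \<xi> = lap s \<xi>"
  by (simp add: lap_def flip: powr_add of_real_mult)

text \<open>Gauge invariance: pointwise the nonlinearity is a real multiple of \<open>x\<close>, so
  its multiple by -\<i> is orthogonal to \<open>x\<close>.\<close>

lemma NL_inner_zero:
  assumes "ess_bdr a V" "ess_bdr b g" "ess_bd K x"
  shows "inner x (mul (\<lambda>_. - \<i>) (NL V g x)) = 0"
proof -
  have "(\<integral>t. Re (rep x t * cnj (rep (mul (\<lambda>_. - \<i>) (NL V g x)) t)) \<partial>lborel) = (\<integral>t. (0::real) \<partial>(lborel :: 'a measure))"
  proof (rule integral_cong_AE)
    show "AE t in lborel. Re (rep x t * cnj (rep (mul (\<lambda>_. - \<i>) (NL V g x)) t)) = 0"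
      using rep_mul[OF bmeas_const, of "- \<i>" "NL V g x"] rep_NL[OF assms]
    proof eventually_elim
      case (elim t)
      show ?case unfolding elim by (simp add: algebra_simps)
    qed
  qed measurable
  then show ?thesis
    unfolding inner_rep integral_Re[OF L2_integrable_mult[OF L2_rep L2_cnj[OF L2_rep]], symmetric] by simp
qed

text \<open>Beyond radius M the weight <xi>^(-s) is at most 1/B; inside, |xi|^(2s) <xi>^(-s) is at
  most B. In the product B cancels, and what remains is the tail of \<open>h\<close>, which tends to
  0.\<close>

lemma trunc_tail_bound:
  fixes h :: "'a::euclidean_space l2"
  assumes s: "s \<ge> 0"
  defines "U \<equiv> mul (wt (- s / 2)) h"
  shows "norm (mul (trunc M) U - U) \<le> norm (mul (trunc M) h - h)"
    and "norm (mul (trunc M) U - U) * norm (mul (\<lambda>\<xi>. trunc M \<xi> * lap s \<xi>) U) \<le> norm (mul (trunc M) h - h) * norm h"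
proof -
  define B where "B = (1 + (real M)\<^sup>2) powr (s / 2)"
  have B1: "B \<ge> 1" unfolding B_def by (rule ge_one_powr_ge_zero) (use s in auto)
  have bw: "bmeas (wt (- s / 2) :: 'a \<Rightarrow> complex)" by (rule bmeas_wt) (use s in simp)
  have bt: "bmeas (\<lambda>\<xi>. 1 + - trunc M \<xi> :: complex)" for M :: nat
    by (rule bmeasI[of _ 1]) (auto simp: trunc_def)
  define k where "k \<xi> = (1 + - trunc M \<xi>) * wt (- s / 2) \<xi>" for \<xi> :: 'a
  have bk: "bmeas k" unfolding k_def[abs_def] by (rule bmeas_mult[OF bt bw])
  have kb: "cmod (k \<xi>) \<le> inverse B" for \<xi>
  proof (cases "norm \<xi> \<le> real M")
    case False
    have "(1 + (norm \<xi>)\<^sup>2) powr (- s / 2) \<le> (1 + (real M)\<^sup>2) powr (- s / 2)"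
      using False s by (intro powr_mono2') (auto intro!: add_pos_nonneg power_mono)
    also have "\<dots> = inverse B" using powr_minus[of "1 + (real M)\<^sup>2" "s / 2"] by (simp add: B_def)
    finally show ?thesis using False by (simp add: k_def trunc_def norm_wt)
  qed (use B1 in \<open>simp add: k_def trunc_def\<close>)
  have eq: "mul (trunc M) U - U = mul k (mul (trunc M) h - h)"
  proof (rule l2_eqI)
    show "AE t in lborel. rep (mul (trunc M) U - U) t = rep (mul k (mul (trunc M) h - h)) t"
      using rep_diff[of "mul (trunc M) U" U] rep_mul[OF bmeas_trunc, of M U] rep_mul[OF bw, of h]
        rep_mul[OF bk, of "mul (trunc M) h - h"] rep_diff[of "mul (trunc M) h" h] rep_mul[OF bmeas_trunc, of M h]
      unfolding U_def[symmetric]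
      by eventually_elim (auto simp: k_def trunc_def)
  qed
  have n1: "norm (mul (trunc M) U - U) \<le> inverse B * norm (mul (trunc M) h - h)"
    unfolding eq by (rule norm_mul_le[OF kb])
  also have "\<dots> \<le> 1 * norm (mul (trunc M) h - h)"
    by (rule mult_right_mono) (use B1 in \<open>auto simp: inverse_le_1_iff\<close>)
  finally show "norm (mul (trunc M) U - U) \<le> norm (mul (trunc M) h - h)" by simp
  have n2: "norm (mul (\<lambda>\<xi>. trunc M \<xi> * lap s \<xi>) U) \<le> B * norm h"
  proof -
    have "mul (\<lambda>\<xi>. trunc M \<xi> * lap s \<xi>) U = mul (\<lambda>\<xi>. trunc M \<xi> * lap s \<xi> * wt (- s / 2) \<xi>) h"
      unfolding U_def by (rule mul_mul[OF bmeas_trunc_lap[OF s] bw])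
    also have "norm \<dots> \<le> B * norm h"
    proof (rule norm_mul_le)
      fix \<xi> :: 'a
      have "cmod (trunc M \<xi> * lap s \<xi> * wt (- s / 2) \<xi>) \<le> cmod (trunc M \<xi> * (wt s \<xi> * wt (- s / 2) \<xi>))"
        unfolding norm_mult mult.assoc
        by (intro mult_left_mono mult_right_mono) (auto simp: norm_wt norm_lap_le s)
      also have "wt s \<xi> * wt (- s / 2) \<xi> = wt (s / 2) \<xi>" unfolding wt_mult by simp
      also have "cmod (trunc M \<xi> * wt (s / 2) \<xi>) \<le> B" unfolding B_def by (rule trunc_weight_bound) (use s in simp)
      finally show "cmod (trunc M \<xi> * lap s \<xi> * wt (- s / 2) \<xi>) \<le> B" .
    qed
    finally show ?thesis .
  qed
  have "norm (mul (trunc M) U - U) * norm (mul (\<lambda>\<xi>. trunc M \<xi> * lap s \<xi>) U)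
      \<le> (inverse B * norm (mul (trunc M) h - h)) * (B * norm h)"
    by (rule mult_mono[OF n1 n2]) (use B1 in auto)
  also have "\<dots> = norm (mul (trunc M) h - h) * norm h" using B1 by simp
  finally show "norm (mul (trunc M) U - U) * norm (mul (\<lambda>\<xi>. trunc M \<xi> * lap s \<xi>) U) \<le> norm (mul (trunc M) h - h) * norm h" .
qed

text \<open>The symbol |xi|^s <xi>^(-s): applied to <xi>^s times the transform it gives the square
  root of the kinetic energy density, while staying bounded.\<close>

definition grad_wt :: "real \<Rightarrow> 'a::euclidean_space \<Rightarrow> complex" where
  "grad_wt s \<xi> = lap (s / 2) \<xi> * wt (- s / 2) \<xi>"

lemma bmeas_grad_wt: "s \<ge> 0 \<Longrightarrow> bmeas (grad_wt s)"
  unfolding grad_wt_def[abs_def] by (rule bmeas_lap_wt) auto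

lemma norm_grad_wt: assumes "s \<ge> 0" shows "cmod (grad_wt s \<xi>) \<le> 1"
proof -
  have "cmod (grad_wt s \<xi>) \<le> cmod (wt (s / 2) \<xi> * wt (- s / 2) \<xi>)"
    unfolding grad_wt_def norm_mult norm_wt by (rule mult_right_mono[OF norm_lap_le]) (use assms in auto)
  then show ?thesis unfolding wt_mult by simp
qed

text \<open>The truncated energy is differentiable, and its derivative is
  controlled by \<open>\<parallel>P\<^sub>M u - u\<parallel> \<parallel>|\<xi>|\<^sup>2\<^sup>s P\<^sub>M u\<parallel>\<close>: the nonlinearity is Lipschitz in \<open>L\<^sup>2\<close> on \<open>L\<^sup>\<infinity>\<close>-bounded
  sets, so the gain \<open>M\<^sup>-\<^sup>s\<close> of the first factor compensates the loss \<open>M\<^sup>s\<close> of the second.\<close>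

lemma energy_conservation:
  fixes X H :: "real \<Rightarrow> 'a::euclidean_space l2"
  assumes s: "s \<ge> 0" and C: "C \<ge> 0" "\<And>(x :: 'a l2) h. FF x = mul (wt (- s / 2)) h \<Longrightarrow> ess_bd (C * norm h) x"
    and V: "ess_bdr a V" and g: "ess_bdr b g" and sol: "l2sol s V g T X H" and t: "t \<in> {0..T}"
  defines "En \<equiv> (\<lambda>t. inverse (2 * FT_const TYPE('a)) * (norm (mul (grad_wt s) (H t)))\<^sup>2 + pot V g (X t))"
  shows "En t = En 0"
proof -
  define c where "c = FT_const TYPE('a)"
  have c: "c > 0" by (simp add: c_def)
  have T0: "T \<ge> 0" using t by simp
  have a0: "a \<ge> 0" and b0: "b \<ge> 0" using V g by (simp_all add: ess_bdr_def)
  have bw: "bmeas (wt (- s / 2) :: 'a \<Rightarrow> complex)" by (rule bmeas_wt) (use s in simp)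
  define U where "U t = FF (X t)" for t
  have UH: "U t = mul (wt (- s / 2)) (H t)" if "t \<in> {0..T}" for t
    using sol that by (simp add: l2sol_def U_def)
  have contH: "continuous_on {0..T} H" using sol by (simp add: l2sol_def)
  have contX: "continuous_on {0..T} X"
  proof -
    have "continuous_on {0..T} (\<lambda>t. FI (mul (wt (- s / 2)) (H t)))"
      by (intro bounded_linear.continuous_on[OF bounded_linear_FI] bounded_linear.continuous_on[OF bounded_linear_mul] contH)
    moreover have "FI (mul (wt (- s / 2)) (H t)) = X t" if "t \<in> {0..T}" for t
      using UH[OF that, symmetric] by (simp add: U_def)
    ultimately show ?thesis by (rule continuous_on_eq)
  qed
  have bnd: "\<exists>B\<ge>0. \<forall>t\<in>{0..T}. norm (f t) \<le> B" if "continuous_on {0..T} f" for f :: "real \<Rightarrow> 'a l2"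
  proof -
    have "bounded (f ` {0..T})" by (intro compact_imp_bounded compact_continuous_image that) auto
    then show ?thesis by (auto simp: bounded_pos intro: less_imp_le)
  qed
  obtain A where A: "A \<ge> 0" "\<And>t. t \<in> {0..T} \<Longrightarrow> norm (H t) \<le> A" using bnd[OF contH] by blast
  define K where "K = C * A"
  have ebK: "ess_bd K x" if "FF x = mul (wt (- s / 2)) h" "norm h \<le> A" for x h :: "'a l2"
  proof -
    have "C * norm h \<le> K" unfolding K_def by (rule mult_left_mono[OF that(2) C(1)])
    then show ?thesis using C(2)[OF that(1)] unfolding ess_bd_def by (auto elim: eventually_mono)
  qed
  have KX: "ess_bd K (X t)" if "t \<in> {0..T}" for t
    using ebK[of "X t" "H t"] UH[OF that] A(2)[OF that] by (simp add: U_def)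
  define N where "N t = NL V g (X t)" for t
  have contN: "continuous_on {0..T} N" unfolding N_def by (rule NL_continuous[OF V g contX KX])
  obtain B where B: "B \<ge> 0" "\<And>t. t \<in> {0..T} \<Longrightarrow> norm (FF (N t)) \<le> B"
    using bnd[OF bounded_linear.continuous_on[OF bounded_linear_FF contN]] by blast
  define L where "L = a + 3 * b * K\<^sup>2"
  have L0: "L \<ge> 0" using a0 b0 by (simp add: L_def)
  define p where "p M t = FI (mul (trunc M) (U t))" for M t
  have Fp: "FF (p M t) = mul (trunc M) (U t)" for M t by (simp add: p_def)
  \<comment> \<open>Sharp frequency cutoffs need not preserve sup bounds. The uniform bound comes
    from the Sobolev embedding, because truncation does not increase the norm of
    \<open>H\<close>.\<close>
  have Kp: "ess_bd K (p M t)" if t: "t \<in> {0..T}" for M t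
  proof (rule ebK)
    show "FF (p M t) = mul (wt (- s / 2)) (mul (trunc M) (H t))"
      unfolding Fp UH[OF t] mul_mul[OF bmeas_trunc bw] mul_mul[OF bw bmeas_trunc] by (simp add: mult.commute)
    show "norm (mul (trunc M) (H t)) \<le> A" using norm_mul_trunc[of M "H t"] A(2)[OF t] by linarith
  qed
  \<comment> \<open>Parseval's factor, the Lipschitz constant of the nonlinearity, and the bounds A
    for \<open>H\<close> and B for the transformed nonlinearity; the one factor left in
    \<open>bound\<close> is the tail of \<open>H\<close>.\<close>
  define Q where "Q = inverse c * L * (A + B)"
  have Q0: "Q \<ge> 0" using c L0 A B by (simp add: Q_def)
  define EM where "EM M t = inverse (2 * c) * inner (mul (\<lambda>\<xi>. trunc M \<xi> * lap s \<xi>) (U t)) (mul (trunc M) (U t)) + pot V g (p M t)" for M t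
  \<comment> \<open>Only a commutator survives: the truncated equation is driven by the nonlinearity
    at \<open>X\<close>, whereas the potential energy of \<open>p M\<close> differentiates to the
    nonlinearity at \<open>p M\<close>.\<close>
  define EM' where "EM' M t = inverse c * inner (FF (NL V g (p M t)) - FF (N t))
     (mul (\<lambda>_. - \<i>) (mul (\<lambda>\<xi>. trunc M \<xi> * lap s \<xi>) (U t) + mul (trunc M) (FF (N t))))" for M t
  have der: "(EM M has_vector_derivative EM' M t) (at t within {0..T})" if t: "t \<in> {0..T}" for M t
  proof -
    define m where "m \<xi> = trunc M \<xi> * lap s \<xi>" for \<xi> :: 'a
    have bm: "bmeas m" unfolding m_def[abs_def] by (rule bmeas_trunc_lap[OF s])
    have mr: "cnj (m \<xi>) = m \<xi>" for \<xi> by (simp add: m_def)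
    define D where "D = mul (\<lambda>_. - \<i>) (mul m (U t) + mul (trunc M) (FF (N t)))"
    have UM: "((\<lambda>t. mul (trunc M) (U t)) has_vector_derivative D) (at t within {0..T})"
      using sol t unfolding l2sol_def D_def m_def U_def N_def by blast
    have AUM: "mul m (mul (trunc M) (U t)) = mul m (U t)" for t
      unfolding mul_mul[OF bm bmeas_trunc]
      by (rule arg_cong[of _ _ "\<lambda>m. mul m (U t)"]) (auto simp: m_def trunc_def)
    have "((\<lambda>t. inner (mul m (mul (trunc M) (U t))) (mul (trunc M) (U t))) has_derivative
       (\<lambda>h. inner (mul m (mul (trunc M) (U t))) (h *\<^sub>R D) + inner (mul m (h *\<^sub>R D)) (mul (trunc M) (U t)))) (at t within {0..T})"
      using UM unfolding has_vector_derivative_def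
      by (intro has_derivative_inner bounded_linear.has_derivative[OF bounded_linear_mul])
    then have 1: "((\<lambda>t. inner (mul m (U t)) (mul (trunc M) (U t))) has_vector_derivative 2 * inner (mul m (U t)) D) (at t within {0..T})"
      unfolding has_vector_derivative_def AUM
    proof (rule has_derivative_eq_rhs)
      show "(\<lambda>h. inner (mul m (U t)) (h *\<^sub>R D) + inner (mul m (h *\<^sub>R D)) (mul (trunc M) (U t))) = (\<lambda>h. h *\<^sub>R (2 * inner (mul m (U t)) D))"
      proof
        fix h
        have "inner (mul m (h *\<^sub>R D)) (mul (trunc M) (U t)) = inner (h *\<^sub>R D) (mul m (U t))"
          unfolding inner_mul_real[OF bm mr, symmetric] AUM ..
        then show "inner (mul m (U t)) (h *\<^sub>R D) + inner (mul m (h *\<^sub>R D)) (mul (trunc M) (U t)) = h *\<^sub>R (2 * inner (mul m (U t)) D)"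
          by (simp only: inner_scaleR_left inner_scaleR_right) (simp add: inner_commute)
      qed
    qed
    have dp: "((\<lambda>t. p M t) has_vector_derivative FI D) (at t within {0..T})"
      unfolding p_def by (rule bounded_linear.has_vector_derivative[OF bounded_linear_FI UM])
    have 2: "((\<lambda>t. pot V g (p M t)) has_vector_derivative inner (NL V g (p M t)) (FI D)) (at t within {0..T})"
      by (rule pot_derivative[where p="p M" and K=K, OF V g _ dp t]) (rule Kp)
    have "(EM M has_vector_derivative (inverse (2 * c) * (2 * inner (mul m (U t)) D) + inner (NL V g (p M t)) (FI D))) (at t within {0..T})"
      unfolding EM_def[abs_def] m_def[symmetric]
      using has_vector_derivative_add[OF bounded_linear.has_vector_derivative[OF bounded_linear_mult_right 1, of "inverse (2 * c)"] 2] .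
    moreover have "inverse (2 * c) * (2 * inner (mul m (U t)) D) + inner (NL V g (p M t)) (FI D) = EM' M t"
    proof -
      have "inner (NL V g (p M t)) (FI D) = inverse c * inner (FF (NL V g (p M t))) D"
        using inner_FI[of "FF (NL V g (p M t))" D] by (simp add: c_def)
      moreover have "inner (mul m (U t)) D = - inner (FF (N t)) D"
      proof -
        have PD: "D = mul (trunc M) D"
          unfolding D_def mul_add mul_mul[OF bmeas_const bm] mul_mul[OF bmeas_const bmeas_trunc]
            mul_mul[OF bmeas_trunc bmeas_mult[OF bmeas_const bm]] mul_mul[OF bmeas_trunc bmeas_mult[OF bmeas_const bmeas_trunc]]
          by (simp add: m_def mult_ac)
        have "inner (FF (N t)) D = inner (mul (trunc M) (FF (N t))) D"
          by (subst PD) (rule inner_mul_real[OF bmeas_trunc cnj_trunc])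
        then have "inner (mul m (U t)) D + inner (FF (N t)) D = inner (mul m (U t) + mul (trunc M) (FF (N t))) D"
          by (simp add: inner_add_left)
        \<comment> \<open>\<open>D\<close> is -\<i> times the other argument, hence orthogonal to
          it.\<close>
        also have "\<dots> = 0" unfolding D_def by (rule inner_mul_imaginary[OF bmeas_const]) simp
        finally show ?thesis by simp
      qed
      ultimately show ?thesis
        unfolding EM'_def m_def[symmetric] D_def[symmetric] using c by (simp add: inner_diff_left field_simps)
    qed
    ultimately show ?thesis by simp
  qed
  have bound: "\<bar>EM' M t\<bar> \<le> Q * norm (mul (trunc M) (H t) - H t)" if t: "t \<in> {0..T}" for M t
  proof -
    define \<tau> where "\<tau> = norm (mul (trunc M) (H t) - H t)"
    have 1: "norm (FF (NL V g (p M t)) - FF (N t)) \<le> L * norm (mul (trunc M) (U t) - U t)"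
    proof -
      have "norm (FF (NL V g (p M t)) - FF (N t)) = sqrt c * norm (NL V g (p M t) - N t)"
        unfolding FF_diff[symmetric] norm_FF c_def ..
      also have "\<dots> \<le> sqrt c * (L * norm (p M t - X t))"
        unfolding N_def L_def using c by (intro mult_left_mono NL_Lipschitz[OF V g Kp[OF t] KX[OF t]]) simp
      also have "\<dots> = L * norm (FF (p M t - X t))" unfolding norm_FF c_def by simp
      also have "FF (p M t - X t) = mul (trunc M) (U t) - U t" by (simp add: FF_diff Fp U_def)
      finally show ?thesis .
    qed
    have 2: "norm (mul (\<lambda>_. - \<i>) (mul (\<lambda>\<xi>. trunc M \<xi> * lap s \<xi>) (U t) + mul (trunc M) (FF (N t)))) \<le> norm (mul (\<lambda>\<xi>. trunc M \<xi> * lap s \<xi>) (U t)) + B"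
    proof -
      have "norm (mul (\<lambda>_. - \<i>) (mul (\<lambda>\<xi>. trunc M \<xi> * lap s \<xi>) (U t) + mul (trunc M) (FF (N t)))) \<le> 1 * norm (mul (\<lambda>\<xi>. trunc M \<xi> * lap s \<xi>) (U t) + mul (trunc M) (FF (N t)))"
        by (rule norm_mul_le) simp
      also have "\<dots> \<le> norm (mul (\<lambda>\<xi>. trunc M \<xi> * lap s \<xi>) (U t)) + norm (mul (trunc M) (FF (N t)))"
        using norm_triangle_ineq by simp
      finally show ?thesis using norm_mul_trunc[of M "FF (N t)"] B(2)[OF t] by linarith
    qed
    have 3: "norm (mul (trunc M) (U t) - U t) * (norm (mul (\<lambda>\<xi>. trunc M \<xi> * lap s \<xi>) (U t)) + B) \<le> \<tau> * (A + B)"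
    proof -
      have "norm (mul (trunc M) (U t) - U t) * norm (mul (\<lambda>\<xi>. trunc M \<xi> * lap s \<xi>) (U t)) \<le> \<tau> * norm (H t)"
        unfolding UH[OF t] \<tau>_def by (rule trunc_tail_bound(2)[OF s])
      also have "\<dots> \<le> \<tau> * A" by (rule mult_left_mono[OF A(2)[OF t]]) (simp add: \<tau>_def)
      finally have "norm (mul (trunc M) (U t) - U t) * norm (mul (\<lambda>\<xi>. trunc M \<xi> * lap s \<xi>) (U t)) \<le> \<tau> * A" .
      moreover have "norm (mul (trunc M) (U t) - U t) * B \<le> \<tau> * B"
        unfolding UH[OF t] \<tau>_def by (rule mult_right_mono[OF trunc_tail_bound(1)[OF s] B(1)])
      ultimately show ?thesis by (simp add: distrib_left)
    qed
    have "\<bar>EM' M t\<bar> \<le> inverse c * (norm (FF (NL V g (p M t)) - FF (N t)) *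
        norm (mul (\<lambda>_. - \<i>) (mul (\<lambda>\<xi>. trunc M \<xi> * lap s \<xi>) (U t) + mul (trunc M) (FF (N t)))))"
      unfolding EM'_def abs_mult using c by (auto intro!: mult_left_mono Cauchy_Schwarz_ineq2)
    also have "\<dots> \<le> inverse c * ((L * norm (mul (trunc M) (U t) - U t)) * (norm (mul (\<lambda>\<xi>. trunc M \<xi> * lap s \<xi>) (U t)) + B))"
      using c L0 by (intro mult_left_mono mult_mono 1 2) auto
    also have "\<dots> = inverse c * L * (norm (mul (trunc M) (U t) - U t) * (norm (mul (\<lambda>\<xi>. trunc M \<xi> * lap s \<xi>) (U t)) + B))"
      by (simp only: mult.assoc)
    also have "\<dots> \<le> inverse c * L * (\<tau> * (A + B))"
      using c L0 by (intro mult_left_mono 3) auto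
    finally show ?thesis by (simp add: Q_def \<tau>_def mult_ac)
  qed
  have lim: "(\<lambda>M. EM M t) \<longlonglongrightarrow> En t" if t: "t \<in> {0..T}" for t
  proof -
    have bG: "bmeas (grad_wt s :: 'a \<Rightarrow> complex)" by (rule bmeas_grad_wt[OF s])
    have Gr: "cnj (grad_wt s \<xi>) = grad_wt s \<xi>" for \<xi> :: 'a by (simp add: grad_wt_def)
    have e: "inner (mul (\<lambda>\<xi>. trunc M \<xi> * lap s \<xi>) (U t)) (mul (trunc M) (U t)) = inner (mul (trunc M) (mul (grad_wt s) (H t))) (mul (grad_wt s) (H t))" for M
    proof -
      have l: "inner (mul (\<lambda>\<xi>. trunc M \<xi> * lap s \<xi>) (U t)) (mul (trunc M) (U t))
         = inner (mul (\<lambda>\<xi>. wt (- s / 2) \<xi> * (trunc M \<xi> * (trunc M \<xi> * lap s \<xi> * wt (- s / 2) \<xi>))) (H t)) (H t)"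
        unfolding UH[OF t] inner_mul_real[OF bmeas_trunc cnj_trunc] inner_mul_real[OF bw cnj_wt]
          mul_mul[OF bmeas_trunc_lap[OF s] bw] mul_mul[OF bmeas_trunc bmeas_mult[OF bmeas_trunc_lap[OF s] bw]]
          mul_mul[OF bw bmeas_mult[OF bmeas_trunc bmeas_mult[OF bmeas_trunc_lap[OF s] bw]]] ..
      have r: "inner (mul (trunc M) (mul (grad_wt s) (H t))) (mul (grad_wt s) (H t))
         = inner (mul (\<lambda>\<xi>. grad_wt s \<xi> * (trunc M \<xi> * grad_wt s \<xi>)) (H t)) (H t)"
        unfolding inner_mul_real[OF bG Gr] by (simp add: mul_mul bG bmeas_mult)
      have "(\<lambda>\<xi>::'a. wt (- s / 2) \<xi> * (trunc M \<xi> * (trunc M \<xi> * lap s \<xi> * wt (- s / 2) \<xi>))) = (\<lambda>\<xi>. grad_wt s \<xi> * (trunc M \<xi> * grad_wt s \<xi>))"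
        unfolding grad_wt_def lap_half[of s, symmetric] by (rule ext) (simp add: trunc_def)
      then show ?thesis unfolding l r by simp
    qed
    have 1: "(\<lambda>M. inverse (2 * c) * inner (mul (\<lambda>\<xi>. trunc M \<xi> * lap s \<xi>) (U t)) (mul (trunc M) (U t)))
       \<longlonglongrightarrow> inverse (2 * c) * (norm (mul (grad_wt s) (H t)))\<^sup>2"
      unfolding e power2_norm_eq_inner by (intro tendsto_intros mul_trunc_tendsto)
    have pX: "(\<lambda>M. norm (p M t - X t)) \<longlonglongrightarrow> 0"
    proof -
      have "(\<lambda>M. p M t) \<longlonglongrightarrow> FI (U t)"
        unfolding p_def by (intro bounded_linear.tendsto[OF bounded_linear_FI] mul_trunc_tendsto)
      then show ?thesis by (simp add: U_def tendsto_norm_zero_iff LIM_zero_iff)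
    qed
    have "(\<lambda>M. norm (N t) * norm (p M t - X t) + (a / 2 + 3 / 2 * b * K\<^sup>2) * (norm (p M t - X t))\<^sup>2) \<longlonglongrightarrow> norm (N t) * 0 + (a / 2 + 3 / 2 * b * K\<^sup>2) * 0\<^sup>2"
      by (intro tendsto_intros pX)
    then have l0: "(\<lambda>M. norm (N t) * norm (p M t - X t) + (a / 2 + 3 / 2 * b * K\<^sup>2) * (norm (p M t - X t))\<^sup>2) \<longlonglongrightarrow> 0" by simp
    have "(\<lambda>M. pot V g (p M t) - pot V g (X t)) \<longlonglongrightarrow> 0"
    proof (rule Lim_null_comparison[OF _ l0], rule always_eventually, rule allI)
      fix M
      have "\<bar>inner (N t) (p M t - X t)\<bar> \<le> norm (N t) * norm (p M t - X t)" by (rule Cauchy_Schwarz_ineq2)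
      then show "norm (pot V g (p M t) - pot V g (X t)) \<le> norm (N t) * norm (p M t - X t) + (a / 2 + 3 / 2 * b * K\<^sup>2) * (norm (p M t - X t))\<^sup>2"
        using pot_expansion[OF V g KX[OF t] Kp[OF t], of M] unfolding N_def[symmetric] real_norm_def by linarith
    qed
    then have "(\<lambda>M. pot V g (p M t)) \<longlonglongrightarrow> pot V g (X t)" by (simp add: LIM_zero_iff)
    from tendsto_add[OF 1 this] show ?thesis unfolding EM_def En_def c_def .
  qed
  have main: "\<bar>En t - En 0\<bar> \<le> Q * \<eta> * T" if eta: "\<eta> > 0" for \<eta>
  proof (rule tendsto_upperbound)
    show "(\<lambda>M. \<bar>EM M t - EM M 0\<bar>) \<longlonglongrightarrow> \<bar>En t - En 0\<bar>"
      using T0 t by (intro tendsto_intros lim) auto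
    show "\<forall>\<^sub>F M in sequentially. \<bar>EM M t - EM M 0\<bar> \<le> Q * \<eta> * T"
      using trunc_uniform[OF contH eta]
    proof eventually_elim
      case (elim M)
      have b: "\<bar>EM' M r\<bar> \<le> Q * \<eta>" if "r \<in> {0..T}" for r
        using bound[OF that, of M] mult_left_mono[OF less_imp_le[OF elim[rule_format, OF that]] Q0] by linarith
      have "EM M t - EM M 0 \<le> Q * \<eta> * t"
        by (rule within_mono_bound[OF der _ t]) (use b in \<open>auto simp: abs_le_iff\<close>)
      moreover have "(- EM M t) - (- EM M 0) \<le> Q * \<eta> * t"
        by (rule within_mono_bound[OF has_vector_derivative_minus[OF der] _ t]) (use b in \<open>auto simp: abs_le_iff\<close>)
      moreover have "Q * \<eta> * t \<le> Q * \<eta> * T" using t Q0 eta by (intro mult_left_mono) auto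
      ultimately show ?case by linarith
    qed
  qed simp
  have "\<bar>En t - En 0\<bar> \<le> 0"
  proof (rule tendsto_lowerbound)
    show "((\<lambda>\<eta>. Q * \<eta> * T) \<longlongrightarrow> 0) (at_right 0)" by (auto intro!: tendsto_eq_intros)
    show "\<forall>\<^sub>F \<eta> in at_right 0. \<bar>En t - En 0\<bar> \<le> Q * \<eta> * T"
      using eventually_at_right_less[of 0] by eventually_elim (rule main)
  qed simp
  then show ?thesis by simp
qed

section \<open>Uniform Sobolev bounds\<close>

text \<open>With r = |xi|^2 one has (1 + r)^s <= (2 max(1, r))^s <= 2^s (1 + r^s); dividing by (1 +
  r)^s bounds 1 by the two squared symbols. Mass and kinetic energy together thus control the H^s
  norm.\<close>

lemma bracket_split:
  assumes "s \<ge> 0"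
  shows "(norm h)\<^sup>2 \<le> 2 powr s * ((norm (mul (wt (- s / 2)) h))\<^sup>2 + (norm (mul (grad_wt s) h))\<^sup>2)"
proof -
  have bw: "bmeas (wt (- s / 2) :: 'a \<Rightarrow> complex)" by (rule bmeas_wt) (use assms in simp)
  have bG: "bmeas (grad_wt s :: 'a \<Rightarrow> complex)" by (rule bmeas_grad_wt[OF assms])
  have pw: "1 \<le> 2 powr s * ((cmod (wt (- s / 2) \<xi>))\<^sup>2 + (cmod (grad_wt s \<xi>))\<^sup>2)" for \<xi> :: 'a
  proof -
    define r where "r = (norm \<xi>)\<^sup>2"
    have r: "r \<ge> 0" by (simp add: r_def)
    have w2: "(cmod (wt (- s / 2) \<xi>))\<^sup>2 = (1 + r) powr (- s)"
      unfolding norm_wt r_def power2_eq_square powr_add[symmetric] by simp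
    have l2: "(cmod (lap (s / 2) \<xi>))\<^sup>2 = r powr s"
    proof -
      have "(cmod (lap (s / 2) \<xi>))\<^sup>2 = norm \<xi> powr (2 * s)"
        unfolding lap_def power2_eq_square by (simp flip: powr_add)
      then show ?thesis by (cases "\<xi> = 0") (simp_all add: r_def powr_powr flip: powr_numeral)
    qed
    have "(1 + r) powr s \<le> (2 * max 1 r) powr s" by (rule powr_mono2) (use assms r in auto)
    also have "\<dots> = 2 powr s * (max 1 r) powr s" by (rule powr_mult)
    also have "(max 1 r) powr s \<le> 1 + r powr s" by (cases "1 \<le> r") (auto simp: max_def)
    finally have "(1 + r) powr s \<le> 2 powr s * (1 + r powr s)" by simp
    then have "(1 + r) powr s * (1 + r) powr (- s) \<le> 2 powr s * (1 + r powr s) * (1 + r) powr (- s)"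
      by (rule mult_right_mono) simp
    moreover have "(1 + r) powr s * (1 + r) powr (- s) = 1" using r by (simp flip: powr_add)
    ultimately show ?thesis
      unfolding grad_wt_def norm_mult power_mult_distrib w2 l2 by (simp add: algebra_simps)
  qed
  have "(norm h)\<^sup>2 \<le> (\<integral>t. 2 powr s * ((cmod (rep (mul (wt (- s / 2)) h) t))\<^sup>2 + (cmod (rep (mul (grad_wt s) h) t))\<^sup>2) \<partial>lborel)"
    unfolding norm_l2_sq[of h]
  proof (rule integral_mono_AE)
    show "AE t in lborel. (cmod (rep h t))\<^sup>2 \<le> 2 powr s * ((cmod (rep (mul (wt (- s / 2)) h) t))\<^sup>2 + (cmod (rep (mul (grad_wt s) h) t))\<^sup>2)"
      using rep_mul[OF bw, of h] rep_mul[OF bG, of h]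
    proof eventually_elim
      case (elim t)
      show ?case
        using mult_right_mono[OF pw[of t], of "(cmod (rep h t))\<^sup>2"]
        unfolding elim norm_mult power_mult_distrib by (simp add: algebra_simps)
    qed
  qed (intro integrable_mult_right Bochner_Integration.integrable_add L2_integrable_sq L2_rep)+
  also have "\<dots> = 2 powr s * ((norm (mul (wt (- s / 2)) h))\<^sup>2 + (norm (mul (grad_wt s) h))\<^sup>2)"
    unfolding norm_l2_sq by (simp add: L2_integrable_sq)
  finally show ?thesis .
qed

text \<open>Where the constant comes from: mass gives h^2. By energy conservation and positivity of
  the potential energy at time t, the kinetic part gives h^2 plus twice the initial potential energy
  up to Parseval's factor, at most (a + b (C h)^2 / 2) h^2. The solution enters only through h, so
  one bound serves all regularised problems.\<close>

lemma Hs_bound: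
  fixes X H :: "real \<Rightarrow> 'a::euclidean_space l2"
  assumes s: "s \<ge> 0" and C: "C \<ge> 0" "\<And>(x :: 'a l2) h. FF x = mul (wt (- s / 2)) h \<Longrightarrow> ess_bd (C * norm h) x"
    and V: "ess_bdr a V" and g: "ess_bdr b g" and V0: "AE x in lborel. V x \<ge> 0" and g0: "AE x in lborel. g x \<ge> 0"
    and sol: "l2sol s V g T X H" and t: "t \<in> {0..T}" and h: "norm (H 0) \<le> h"
  shows "(norm (H t))\<^sup>2 \<le> 2 powr s * (h\<^sup>2 * (2 + a + b * (C * h)\<^sup>2 / 2))"
proof -
  define c where "c = FT_const TYPE('a)"
  have c: "c > 0" by (simp add: c_def)
  have T0: "T \<ge> 0" using t by simp
  have a0: "a \<ge> 0" and b0: "b \<ge> 0" using V g by (simp_all add: ess_bdr_def)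
  have h0: "h \<ge> 0" using order_trans[OF norm_ge_zero h] .
  have hh: "(norm (H 0))\<^sup>2 \<le> h\<^sup>2" using h by (rule power_mono) simp
  have UH: "FF (X t) = mul (wt (- s / 2)) (H t)" if "t \<in> {0..T}" for t
    using sol that by (simp add: l2sol_def)
  have contH: "continuous_on {0..T} H" using sol by (simp add: l2sol_def)
  have contU: "continuous_on {0..T} (\<lambda>t. FF (X t))"
  proof -
    have "continuous_on {0..T} (\<lambda>t. mul (wt (- s / 2)) (H t))"
      by (intro bounded_linear.continuous_on[OF bounded_linear_mul] contH)
    then show ?thesis by (rule continuous_on_eq) (simp add: UH)
  qed
  have contX: "continuous_on {0..T} X"
    using bounded_linear.continuous_on[OF bounded_linear_FI contU] by simp
  have "bounded (H ` {0..T})" by (intro compact_imp_bounded compact_continuous_image contH) auto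
  then obtain A where A: "\<forall>t\<in>{0..T}. norm (H t) \<le> A" by (auto simp: bounded_iff)
  \<comment> \<open>\<open>A\<close> depends on the individual solution and only justifies the
    calculus; the final constant uses the Sobolev bound at time 0, in \<open>K0\<close>.\<close>
  have KX: "ess_bd (C * A) (X t)" if "t \<in> {0..T}" for t
  proof -
    have "C * norm (H t) \<le> C * A" using A C(1) that by (intro mult_left_mono) auto
    then show ?thesis using C(2)[OF UH[OF that]] unfolding ess_bd_def by (auto elim: eventually_mono)
  qed
  have contN: "continuous_on {0..T} (\<lambda>t. FF (NL V g (X t)))"
    by (intro bounded_linear.continuous_on[OF bounded_linear_FF] NL_continuous[OF V g contX KX])
  \<comment> \<open>Gronwall with growth rate and source both 0, which \<open>NL_inner_zero\<close>
    permits.\<close>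
  have "(norm (FF (X t)))\<^sup>2 \<le> exp (0 * T) * ((norm (FF (X 0)))\<^sup>2 + 0 * T)"
  proof (rule mass_gronwall[OF s contU contN _ _ _ _ t])
    show "((\<lambda>t. mul (trunc M) (FF (X t))) has_vector_derivative
        mul (\<lambda>_. - \<i>) (mul (\<lambda>\<xi>. trunc M \<xi> * lap s \<xi>) (FF (X t)) + mul (trunc M) (FF (NL V g (X t))))) (at t within {0..T})"
      if "t \<in> {0..T}" for M t using sol that unfolding l2sol_def by blast
    show "2 * inner (FF (X t)) (mul (\<lambda>_. - \<i>) (FF (NL V g (X t)))) \<le> 0 * (norm (FF (X t)))\<^sup>2 + 0" if "t \<in> {0..T}" for t
      unfolding FF_cmult[symmetric] inner_FF NL_inner_zero[OF V g KX[OF that]] by simp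
  qed auto
  then have mass: "(norm (FF (X t)))\<^sup>2 \<le> (norm (FF (X 0)))\<^sup>2" by simp
  have U0: "(norm (FF (X 0)))\<^sup>2 \<le> h\<^sup>2"
  proof -
    have "norm (FF (X 0)) \<le> 1 * norm (H 0)"
    proof -
      have "norm (mul (wt (- s / 2)) (H 0)) \<le> 1 * norm (H 0)"
        by (rule norm_mul_le[OF norm_wt_le_1]) (use s in simp)
      then show ?thesis using UH[of 0] T0 by simp
    qed
    then show ?thesis using h by (intro power_mono) auto
  qed
  have nG: "norm (mul (grad_wt s) (H 0)) \<le> 1 * norm (H 0)" by (rule norm_mul_le[OF norm_grad_wt[OF s]])
  have K0: "ess_bd (C * h) (X 0)"
  proof -
    have "C * norm (H 0) \<le> C * h" by (rule mult_left_mono[OF h C(1)])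
    then show ?thesis using C(2)[OF UH[of 0]] T0 unfolding ess_bd_def by (auto elim: eventually_mono)
  qed
  have pot0: "pot V g (X t) \<ge> 0"
    unfolding pot_def
  proof (rule integral_nonneg_AE)
    show "AE x in lborel. 0 \<le> V x / 2 * (cmod (rep (X t) x))\<^sup>2 + g x / 4 * (cmod (rep (X t) x)) ^ 4"
      using V0 g0 by eventually_elim simp
  qed
  have cX: "c * (norm (X 0))\<^sup>2 = (norm (FF (X 0)))\<^sup>2"
    unfolding norm_FF power_mult_distrib using c by (simp add: c_def less_imp_le)
  have "inverse (2 * c) * (norm (mul (grad_wt s) (H t)))\<^sup>2 + pot V g (X t) = inverse (2 * c) * (norm (mul (grad_wt s) (H 0)))\<^sup>2 + pot V g (X 0)"
    unfolding c_def by (rule energy_conservation[OF s C V g sol t])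
  then have "inverse (2 * c) * (norm (mul (grad_wt s) (H t)))\<^sup>2 \<le> inverse (2 * c) * (norm (mul (grad_wt s) (H 0)))\<^sup>2 + (a / 2 + b * (C * h)\<^sup>2 / 4) * (norm (X 0))\<^sup>2"
    using pot0 pot_integrable(2)[OF V g K0] by linarith
  then have "(2 * c) * (inverse (2 * c) * (norm (mul (grad_wt s) (H t)))\<^sup>2) \<le> (2 * c) * (inverse (2 * c) * (norm (mul (grad_wt s) (H 0)))\<^sup>2 + (a / 2 + b * (C * h)\<^sup>2 / 4) * (norm (X 0))\<^sup>2)"
    using c by (intro mult_left_mono) auto
  also have "(2 * c) * (inverse (2 * c) * (norm (mul (grad_wt s) (H t)))\<^sup>2) = (norm (mul (grad_wt s) (H t)))\<^sup>2"
    using c by simp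
  also have "(2 * c) * (inverse (2 * c) * (norm (mul (grad_wt s) (H 0)))\<^sup>2 + (a / 2 + b * (C * h)\<^sup>2 / 4) * (norm (X 0))\<^sup>2)
    = (norm (mul (grad_wt s) (H 0)))\<^sup>2 + (a + b * (C * h)\<^sup>2 / 2) * (c * (norm (X 0))\<^sup>2)"
    using c by (simp add: field_simps)
  also have "\<dots> \<le> h\<^sup>2 + (a + b * (C * h)\<^sup>2 / 2) * h\<^sup>2"
  proof (rule add_mono)
    show "(norm (mul (grad_wt s) (H 0)))\<^sup>2 \<le> h\<^sup>2" using nG h by (intro power_mono) auto
    show "(a + b * (C * h)\<^sup>2 / 2) * (c * (norm (X 0))\<^sup>2) \<le> (a + b * (C * h)\<^sup>2 / 2) * h\<^sup>2"
      unfolding cX using a0 b0 by (intro mult_left_mono U0) auto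
  qed
  finally have G: "(norm (mul (grad_wt s) (H t)))\<^sup>2 \<le> h\<^sup>2 + (a + b * (C * h)\<^sup>2 / 2) * h\<^sup>2" .
  have "(norm (H t))\<^sup>2 \<le> 2 powr s * ((norm (mul (wt (- s / 2)) (H t)))\<^sup>2 + (norm (mul (grad_wt s) (H t)))\<^sup>2)"
    by (rule bracket_split[OF s])
  also have "\<dots> \<le> 2 powr s * (h\<^sup>2 + (h\<^sup>2 + (a + b * (C * h)\<^sup>2 / 2) * h\<^sup>2))"
    unfolding UH[OF t, symmetric] by (intro mult_left_mono add_mono order_trans[OF mass U0] G) auto
  also have "h\<^sup>2 + (h\<^sup>2 + (a + b * (C * h)\<^sup>2 / 2) * h\<^sup>2) = h\<^sup>2 * (2 + a + b * (C * h)\<^sup>2 / 2)"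
    by (simp add: algebra_simps)
  finally show ?thesis .
qed

section \<open>Convergence of the regularised solutions\<close>

text \<open>The difference solves the linear equation with source \<open>F\<close>, where |F| <= L
  |Y| + d R. Young's inequality 2 |Y| d R <= |Y|^2 + (d R)^2 produces the growth rate 2 L + 1 and
  the source (d R)^2.\<close>

lemma l2sol_difference:
  fixes X X' H H' :: "real \<Rightarrow> 'a::euclidean_space l2"
  assumes s: "s \<ge> 0" and sol: "l2sol s V g T X H" and sol': "l2sol s V' g' T X' H'"
    and V: "ess_bdr a V" and g: "ess_bdr b g" and V': "ess_bdr a V'" and g': "ess_bdr b g'"
    and K: "\<And>t. t \<in> {0..T} \<Longrightarrow> ess_bd K (X t)" and K': "\<And>t. t \<in> {0..T} \<Longrightarrow> ess_bd K (X' t)"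
    and R: "\<And>t. t \<in> {0..T} \<Longrightarrow> norm (H t) \<le> R"
    and dV: "AE x in lborel. \<bar>V' x - V x\<bar> \<le> p" and dg: "AE x in lborel. \<bar>g' x - g x\<bar> \<le> q"
    and pq: "p \<ge> 0" "q \<ge> 0" and t: "t \<in> {0..T}"
  shows "(norm (FF (X' t) - FF (X t)))\<^sup>2 \<le>
    exp ((2 * (a + 3 * b * K\<^sup>2) + 1) * T) * ((norm (FF (X' 0) - FF (X 0)))\<^sup>2 + ((p + q * K\<^sup>2) * R)\<^sup>2 * T)"
proof -
  define L where "L = a + 3 * b * K\<^sup>2"
  have L0: "L \<ge> 0" using V g by (simp add: L_def ess_bdr_def)
  define d where "d = p + q * K\<^sup>2"
  have d0: "d \<ge> 0" using pq by (simp add: d_def)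
  have R0: "R \<ge> 0" using order_trans[OF norm_ge_zero R[OF t]] .
  have FX: "FF (Z t) = mul (wt (- s / 2)) (G t)" if "l2sol s W w T Z G" "t \<in> {0..T}" for W w Z G t
    using that by (simp add: l2sol_def)
  have cU: "continuous_on {0..T} (\<lambda>t. FF (Z t))" if "l2sol s W w T Z G" for W w Z and G :: "real \<Rightarrow> 'a l2"
  proof -
    have "continuous_on {0..T} G" using that by (simp add: l2sol_def)
    then have "continuous_on {0..T} (\<lambda>t. mul (wt (- s / 2)) (G t))"
      by (rule bounded_linear.continuous_on[OF bounded_linear_mul])
    then show ?thesis by (rule continuous_on_eq) (simp add: FX[OF that])
  qed
  have cX: "continuous_on {0..T} Z" if "l2sol s W w T Z G" for W w Z and G :: "real \<Rightarrow> 'a l2"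
    using bounded_linear.continuous_on[OF bounded_linear_FI cU[OF that]] by simp
  define Y where "Y t = FF (X' t) - FF (X t)" for t
  define F where "F t = FF (NL V' g' (X' t)) - FF (NL V g (X t))" for t
  have contY: "continuous_on {0..T} Y"
    unfolding Y_def by (intro continuous_on_diff cU[OF sol] cU[OF sol'])
  have contF: "continuous_on {0..T} F"
    unfolding F_def
    by (intro continuous_on_diff bounded_linear.continuous_on[OF bounded_linear_FF]
      NL_continuous[OF V g cX[OF sol] K] NL_continuous[OF V' g' cX[OF sol'] K'])
  have "(norm (Y t))\<^sup>2 \<le> exp ((2 * L + 1) * T) * ((norm (Y 0))\<^sup>2 + (d * R)\<^sup>2 * T)"
  proof (rule mass_gronwall[OF s contY contF _ _ _ _ t])
    fix M t assume t: "t \<in> {0..T}"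
    have 1: "((\<lambda>t. mul (trunc M) (FF (X' t))) has_vector_derivative
        mul (\<lambda>_. - \<i>) (mul (\<lambda>\<xi>. trunc M \<xi> * lap s \<xi>) (FF (X' t)) + mul (trunc M) (FF (NL V' g' (X' t))))) (at t within {0..T})"
      using sol' t unfolding l2sol_def by blast
    have 2: "((\<lambda>t. mul (trunc M) (FF (X t))) has_vector_derivative
        mul (\<lambda>_. - \<i>) (mul (\<lambda>\<xi>. trunc M \<xi> * lap s \<xi>) (FF (X t)) + mul (trunc M) (FF (NL V g (X t))))) (at t within {0..T})"
      using sol t unfolding l2sol_def by blast
    have e: "mul (\<lambda>_. - \<i>) (mul (\<lambda>\<xi>. trunc M \<xi> * lap s \<xi>) (Y t) + mul (trunc M) (F t))
      = mul (\<lambda>_. - \<i>) (mul (\<lambda>\<xi>. trunc M \<xi> * lap s \<xi>) (FF (X' t)) + mul (trunc M) (FF (NL V' g' (X' t))))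
      - mul (\<lambda>_. - \<i>) (mul (\<lambda>\<xi>. trunc M \<xi> * lap s \<xi>) (FF (X t)) + mul (trunc M) (FF (NL V g (X t))))"
      unfolding Y_def F_def mul_diff mul_add by simp
    show "((\<lambda>t. mul (trunc M) (Y t)) has_vector_derivative
        mul (\<lambda>_. - \<i>) (mul (\<lambda>\<xi>. trunc M \<xi> * lap s \<xi>) (Y t) + mul (trunc M) (F t))) (at t within {0..T})"
      unfolding e unfolding Y_def mul_diff by (rule has_vector_derivative_diff[OF 1 2])
  next
    fix t assume t: "t \<in> {0..T}"
    have "norm (F t) \<le> L * norm (Y t) + d * R"
    proof -
      have "norm (F t) = sqrt (FT_const TYPE('a)) * norm (NL V' g' (X' t) - NL V g (X t))"
        unfolding F_def FF_diff[symmetric] norm_FF ..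
      \<comment> \<open>Intermediate term: new coefficients at the old solution. The change of state
        is then a Lipschitz estimate, and the change of coefficients happens at the fixed state
        \<open>X t\<close>.\<close>
      also have "norm (NL V' g' (X' t) - NL V g (X t)) \<le> norm (NL V' g' (X' t) - NL V' g' (X t)) + norm (NL V' g' (X t) - NL V g (X t))"
        using norm_triangle_ineq[of "NL V' g' (X' t) - NL V' g' (X t)" "NL V' g' (X t) - NL V g (X t)"] by simp
      also have "\<dots> \<le> L * norm (X' t - X t) + d * norm (X t)"
        unfolding L_def d_def
        by (intro add_mono NL_Lipschitz[OF V' g' K'[OF t] K[OF t]] NL_perturb[OF V g V' g' K[OF t] dV dg pq])
      finally have "norm (F t) \<le> sqrt (FT_const TYPE('a)) * (L * norm (X' t - X t) + d * norm (X t))"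
        by (simp add: less_imp_le mult_left_mono)
      also have "\<dots> = L * norm (FF (X' t - X t)) + d * norm (FF (X t))"
        unfolding norm_FF by (simp add: algebra_simps)
      also have "FF (X' t - X t) = Y t" by (simp add: Y_def FF_diff)
      also have "d * norm (FF (X t)) \<le> d * R"
      proof (rule mult_left_mono[OF _ d0])
        have "norm (FF (X t)) \<le> 1 * norm (H t)"
          unfolding FX[OF sol t] by (rule norm_mul_le[OF norm_wt_le_1]) (use s in simp)
        then show "norm (FF (X t)) \<le> R" using R[OF t] by simp
      qed
      finally show ?thesis by simp
    qed
    moreover have "inner (Y t) (mul (\<lambda>_. - \<i>) (F t)) \<le> norm (Y t) * norm (F t)"
    proof -
      have "norm (mul (\<lambda>_. - \<i>) (F t)) \<le> 1 * norm (F t)" by (rule norm_mul_le) simp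
      then show ?thesis
        by (intro order_trans[OF norm_cauchy_schwarz] mult_left_mono) auto
    qed
    ultimately have "inner (Y t) (mul (\<lambda>_. - \<i>) (F t)) \<le> norm (Y t) * (L * norm (Y t) + d * R)"
      by (meson mult_left_mono norm_ge_zero order_trans)
    moreover have "2 * (norm (Y t) * (d * R)) \<le> (norm (Y t))\<^sup>2 + (d * R)\<^sup>2"
      using sum_squares_bound[of "norm (Y t)" "d * R"] by simp
    ultimately show "2 * inner (Y t) (mul (\<lambda>_. - \<i>) (F t)) \<le> (2 * L + 1) * (norm (Y t))\<^sup>2 + (d * R)\<^sup>2"
      by (simp add: algebra_simps power2_eq_square)
  qed (use L0 in auto)
  then show ?thesis by (simp add: Y_def L_def d_def)
qed

section \<open>Essential bounds for the regularised coefficients\<close>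

text \<open>Passage from a limit in the extended reals to a real majorant. Since
  \<open>real_of_ereal\<close> sends infinite values to 0, the pointwise bound is claimed only
  eventually, once the essential supremum lies between -1 and 1.\<close>

lemma esssup_tendsto_bound:
  fixes f :: "'i \<Rightarrow> 'a::euclidean_space \<Rightarrow> real"
  assumes "((\<lambda>\<epsilon>. esssup lborel (\<lambda>x. ereal \<bar>f \<epsilon> x\<bar>)) \<longlongrightarrow> 0) F"
  obtains p where "(p \<longlongrightarrow> 0) F" "\<And>\<epsilon>. p \<epsilon> \<ge> (0::real)" "\<forall>\<^sub>F \<epsilon> in F. AE x in lborel. \<bar>f \<epsilon> x\<bar> \<le> p \<epsilon>"
proof -
  define e where "e \<epsilon> = esssup lborel (\<lambda>x. ereal \<bar>f \<epsilon> x\<bar>)" for \<epsilon>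
  define p where "p \<epsilon> = \<bar>real_of_ereal (e \<epsilon>)\<bar>" for \<epsilon>
  have lim: "(e \<longlongrightarrow> ereal 0) F" using assms by (simp add: e_def[abs_def] zero_ereal_def)
  have "((\<lambda>\<epsilon>. real_of_ereal (e \<epsilon>)) \<longlongrightarrow> 0) F" by (rule lim_real_of_ereal[OF lim])
  then have 1: "(p \<longlongrightarrow> 0) F" unfolding p_def by (rule tendsto_rabs_zero)
  have 2: "\<forall>\<^sub>F \<epsilon> in F. AE x in lborel. \<bar>f \<epsilon> x\<bar> \<le> p \<epsilon>"
    using order_tendstoD(2)[OF lim, of "ereal 1", simplified] order_tendstoD(1)[OF lim, of "ereal (- 1)", simplified]
  proof eventually_elim
    case (elim \<epsilon>)
    then obtain r where r: "e \<epsilon> = ereal r" by (cases "e \<epsilon>") auto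
    have "AE x in lborel. ereal \<bar>f \<epsilon> x\<bar> \<le> e \<epsilon>" unfolding e_def by (rule esssup_AE)
    then show ?case by eventually_elim (auto simp: r p_def)
  qed
  have "p \<epsilon> \<ge> 0" for \<epsilon> unfolding p_def by (rule abs_ge_zero)
  then show ?thesis by (rule that[OF 1 _ 2])
qed

lemma Linf_ess_bdr: assumes "Linf V" shows "\<exists>a. ess_bdr a V"
proof -
  define e where "e = esssup lborel (\<lambda>x. ereal \<bar>V x\<bar>)"
  have e: "e < \<infinity>" and m: "V \<in> borel_measurable borel" using assms by (auto simp: Linf_def e_def)
  have "AE x in lborel. ereal \<bar>V x\<bar> \<le> e" unfolding e_def by (rule esssup_AE)
  then have "AE x in lborel. \<bar>V x\<bar> \<le> max 0 (real_of_ereal e)"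
  proof eventually_elim
    case (elim x)
    then show ?case using e by (cases e) auto
  qed
  then show ?thesis using m by (intro exI[of _ "max 0 (real_of_ereal e)"]) (simp add: ess_bdr_def)
qed

lemma ess_bdr_mono: "ess_bdr a V \<Longrightarrow> a \<le> a' \<Longrightarrow> ess_bdr a' V"
  unfolding ess_bdr_def by (auto elim: eventually_mono)

lemma conv_real_measurable:
  assumes [measurable]: "V \<in> borel_measurable borel" "k \<in> borel_measurable borel"
  shows "conv_real V k \<in> borel_measurable borel"
proof -
  have "(\<lambda>x. \<integral>y. V (x - y) * k y \<partial>lborel) \<in> borel_measurable lborel"
    by (rule lborel.borel_measurable_lebesgue_integral) measurable
  then show ?thesis by (simp add: conv_real_def[abs_def])
qed

text \<open>For each fixed \<open>x\<close> the reflected and shifted exceptional set is still null,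
  so positivity almost everywhere becomes positivity of the convolution at every point.\<close>

lemma conv_real_nonneg:
  assumes [measurable]: "V \<in> borel_measurable borel" and V: "AE x in lborel. V x \<ge> 0" and k: "\<And>y. k y \<ge> 0"
  shows "conv_real V k x \<ge> 0"
  unfolding conv_real_def
proof (rule integral_nonneg_AE)
  have "AE y in lborel. 0 \<le> V (x + (- 1) *\<^sub>R y)"
    by (rule AE_lborel_affine) (use V in auto)
  then show "AE y in lborel. 0 \<le> V (x - y) * k y"
    by eventually_elim (simp add: k)
qed

context mollifier
begin

section \<open>Mollification as a Fourier multiplier\<close>

lemma HH_mul:
  fixes w v :: "'a \<Rightarrow> complex"
  assumes w: "in_Hs s w" and v: "in_Hs s v" and m: "bmeas m" and eq: "FF (cls v) = mul m (FF (cls w))"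
  shows "HH s v = mul m (HH s w)"
proof -
  note L = in_Hs_D[OF w] in_Hs_D[OF v]
  have "cls (FT v) = cls (\<lambda>\<xi>. m \<xi> * FT w \<xi>)"
    using eq unfolding FT_cls(2)[OF L(1), symmetric] FT_cls(2)[OF L(3), symmetric] mul_cls[OF m FT_cls(1)[OF L(1)]] .
  then have "AE \<xi> in lborel. FT v \<xi> = m \<xi> * FT w \<xi>"
    by (rule iffD1[OF cls_eq_iff[OF FT_cls(1)[OF L(3)] L2_bmeas_mult[OF m FT_cls(1)[OF L(1)]]]])
  then have "AE \<xi> in lborel. wt (s / 2) \<xi> * FT v \<xi> = m \<xi> * (wt (s / 2) \<xi> * FT w \<xi>)"
    by eventually_elim (simp add: mult_ac)
  then show ?thesis
    unfolding HH_def mul_cls[OF m L(2)] by (rule cls_eqI[OF L(4) L2_bmeas_mult[OF m L(2)]])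
qed

text \<open>The Fourier transform of \<open>\<psi>\<^sub>\<epsilon>\<close> at \<open>r = \<omega>(\<epsilon>)\<close>.\<close>

definition dil :: "real \<Rightarrow> 'a \<Rightarrow> complex" where
  "dil r \<xi> = fourier (pk 1) (r *\<^sub>R \<xi>)"

lemma dil_measurable [measurable]: "dil r \<in> borel_measurable borel"
proof -
  have [measurable]: "pk 1 \<in> borel_measurable borel" unfolding pk_def[abs_def] by measurable
  show ?thesis unfolding dil_def[abs_def] by measurable
qed

text \<open>A nonnegative profile with integral 1 has L1 norm 1; this is what makes mollification a
  contraction on H^s.\<close>

lemma norm_dil_le: assumes "\<forall>x. \<psi> x \<ge> 0" shows "cmod (dil r \<xi>) \<le> 1"
  using fourier_bounded[of "pk 1" "r *\<^sub>R \<xi>"] assms psi_int by (simp add: dil_def pk_def)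

lemma bmeas_dil: "\<forall>x. \<psi> x \<ge> 0 \<Longrightarrow> bmeas (dil r)"
  by (rule bmeasI[OF dil_measurable norm_dil_le])

text \<open>The symbols tend to 1 at each frequency, by continuity of the transform of \<psi> at 0,
  but not uniformly in frequency; hence the limit is taken at a fixed \<open>z\<close>.\<close>

lemma dil_tendsto: 
  assumes "\<forall>x. \<psi> x \<ge> 0" shows "((\<lambda>r. mul (dil r) z) \<longlongrightarrow> z) (at 0)"
  unfolding tendsto_at_iff_sequentially
proof (intro allI impI)
  fix r :: "nat \<Rightarrow> real" assume r: "r \<longlonglongrightarrow> 0"
  have "(\<lambda>n. mul (dil (r n)) z) \<longlonglongrightarrow> mul (\<lambda>_. 1) z"
  proof (rule mul_tendsto[where c=1])
    show "AE \<xi> in lborel. (\<lambda>n. dil (r n) \<xi>) \<longlonglongrightarrow> 1"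
    proof (rule AE_I2)
      fix \<xi> :: 'a
      have "(\<lambda>n. r n *\<^sub>R \<xi>) \<longlonglongrightarrow> 0 *\<^sub>R \<xi>" by (intro tendsto_intros r)
      then have "(\<lambda>n. r n *\<^sub>R \<xi>) \<longlonglongrightarrow> 0" by simp
      from fourier_tendsto[OF test_fun_L2(2)[OF pk_test] this, of 1]
      show "(\<lambda>n. dil (r n) \<xi>) \<longlonglongrightarrow> 1" by (simp add: dil_def fourier_pk_0)
    qed
  qed (use norm_dil_le[OF assms] in auto)
  then show "((\<lambda>r. mul (dil r) z) \<circ> r) \<longlonglongrightarrow> z" by (simp add: o_def)
qed

text \<open>When a convolution is tested, the kernel moves onto the test function as this
  correlation. It is again bounded with compact support, so its transform is a classical integral
  and factors by Fubini.\<close>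

lemma fourier_correlation:
  assumes phi: "test_fun \<phi>" and kap: "test_fun \<kappa>" and real: "\<And>y. cnj (\<kappa> y) = \<kappa> y"
  defines "ch \<equiv> (\<lambda>z. \<integral>x. \<phi> x * \<kappa> (x - z) \<partial>lborel)"
  shows "L2 ch" "integrable lborel ch" "fourier ch (\<xi> :: 'a) = fourier \<kappa> (- \<xi>) * fourier \<phi> \<xi>"
    and "\<exists>R. \<forall>x z. norm z > R \<longrightarrow> \<phi> x * \<kappa> (x - z) = 0"
proof -
  obtain B1 R1 where b1: "continuous_on UNIV \<phi>" "\<And>x. cmod (\<phi> x) \<le> B1" "\<And>x. norm x > R1 \<Longrightarrow> \<phi> x = 0"
    using test_fun_bounds[OF phi] by metis
  obtain B2 R2 where b2: "continuous_on UNIV \<kappa>" "\<And>x. cmod (\<kappa> x) \<le> B2" "\<And>x. norm x > R2 \<Longrightarrow> \<kappa> x = 0"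
    using test_fun_bounds[OF kap] by metis
  have [measurable]: "\<phi> \<in> borel_measurable borel" "\<kappa> \<in> borel_measurable borel"
    using b1(1) b2(1) by (auto intro: borel_measurable_continuous_onI)
  have fi: "integrable lborel \<phi>" and ki: "integrable lborel \<kappa>"
    using test_fun_L2[OF phi] test_fun_L2[OF kap] by auto
  have z0: "\<phi> x * \<kappa> (x - z) = 0" if "norm z > R1 + R2" for x z
  proof (cases "norm x > R1")
    case False
    have "norm z \<le> norm x + norm (x - z)" using norm_triangle_ineq4[of x "x - z"] by simp
    then have "norm (x - z) > R2" using that False by linarith
    then show ?thesis by (simp add: b2(3))
  qed (simp add: b1(3))
  then show "\<exists>R. \<forall>x z. norm z > R \<longrightarrow> \<phi> x * \<kappa> (x - z) = 0" by blast
  have m: "ch \<in> borel_measurable borel"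
  proof -
    have "(\<lambda>z. \<integral>x. \<phi> x * \<kappa> (x - z) \<partial>lborel) \<in> borel_measurable lborel"
      by (rule lborel.borel_measurable_lebesgue_integral) measurable
    then show ?thesis by (simp add: ch_def)
  qed
  have bd: "cmod (ch z) \<le> (\<integral>x. B2 * cmod (\<phi> x) \<partial>lborel)" for z
  proof -
    have i: "integrable lborel (\<lambda>x. \<kappa> (x - z) * \<phi> x)"
      by (rule integrable_bounded_mult[OF fi _ b2(2)]) measurable
    have "cmod (ch z) \<le> (\<integral>x. cmod (\<kappa> (x - z) * \<phi> x) \<partial>lborel)"
      unfolding ch_def using integral_norm_bound[of lborel "\<lambda>x. \<kappa> (x - z) * \<phi> x"] by (simp add: mult.commute)
    also have "\<dots> \<le> (\<integral>x. B2 * cmod (\<phi> x) \<partial>lborel)"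
    proof (rule integral_mono)
      show "integrable lborel (\<lambda>x. B2 * cmod (\<phi> x))" using fi by simp
      show "integrable lborel (\<lambda>x. cmod (\<kappa> (x - z) * \<phi> x))" using i by (rule integrable_norm)
      show "cmod (\<kappa> (x - z) * \<phi> x) \<le> B2 * cmod (\<phi> x)" for x
        unfolding norm_mult by (rule mult_right_mono[OF b2(2)]) simp
    qed
    finally show ?thesis .
  qed
  have sp: "ch z = 0" if "norm z > R1 + R2" for z by (simp add: ch_def z0[OF that])
  show "L2 ch" "integrable lborel ch"
    by (rule L2_bounded_support[OF m bd sp]; assumption)+
  define e where "e z = exp (- \<i> * complex_of_real (z \<bullet> \<xi>))" for z :: 'a
  define k where "k q = e (snd q) * \<kappa> (fst q - snd q)" for q :: "'a \<times> 'a"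
  \<comment> \<open>The indicator is 1 wherever the integrand is nonzero; inserting it makes the
    double integral absolutely convergent.\<close>
  define J where "J z = complex_of_real (indicator (cball 0 (R1 + R2)) z)" for z :: 'a
  have [measurable]: "e \<in> borel_measurable borel" unfolding e_def[abs_def] by measurable
  have Ji: "integrable lborel J"
    by (rule L2_bounded_support(2)[of _ 1 "R1 + R2"]) (auto simp: J_def[abs_def] indicator_def)
  have kb: "cmod (k q) \<le> B2" for q unfolding k_def norm_mult e_def norm_exp_i using b2(2) by simp
  have F: "integrable (lborel \<Otimes>\<^sub>M lborel) (\<lambda>(x, z). \<phi> x * J z * k (x, z))"
    by (rule integrable_kernel[OF fi Ji _ kb]) (simp add: k_def[abs_def])
  have pt: "\<phi> x * J z * k (x, z) = e z * (\<phi> x * \<kappa> (x - z))" for x z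
    using z0[of z x] by (cases "norm z > R1 + R2") (auto simp: J_def k_def indicator_def)
  have "fourier ch \<xi> = (\<integral>z. (\<integral>x. \<phi> x * J z * k (x, z) \<partial>lborel) \<partial>lborel)"
    unfolding pt integral_mult_right_zero fourier_def ch_def e_def ..
  also have "\<dots> = (\<integral>x. (\<integral>z. \<phi> x * J z * k (x, z) \<partial>lborel) \<partial>lborel)"
    using lborel_pair.Fubini_integral[OF F] by simp
  also have "\<dots> = (\<integral>x. fourier \<kappa> (- \<xi>) * (e x * \<phi> x) \<partial>lborel)"
  proof (rule Bochner_Integration.integral_cong[OF refl])
    fix x
    have "(\<integral>z. \<phi> x * J z * k (x, z) \<partial>lborel) = (\<integral>z. \<phi> x * (e z * \<kappa> (x - z)) \<partial>lborel)"
      unfolding pt by (simp add: mult.left_commute)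
    also have "\<dots> = \<phi> x * fourier (\<lambda>z. cnj (\<kappa> (x - z))) \<xi>"
      unfolding integral_mult_right_zero fourier_def e_def real ..
    also have "\<dots> = \<phi> x * (e x * cnj (fourier \<kappa> \<xi>))"
      unfolding fourier_cnj_reflect[OF ki] e_def ..
    also have "cnj (fourier \<kappa> \<xi>) = fourier \<kappa> (- \<xi>)"
      using fourier_cnj[of \<kappa> "- \<xi>"] by (simp add: real)
    finally show "(\<integral>z. \<phi> x * J z * k (x, z) \<partial>lborel) = fourier \<kappa> (- \<xi>) * (e x * \<phi> x)"
      by (simp add: mult_ac)
  qed
  also have "\<dots> = fourier \<kappa> (- \<xi>) * fourier \<phi> \<xi>"
    unfolding integral_mult_right_zero fourier_def[of \<phi>] e_def ..
  finally show "fourier ch \<xi> = fourier \<kappa> (- \<xi>) * fourier \<phi> \<xi>" .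
qed

text \<open>\<open>w\<close> need not be integrable, so the convolution theorem is proved by
  duality: test against mollifiers, move the kernel onto the test function, and apply Parseval to
  the correlation.\<close>

lemma FF_conv:
  assumes r: "\<omega> \<epsilon> > 0" and nn: "\<forall>x. \<psi> x \<ge> 0" and w: "L2 w" and v: "L2 v"
    and eq: "AE x in lborel. v x = conv_cplx w (moll \<psi> \<omega> \<epsilon>) x"
  shows "FF (cls v) = mul (dil (\<omega> \<epsilon>)) (FF (cls w))"
proof -
  define r where "r = \<omega> \<epsilon>"
  have r0: "r > 0" using r by (simp add: r_def)
  define \<alpha> where "\<alpha> = complex_of_real (r powr (- real DIM('a)))"
  define \<kappa> where "\<kappa> y = complex_of_real (moll \<psi> \<omega> \<epsilon> y)" for y
  have kpk: "\<kappa> = (\<lambda>y. \<alpha> * pk r y)" by (auto simp: \<kappa>_def \<alpha>_def moll_def pk_def r_def)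
  have kap: "test_fun \<kappa>"
    unfolding kpk test_fun_def
  proof
    show "\<forall>k. Ck k (\<lambda>y. \<alpha> * pk r y)"
      using pk_test[OF r0] Ck_linear[OF bounded_linear_mult_right, of _ "pk r" \<alpha>] by (auto simp: test_fun_def)
    have "bounded {x. pk r x \<noteq> 0}" using pk_test[OF r0] by (simp add: test_fun_def)
    then have "bounded {x. \<alpha> * pk r x \<noteq> 0}" by (rule bounded_subset) auto
    then show "compact (closure {x. \<alpha> * pk r x \<noteq> 0})" by simp
  qed
  have real: "cnj (\<kappa> y) = \<kappa> y" for y by (simp add: \<kappa>_def)
  \<comment> \<open>The normalisation of the mollifier cancels the Jacobian of the dilation.\<close>
  have Fk: "fourier \<kappa> \<xi> = dil r \<xi>" for \<xi>
  proof -
    have "\<alpha> * complex_of_real (r ^ DIM('a)) = complex_of_real (r powr (- real DIM('a)) * r powr real DIM('a))"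
      using r0 by (simp add: \<alpha>_def powr_realpow)
    also have "\<dots> = 1" using r0 by (simp flip: powr_add)
    finally show ?thesis
      unfolding kpk fourier_cmult fourier_pk_scale[OF r0, of \<xi>] dil_def by (simp flip: mult.assoc)
  qed
  have km [measurable]: "\<kappa> \<in> borel_measurable borel" using L2_measurable[OF test_fun_L2(1)[OF kap]] by simp
  have wm [measurable]: "w \<in> borel_measurable borel" using L2_measurable[OF w] by simp
  have vm [measurable]: "v \<in> borel_measurable borel" using L2_measurable[OF v] by simp
  have "cls v - FI (mul (dil r) (FF (cls w))) = 0"
  proof (rule tst_total)
    fix x0 :: 'a and \<delta> :: real assume d: "\<delta> > 0"
    define \<phi> where "\<phi> = tst x0 \<delta>"
    have phi: "test_fun \<phi>" unfolding \<phi>_def by (rule tst_test[OF d])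
    note Lphi = test_fun_L2[OF phi]
    have [measurable]: "\<phi> \<in> borel_measurable borel" using L2_measurable[OF Lphi(1)] by simp
    define ch where "ch z = (\<integral>x. \<phi> x * \<kappa> (x - z) \<partial>lborel)" for z
    note corr = fourier_correlation[OF phi kap real, folded ch_def]
    obtain R where R: "\<And>x z. norm z > R \<Longrightarrow> \<phi> x * \<kappa> (x - z) = 0" using corr(4) by blast
    \<comment> \<open>Restricting \<open>w\<close> to the ball outside which the kernel product
      vanishes makes it integrable and changes no integral.\<close>
    define wb where "wb z = complex_of_real (indicator (cball 0 R) z) * w z" for z
    have wbi: "integrable lborel wb"
      unfolding wb_def
      by (intro L2_integrable_mult w L2_bounded_support(1)[of _ 1 R]) (auto simp: indicator_def)
    obtain B where B: "\<And>x. cmod (\<kappa> x) \<le> B" using test_fun_bounds[OF kap] by metis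
    have F: "integrable (lborel \<Otimes>\<^sub>M lborel) (\<lambda>(x, z). \<phi> x * wb z * \<kappa> (fst (x, z) - snd (x, z)))"
      by (rule integrable_kernel[OF Lphi(2) wbi _ B]) measurable
    have pt: "\<phi> x * wb z * \<kappa> (fst (x, z) - snd (x, z)) = w z * (\<phi> x * \<kappa> (x - z))" for x z
      using R[of z x] by (cases "norm z > R") (auto simp: wb_def indicator_def)
    have cv: "conv_cplx w (moll \<psi> \<omega> \<epsilon>) x = (\<integral>z. w z * \<kappa> (x - z) \<partial>lborel)" for x
      unfolding conv_cplx_def \<kappa>_def[symmetric]
      by (subst lborel_integral_affine[of "-1" _ x]) simp_all
    have "bp (cls v) (cls \<phi>) = (\<integral>x. v x * \<phi> x \<partial>lborel)" by (rule bp_cls[OF v Lphi(1)])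
    also have "\<dots> = (\<integral>x. (\<integral>z. w z * \<kappa> (x - z) \<partial>lborel) * \<phi> x \<partial>lborel)"
    proof (rule integral_cong_AE)
      have "(\<lambda>x. \<integral>z. w z * \<kappa> (x - z) \<partial>lborel) \<in> borel_measurable lborel"
        by (rule lborel.borel_measurable_lebesgue_integral) measurable
      then show "(\<lambda>x. (\<integral>z. w z * \<kappa> (x - z) \<partial>lborel) * \<phi> x) \<in> borel_measurable lborel" by measurable
      show "AE x in lborel. v x * \<phi> x = (\<integral>z. w z * \<kappa> (x - z) \<partial>lborel) * \<phi> x"
        using eq unfolding cv by eventually_elim simp
    qed measurable
    also have "\<dots> = (\<integral>x. (\<integral>z. \<phi> x * wb z * \<kappa> (fst (x, z) - snd (x, z)) \<partial>lborel) \<partial>lborel)"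
      unfolding pt by (simp only: integral_mult_right_zero mult_ac)
    also have "\<dots> = (\<integral>z. (\<integral>x. \<phi> x * wb z * \<kappa> (fst (x, z) - snd (x, z)) \<partial>lborel) \<partial>lborel)"
      using lborel_pair.Fubini_integral[OF F] by simp
    also have "\<dots> = (\<integral>z. w z * ch z \<partial>lborel)"
      unfolding pt integral_mult_right_zero ch_def ..
    also have "\<dots> = bp (cls w) (cls ch)" by (rule bp_cls[OF w corr(1), symmetric])
    finally have 1: "bp (cls v) (cls \<phi>) = bp (cls w) (cls ch)" .
    have "complex_of_real (FT_const TYPE('a)) * bp (cls w) (cls ch) = bp (FF (cls w)) (cls (\<lambda>\<xi>. dil r \<xi> * fourier \<phi> (- \<xi>)))"
      unfolding bp_parseval[OF corr(1,2)] corr(3) minus_minus Fk ..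
    also have "\<dots> = bp (mul (dil r) (FF (cls w))) (cls (\<lambda>\<xi>. fourier \<phi> (- \<xi>)))"
      by (rule bp_mul_cls[OF bmeas_dil[OF nn] refl_FF_cls(2)[OF Lphi], symmetric])
    also have "\<dots> = complex_of_real (FT_const TYPE('a)) * bp (FI (mul (dil r) (FF (cls w)))) (cls \<phi>)"
      unfolding bp_parseval[OF Lphi] FF_FI ..
    finally have "bp (cls w) (cls ch) = bp (FI (mul (dil r) (FF (cls w)))) (cls \<phi>)" by simp
    with 1 show "bp (cls v - FI (mul (dil r) (FF (cls w)))) (cls (tst x0 \<delta>)) = 0"
      unfolding \<phi>_def by (simp add: linear_diff[OF bounded_linear.linear[OF bounded_linear_bp]])
  qed
  then have "cls v = FI (mul (dil r) (FF (cls w)))" by simp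
  then show ?thesis by (simp add: r_def)
qed

end

theorem theorem4p1:
  fixes V g :: "'a::euclidean_space \<Rightarrow> real"
    and u0 :: "'a \<Rightarrow> complex"
    and u :: "real \<Rightarrow> 'a \<Rightarrow> complex"
    and u_eps :: "real \<Rightarrow> real \<Rightarrow> 'a \<Rightarrow> complex"
    and \<psi> :: "'a \<Rightarrow> real"
    and \<omega> :: "real \<Rightarrow> real"
    and s T :: real
  assumes "T > 0"
    and "s > real DIM('a) / 2"
    and "Linf V" and "Linf g"
    and "AE x in lborel. V x \<ge> 0" and "AE x in lborel. g x \<ge> 0"
    and "in_Hs s u0" and "L4 u0"
    and "nls_solution s V g u0 T u"
    and "test_fun \<psi>" and "\<forall>x. \<psi> x \<ge> 0" and "(\<integral>x. \<psi> x \<partial>lborel) = 1"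
    and "\<forall>\<epsilon>\<in>{0<..1}. \<omega> \<epsilon> > 0" and "(\<omega> \<longlongrightarrow> 0) (at_right 0)"
    and "((\<lambda>\<epsilon>. esssup lborel (\<lambda>x. ereal \<bar>conv_real V (moll \<psi> \<omega> \<epsilon>) x - V x\<bar>))
            \<longlongrightarrow> 0) (at_right 0)"
    and "((\<lambda>\<epsilon>. esssup lborel (\<lambda>x. ereal \<bar>conv_real g (moll \<psi> \<omega> \<epsilon>) x - g x\<bar>))
            \<longlongrightarrow> 0) (at_right 0)"
    and "\<forall>\<epsilon>\<in>{0<..1}. nls_solution s (conv_real V (moll \<psi> \<omega> \<epsilon>)) (conv_real g (moll \<psi> \<omega> \<epsilon>))
            (conv_cplx u0 (moll \<psi> \<omega> \<epsilon>)) T (u_eps \<epsilon>)"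
  shows "\<forall>t\<in>{0..T}. ((\<lambda>\<epsilon>. \<integral>\<^sup>+x. ennreal ((cmod (u_eps \<epsilon> t x - u t x))\<^sup>2) \<partial>lborel)
            \<longlongrightarrow> 0) (at_right 0)"
proof
  fix t assume t: "t \<in> {0..T}"
  interpret mollifier \<psi> by unfold_locales (rule assms)+
  note nn = \<open>\<forall>x. \<psi> x \<ge> 0\<close>
  have zT: "0 \<in> {0..T}" using \<open>T > 0\<close> by simp
  have s0: "s \<ge> 0" using assms(2) by (smt (verit) divide_nonneg_nonneg of_nat_0_le_iff)
  obtain a0 where a0: "ess_bdr a0 V" using Linf_ess_bdr[OF \<open>Linf V\<close>] by blast
  obtain b0 where b0: "ess_bdr b0 g" using Linf_ess_bdr[OF \<open>Linf g\<close>] by blast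
  obtain C where C: "C \<ge> 0" "\<And>(x :: 'a l2) h. FF x = mul (wt (- s / 2)) h \<Longrightarrow> ess_bd (C * norm h) x"
    using sobolev[OF assms(2)] by blast
  \<comment> \<open>The margin 1 accommodates the regularised coefficients too, once they are within
    1 of the original ones in the sup norm.\<close>
  define a where "a = a0 + 1"
  define b where "b = b0 + 1"
  define h where "h = norm (HH s u0)"
  \<comment> \<open>The bound of \<open>Hs_bound\<close>, with \<open>h\<close> majorising the
    initial norms of all problems at once.\<close>
  define R where "R = sqrt (2 powr s * (h\<^sup>2 * (2 + a + b * (C * h)\<^sup>2 / 2)))"
  define K where "K = C * R"
  define z where "z = FF (cls u0)"
  have Va: "ess_bdr a V" and gb: "ess_bdr b g" using a0 b0 by (auto simp: a_def b_def intro: ess_bdr_mono)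
  have Lu0: "L2 u0" by (rule in_Hs_D(1)[OF assms(7)])
  \<comment> \<open>Stated for arbitrary coefficients within the bounds, so that it covers the limit
    problem and every regularised problem with the same constants.\<close>
  have HR: "norm (H' t) \<le> R \<and> ess_bd K (X' t)"
    if "l2sol s V' g' T X' H'" "ess_bdr a V'" "ess_bdr b g'" "AE x in lborel. V' x \<ge> 0" "AE x in lborel. g' x \<ge> 0"
      "norm (H' 0) \<le> h" "t \<in> {0..T}" for V' g' t and X' H' :: "real \<Rightarrow> 'a l2"
  proof
    have "sqrt ((norm (H' t))\<^sup>2) \<le> R"
      unfolding R_def by (rule real_sqrt_le_mono[OF Hs_bound[OF s0 C that(2,3,4,5,1,7,6)]])
    then show R: "norm (H' t) \<le> R" by simp
    have "FF (X' t) = mul (wt (- s / 2)) (H' t)" using that(1,7) by (simp add: l2sol_def)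
    from C(2)[OF this] have "ess_bd (C * norm (H' t)) (X' t)" .
    moreover have "C * norm (H' t) \<le> K" unfolding K_def by (rule mult_left_mono[OF R C(1)])
    ultimately show "ess_bd K (X' t)" unfolding ess_bd_def by (auto elim: eventually_mono)
  qed
  have sol: "l2sol s V g T (\<lambda>t. cls (u t)) (\<lambda>t. HH s (u t))"
    by (rule nls_l2sol[OF assms(9) Va gb assms(2)])
  have inu: "in_Hs s (u t)" if "t \<in> {0..T}" for t using assms(9) that by (simp add: nls_solution_def)
  have u00: "cls (u 0) = cls u0"
    using assms(9) in_Hs_D(1)[OF inu[OF zT]] Lu0 by (intro cls_eqI) (auto simp: nls_solution_def)
  \<comment> \<open>The initial condition holds only almost everywhere, so the two transforms are
    compared through the multiplier 1.\<close>
  have H0: "norm (HH s (u 0)) \<le> h"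
    using HH_mul[OF assms(7) inu[OF zT] bmeas_const[of 1]] u00 by (simp add: h_def)
  obtain p where p: "(p \<longlongrightarrow> 0) (at_right 0)" "\<And>\<epsilon>. p \<epsilon> \<ge> 0"
    "\<forall>\<^sub>F \<epsilon> in at_right 0. AE x in lborel. \<bar>conv_real V (moll \<psi> \<omega> \<epsilon>) x - V x\<bar> \<le> p \<epsilon>"
    using esssup_tendsto_bound[OF assms(15)] by blast
  obtain q where q: "(q \<longlongrightarrow> 0) (at_right 0)" "\<And>\<epsilon>. q \<epsilon> \<ge> 0"
    "\<forall>\<^sub>F \<epsilon> in at_right 0. AE x in lborel. \<bar>conv_real g (moll \<psi> \<omega> \<epsilon>) x - g x\<bar> \<le> q \<epsilon>"
    using esssup_tendsto_bound[OF assms(16)] by blast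
  define k where "k = exp ((2 * (a + 3 * b * K\<^sup>2) + 1) * T)"
  define c where "c = FT_const TYPE('a)"
  have c: "c > 0" by (simp add: c_def)
  \<comment> \<open>The estimate of \<open>l2sol_difference\<close> divided by Parseval's constant;
    \<epsilon> enters only through the initial error and the two coefficient errors.\<close>
  define E where "E \<epsilon> = inverse c * (k * ((norm (mul (dil (\<omega> \<epsilon>)) z - z))\<^sup>2 + ((p \<epsilon> + q \<epsilon> * K\<^sup>2) * R)\<^sup>2 * T))" for \<epsilon>
  have "\<forall>\<^sub>F \<epsilon> in at_right (0::real). \<epsilon> \<in> {0<..<1}" by (rule eventually_at_right_real) simp
  moreover have "\<forall>\<^sub>F \<epsilon> in at_right 0. p \<epsilon> < 1" using order_tendstoD(2)[OF p(1), of 1] by simp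
  moreover have "\<forall>\<^sub>F \<epsilon> in at_right 0. q \<epsilon> < 1" using order_tendstoD(2)[OF q(1), of 1] by simp
  ultimately have bound: "\<forall>\<^sub>F \<epsilon> in at_right 0.
      (\<integral>\<^sup>+x. ennreal ((cmod (u_eps \<epsilon> t x - u t x))\<^sup>2) \<partial>lborel) \<le> ennreal (E \<epsilon>)"
    using p(3) q(3)
  proof eventually_elim
    case (elim \<epsilon>)
    define V' where "V' = conv_real V (moll \<psi> \<omega> \<epsilon>)"
    define g' where "g' = conv_real g (moll \<psi> \<omega> \<epsilon>)"
    have e: "\<epsilon> \<in> {0<..1}" using elim(1) by simp
    have w: "\<omega> \<epsilon> > 0" using assms(13) e by blast
    have mm: "moll \<psi> \<omega> \<epsilon> \<in> borel_measurable borel" unfolding moll_def[abs_def] by measurable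
    have mn: "moll \<psi> \<omega> \<epsilon> y \<ge> 0" for y using nn by (simp add: moll_def)
    have bd: "ess_bdr (a1 + 1) (conv_real W (moll \<psi> \<omega> \<epsilon>))"
      if "ess_bdr a1 W" "AE x in lborel. \<bar>conv_real W (moll \<psi> \<omega> \<epsilon>) x - W x\<bar> \<le> r" "r < 1" for a1 W r
      unfolding ess_bdr_def
    proof (intro conjI)
      show "conv_real W (moll \<psi> \<omega> \<epsilon>) \<in> borel_measurable borel"
        by (rule conv_real_measurable[OF _ mm]) (use that in \<open>simp add: ess_bdr_def\<close>)
      show "0 \<le> a1 + 1" using that by (simp add: ess_bdr_def)
      show "AE t in lborel. \<bar>conv_real W (moll \<psi> \<omega> \<epsilon>) t\<bar> \<le> a1 + 1"
        using that(1)[unfolded ess_bdr_def, THEN conjunct2, THEN conjunct2] that(2)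
        by eventually_elim (use that(3) in linarith)
    qed
    have Va': "ess_bdr a V'" unfolding V'_def a_def by (rule bd[OF a0 elim(4,2)])
    have gb': "ess_bdr b g'" unfolding g'_def b_def by (rule bd[OF b0 elim(5,3)])
    \<comment> \<open>Positivity survives mollification, so the regularised potential energy is
      nonnegative and the uniform Sobolev bound applies to \<open>u_eps\<close>.\<close>
    have V0': "AE x in lborel. V' x \<ge> 0"
      unfolding V'_def by (intro AE_I2 conv_real_nonneg[OF _ assms(5) mn]) (use a0 in \<open>simp add: ess_bdr_def\<close>)
    have g0': "AE x in lborel. g' x \<ge> 0"
      unfolding g'_def by (intro AE_I2 conv_real_nonneg[OF _ assms(6) mn]) (use b0 in \<open>simp add: ess_bdr_def\<close>)
    have nls': "nls_solution s V' g' (conv_cplx u0 (moll \<psi> \<omega> \<epsilon>)) T (u_eps \<epsilon>)"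
      using assms(17) e by (simp add: V'_def g'_def)
    have sol': "l2sol s V' g' T (\<lambda>t. cls (u_eps \<epsilon> t)) (\<lambda>t. HH s (u_eps \<epsilon> t))"
      by (rule nls_l2sol[OF nls' Va' gb' assms(2)])
    have inu': "in_Hs s (u_eps \<epsilon> t)" if "t \<in> {0..T}" for t using nls' that by (simp add: nls_solution_def)
    have init: "FF (cls (u_eps \<epsilon> 0)) = mul (dil (\<omega> \<epsilon>)) z"
      unfolding z_def
      by (rule FF_conv[where \<omega>=\<omega> and \<epsilon>=\<epsilon>, OF w nn Lu0 in_Hs_D(1)[OF inu'[OF zT]]]) (use nls' in \<open>simp add: nls_solution_def\<close>)
    have H0': "norm (HH s (u_eps \<epsilon> 0)) \<le> h"
    proof -
      have "HH s (u_eps \<epsilon> 0) = mul (dil (\<omega> \<epsilon>)) (HH s u0)"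
        by (rule HH_mul[OF assms(7) inu'[OF zT] bmeas_dil[OF nn] init[unfolded z_def]])
      moreover have "norm (mul (dil (\<omega> \<epsilon>)) (HH s u0)) \<le> 1 * norm (HH s u0)"
        by (rule norm_mul_le[OF norm_dil_le[OF nn]])
      ultimately show ?thesis by (simp add: h_def)
    qed
    have "(norm (FF (cls (u_eps \<epsilon> t)) - FF (cls (u t))))\<^sup>2 \<le>
      k * ((norm (FF (cls (u_eps \<epsilon> 0)) - FF (cls (u 0))))\<^sup>2 + ((p \<epsilon> + q \<epsilon> * K\<^sup>2) * R)\<^sup>2 * T)"
      unfolding k_def
    proof (rule l2sol_difference[OF s0 sol sol' Va gb Va' gb' _ _ _ _ _ p(2) q(2) t])
      show "ess_bd K (cls (u t))" "norm (HH s (u t)) \<le> R" if "t \<in> {0..T}" for t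
        using HR[OF sol Va gb assms(5,6) H0 that] by simp_all
      show "ess_bd K (cls (u_eps \<epsilon> t))" if "t \<in> {0..T}" for t
        using HR[OF sol' Va' gb' V0' g0' H0' that] by simp
    qed (use elim(4,5) in \<open>simp_all add: V'_def g'_def\<close>)
    then have "inverse c * (norm (FF (cls (u_eps \<epsilon> t)) - FF (cls (u t))))\<^sup>2 \<le> E \<epsilon>"
      unfolding E_def init u00 z_def[symmetric] using c by (intro mult_left_mono) auto
    moreover have "inverse c * (norm (FF (cls (u_eps \<epsilon> t)) - FF (cls (u t))))\<^sup>2 = (norm (cls (u_eps \<epsilon> t) - cls (u t)))\<^sup>2"
      unfolding FF_diff[symmetric] norm_FF power_mult_distrib c_def by (simp add: less_imp_le)
    moreover have "(\<integral>\<^sup>+x. ennreal ((cmod (u_eps \<epsilon> t x - u t x))\<^sup>2) \<partial>lborel) = ennreal ((norm (cls (u_eps \<epsilon> t) - cls (u t)))\<^sup>2)"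
      using in_Hs_D(1)[OF inu[OF t]] in_Hs_D(1)[OF inu'[OF t]] by (simp add: nn_integral_cls L2_diff cls_diff)
    ultimately show ?case by (simp add: ennreal_leI)
  qed
  have "(E \<longlongrightarrow> 0) (at_right 0)"
  proof -
    \<comment> \<open>\<open>dil_tendsto\<close> is a limit at a punctured neighbourhood, hence the
      scale must also be shown to be nonzero eventually.\<close>
    have "filterlim \<omega> (at 0) (at_right 0)"
      unfolding filterlim_at
    proof
      have "\<forall>\<^sub>F \<epsilon> in at_right (0::real). \<epsilon> \<in> {0<..<1}" by (rule eventually_at_right_real) simp
      then show "\<forall>\<^sub>F \<epsilon> in at_right 0. \<omega> \<epsilon> \<in> UNIV \<and> \<omega> \<epsilon> \<noteq> 0"
        by eventually_elim (use assms(13) in force)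
    qed (rule assms)
    from filterlim_compose[OF dil_tendsto[OF nn] this]
    have "((\<lambda>\<epsilon>. mul (dil (\<omega> \<epsilon>)) z) \<longlongrightarrow> z) (at_right 0)" .
    then have "(E \<longlongrightarrow> inverse c * (k * ((norm (z - z))\<^sup>2 + ((0 + 0 * K\<^sup>2) * R)\<^sup>2 * T))) (at_right 0)"
      unfolding E_def by (intro tendsto_intros p(1) q(1))
    then show ?thesis by simp
  qed
  then have "((\<lambda>\<epsilon>. ennreal (E \<epsilon>)) \<longlongrightarrow> 0) (at_right 0)"
    using tendsto_ennrealI by fastforce
  then show "((\<lambda>\<epsilon>. \<integral>\<^sup>+x. ennreal ((cmod (u_eps \<epsilon> t x - u t x))\<^sup>2) \<partial>lborel) \<longlongrightarrow> 0) (at_right 0)"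
    by (rule tendsto_sandwich[OF _ bound tendsto_const, rotated]) simp
qed

end
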